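(* Let $a\in\mathbb{C}\setminus\{0,-1\}$. On the contact superspace $M=\mathbb{C}^{1|4}(y|\theta_1,\theta_2,\nu_1,\nu_2)$ with contact form $\sigma=dy+\nu_1\,d\theta_1+\nu_2\,d\theta_2$ consider the linear differential system $\mathcal{E}$ on a function $f=f(y,\theta_1,\theta_2,\nu_1,\nu_2)$: $$\bigl((a+1)\partial_y^2+2\partial_{\theta_1}\partial_{\theta_2}\partial_{\nu_1}\partial_{\nu_2}\bigr)(f)=0,\quad \partial_y\partial_{\theta_1}\partial_{\nu_2}(f)=0,\quad \partial_y\partial_{\theta_2}\partial_{\nu_1}(f)=0,$$ $$\partial_y\partial_{\theta_1}\partial_{\theta_2}(f)=0,\quad \partial_y\partial_{\nu_1}\partial_{\nu_2}(f)=0,\quad \partial_y\partial_{\theta_1}\partial_{\nu_1}(f)=\partial_y\partial_{\theta_2}\partial_{\nu_2}(f),$$ $$\bigl((a+1)\partial_y\partial_{\nu_k}-(-1)^k\partial_{\theta_{3-k}}\partial_{\nu_1}\partial_{\nu_2}\bigr)(f)=0,\quad \nu_k\bigl(a\,\partial_y\partial_{\theta_k}-(-1)^k\partial_{\theta_1}\partial_{\theta_2}\partial_{\nu_{3-k}}\bigr)(f)=0\qquad(k=1,2).$$ Then the Lie superalgebra $D(2,1;a)$ is the symmetry subalgebra of the (infinitely prolonged) differential system $\mathcal{E}^\infty$ within the algebra of (lifted, prolonged) contact vector fields $\mathfrak{cont}^{(\infty)}(M)\subset\mathfrak{vect}(J^\infty M)$.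
   Context: $y$ is even; $\theta_j,\nu_j$ are odd. With $D_{\theta_j}=\partial_{\theta_j}+\nu_j\partial_y$, the contact vector fields on $M$ (preserving $\ker\sigma$) are $X_f=f\partial_y+(-1)^{|f|}\sum_{j=1}^2\bigl(D_{\theta_j}(f)\partial_{\nu_j}+\partial_{\nu_j}(f)D_{\theta_j}\bigr)$ for functions $f$ on $M$, forming the Lie superalgebra $\mathfrak{cont}(M)$. (The contact superspace $M$ is locally the jet space $J^1(\mathbb{C}^{0|2},\mathbb{C}^{1|0})$, over which $M^{2|4}=G/P_{12}^{\rm I}$ is locally $J^2(\mathbb{C}^{0|2},\mathbb{C}^{1|0})$, and contact fields on $M$ prolong uniquely to the latter.) $J^0M=M\times\mathbb{C}$ has additional even coordinate $h$ (dependent variable), and $J^kM$, $J^\infty M$ are jet spaces of functions $h$ on $M$. Contact fields are lifted by $X_f\mapsto X_f+f_y\,h\,\partial_h$, $f_y=\partial_yf$, and prolonged in the standard way to $J^\infty M$, giving $\mathfrak{cont}^{(\infty)}(M)$. The system $\mathcal{E}$ (unknown function $h=f$) with all its prolongations is a submanifold $\mathcal{E}^\infty\subset J^\infty M$; a symmetry is a vector field whose prolongation preserves the ideal of the system (equivalently maps solutions to solutions). $D(2,1;a)=\Gamma(-1-a,1,a)$, where for $s_1+s_2+s_3=0$, $\Gamma(s_1,s_2,s_3)$ is the Lie superalgebra with even part $\mathfrak{sl}_2^{\oplus3}$ ($i$-th copy with standard basis $X_i,H_i,Y_i$), odd part $\mathbb{C}^2\boxtimes\mathbb{C}^2\boxtimes\mathbb{C}^2$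 (each $\mathbb{C}^2=\langle x,y\rangle$ standard: $X=x\partial_y$, $H=x\partial_x-y\partial_y$, $Y=y\partial_x$), and odd-odd bracket $[v_1v_2v_3,w_1w_2w_3]=s_1\varphi_1(v_1w_1)\eta_2(v_2,w_2)\eta_3(v_3,w_3)+s_2\eta_1(v_1,w_1)\varphi_2(v_2w_2)\eta_3(v_3,w_3)+s_3\eta_1(v_1,w_1)\eta_2(v_2,w_2)\varphi_3(v_3w_3)$, with $\eta_i$ skew, $\eta_i(x,y)=1$, $\varphi_i:x^2\mapsto X_i,\ -2xy\mapsto H_i,\ -y^2\mapsto Y_i$. Up to isomorphism $D(2,1;a)$ depends only on the orbit of $a$ under $a\mapsto1/a$, $a\mapsto-1-a$. *)

theory Defs
  imports "HOL-Analysis.Analysis" "HOL-Library.Function_Algebras"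
begin

section \<open>Coordinates and superfunctions on the jet superspace\<close>

datatype odd_var = Theta1 | Theta2 | Nu1 | Nu2

text \<open>
  Coordinates of the infinite jet space of functions on M. The coordinates of M itself are
  \<open>Yc\<close> and \<open>Oc i\<close>. The fibre coordinate \<open>Jet m I\<close> stands for the derivative
  of h obtained by applying m times the y-derivative and the odd left derivatives indexed by I,
  composed in the order Theta1, Theta2, Nu1, Nu2 from left to right. As h is even, its parity is
  that of the cardinality of I.
\<close>

datatype coord = Yc | Oc odd_var | Jet nat "odd_var set"

definition base :: "coord set" where
  "base = {Yc, Oc Theta1, Oc Theta2, Oc Nu1, Oc Nu2}"

definition theta :: "nat \<Rightarrow> coord" where
  "theta k = Oc (if k = 1 then Theta1 else Theta2)"

definition nu :: "nat \<Rightarrow> coord" where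
  "nu k = Oc (if k = 1 then Nu1 else Nu2)"

fun is_odd :: "coord \<Rightarrow> bool" where
  "is_odd Yc = False"
| "is_odd (Oc i) = True"
| "is_odd (Jet m I) = odd (card I)"

fun var_rank :: "odd_var \<Rightarrow> nat" where
  "var_rank Theta1 = 0"
| "var_rank Theta2 = 1"
| "var_rank Nu1 = 2"
| "var_rank Nu2 = 3"

text \<open>
  An injective numbering of the odd coordinates; it only serves to fix the order of the factors
  in monomials in anticommuting coordinates.
\<close>

fun rank :: "coord \<Rightarrow> nat" where
  "rank Yc = 0"
| "rank (Oc i) = var_rank i"
| "rank (Jet m I) = 4 + 16 * m + (\<Sum>i\<in>I. 2 ^ var_rank i)"

text \<open>
  \<open>F K z\<close> is the coefficient, at the point z, of the monomial which is the product of the odd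
  coordinates in K in increasing order of rank. Points assign a number to every coordinate, but
  superfunctions depend on the values at even coordinates only. They involve finitely many
  coordinates (so they live on a jet space of finite order), and their coefficients are
  holomorphic, i.e. continuous and holomorphic in each even coordinate separately.
\<close>

type_synonym superfun = "coord set \<Rightarrow> (coord \<Rightarrow> complex) \<Rightarrow> complex"

definition superfun_in :: "coord set \<Rightarrow> superfun \<Rightarrow> bool" where
  "superfun_in S F \<longleftrightarrow>
     (\<forall>K z. F K z \<noteq> 0 \<longrightarrow> K \<subseteq> {c \<in> S. is_odd c}) \<and>
     (\<forall>K z z'. (\<forall>c\<in>S. \<not> is_odd c \<longrightarrow> z c = z' c) \<longrightarrow> F K z = F K z') \<and>
     (\<forall>K. continuous_on UNIV (F K)) \<and>
     (\<forall>K z c. (\<lambda>t. F K (z(c := t))) holomorphic_on UNIV)"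

definition superfun :: "superfun \<Rightarrow> bool" where
  "superfun F \<longleftrightarrow> (\<exists>S. finite S \<and> superfun_in S F)"

definition fun_on_M :: "superfun \<Rightarrow> bool" where
  "fun_on_M f \<longleftrightarrow> superfun_in base f"

definition scal :: "complex \<Rightarrow> superfun \<Rightarrow> superfun" where
  "scal a F = (\<lambda>K z. a * F K z)"

definition one_sf :: superfun where
  "one_sf = (\<lambda>K z. if K = {} then 1 else 0)"

definition coord_fun :: "coord \<Rightarrow> superfun" where
  "coord_fun c = (\<lambda>K z. if is_odd c then (if K = {c} then 1 else 0)
                                else (if K = {} then z c else 0))"

definition reorder_sign :: "coord set \<Rightarrow> coord set \<Rightarrow> complex" where
  "reorder_sign I J = (-1) ^ card {(i, j). i \<in> I \<and> j \<in> J \<and> rank j < rank i}"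

text \<open>
  The supercommutative product (the instance of \<open>(*)\<close> on functions is the pointwise product,
  which is not used for superfunctions).
\<close>

definition sprod :: "superfun \<Rightarrow> superfun \<Rightarrow> superfun" (infixl "\<otimes>" 70) where
  "F \<otimes> G = (\<lambda>K z. \<Sum>I\<in>Pow K. reorder_sign I (K - I) * F I z * G (K - I) z)"

text \<open>The parity involution, equal to \<open>(-1) ^ |F|\<close> times F on homogeneous F.\<close>

definition parity :: "superfun \<Rightarrow> superfun" where
  "parity F = (\<lambda>K z. (-1) ^ card K * F K z)"

text \<open>Partial derivatives; for odd coordinates these are left derivatives.\<close>

definition pd :: "coord \<Rightarrow> superfun \<Rightarrow> superfun" where
  "pd c F = (\<lambda>K z.
     if is_odd c
     then (if c \<in> K then 0 else (-1) ^ card {i \<in> K. rank i < rank c} * F (insert c K) z)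
     else deriv (\<lambda>t. F K (z(c := t))) (z c))"


section \<open>Vector fields\<close>

text \<open>
  A vector field is given by its coefficients: V stands for the sum over all coordinates c of
  \<open>V c\<close> times the partial derivative along c. For a superfunction F only finitely many
  \<open>pd c F\<close> are non-zero.
\<close>

type_synonym vfield = "coord \<Rightarrow> superfun"

definition vf_apply :: "vfield \<Rightarrow> superfun \<Rightarrow> superfun" where
  "vf_apply V F = (\<Sum>c | pd c F \<noteq> 0. V c \<otimes> pd c F)"

definition vf_scal :: "complex \<Rightarrow> vfield \<Rightarrow> vfield" where
  "vf_scal a V = (\<lambda>c. scal a (V c))"

text \<open>Homogeneous components: the odd one for \<open>p = True\<close>, the even one for \<open>p = False\<close>.\<close>

definition vf_part :: "bool \<Rightarrow> vfield \<Rightarrow> vfield" where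
  "vf_part p V = (\<lambda>c K z. if (odd (card K) \<noteq> is_odd c) = p then V c K z else 0)"

definition vf_bracket :: "vfield \<Rightarrow> vfield \<Rightarrow> vfield" where
  "vf_bracket V W = (\<lambda>c. \<Sum>p\<in>{False, True}. \<Sum>q\<in>{False, True}.
     vf_apply (vf_part p V) (vf_part q W c)
     - scal (if p \<and> q then -1 else 1) (vf_apply (vf_part q W) (vf_part p V c)))"


section \<open>Total derivatives and prolongation\<close>

fun total_vf :: "coord \<Rightarrow> vfield" where
  "total_vf Yc c =
     (case c of Yc \<Rightarrow> one_sf | Oc j \<Rightarrow> 0 | Jet m I \<Rightarrow> coord_fun (Jet (Suc m) I))"
| "total_vf (Oc i) c =
     (case c of Yc \<Rightarrow> 0 | Oc j \<Rightarrow> (if j = i then one_sf else 0)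
      | Jet m I \<Rightarrow> (if i \<in> I then 0
          else scal ((-1) ^ card {j \<in> I. var_rank j < var_rank i}) (coord_fun (Jet m (insert i I)))))"
| "total_vf (Jet m I) c = 0"

definition D :: "coord \<Rightarrow> superfun \<Rightarrow> superfun" where
  "D b = vf_apply (total_vf b)"

definition D_multi :: "nat \<Rightarrow> odd_var set \<Rightarrow> superfun \<Rightarrow> superfun" where
  "D_multi m I F =
     (D Yc ^^ m) (foldr (\<lambda>i G. if i \<in> I then D (Oc i) G else G) [Theta1, Theta2, Nu1, Nu2] F)"

definition hfun :: superfun where
  "hfun = coord_fun (Jet 0 {})"

text \<open>
  The standard prolongation of a vector field V on the 0-jets (given by its coefficients along
  \<open>base\<close> and h). With the characteristic Q, it is the sum of the \<open>V b\<close> times the total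
  derivatives \<open>D b\<close>, plus the evolutionary vector field of Q. The latter supercommutes with
  the total derivatives, which gives the sign \<open>(-1) ^ (|V| |I|)\<close> in its coefficient along
  \<open>Jet m I\<close>; as h is even, Q has the same parity as V.
\<close>

definition characteristic :: "vfield \<Rightarrow> superfun" where
  "characteristic V = V (Jet 0 {}) - (\<Sum>b\<in>base. V b \<otimes> D b hfun)"

definition prolong :: "vfield \<Rightarrow> vfield" where
  "prolong V = (\<lambda>c. case c of
       Jet m I \<Rightarrow> (\<Sum>b\<in>base. V b \<otimes> D b (coord_fun (Jet m I)))
                 + D_multi m I ((parity ^^ card I) (characteristic V))
     | _ \<Rightarrow> V c)"


section \<open>Contact vector fields\<close>

text \<open>The derivation along the vector field \<open>\<partial>/\<partial>\<theta> + \<nu> \<partial>/\<partial>y\<close> of M.\<close>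

definition D_theta :: "nat \<Rightarrow> superfun \<Rightarrow> superfun" where
  "D_theta j f = pd (theta j) f + coord_fun (nu j) \<otimes> pd Yc f"

text \<open>
  The coefficients of the contact field with generating function f, obtained by expanding
  \<open>D_theta\<close> into partial derivatives. The sign \<open>(-1) ^ |f|\<close> is expressed through
  \<open>parity f\<close>, which extends the definition linearly to inhomogeneous f.
\<close>

definition contact_vf :: "superfun \<Rightarrow> vfield" where
  "contact_vf f = (\<lambda>c. case c of
       Yc \<Rightarrow> f + (\<Sum>j\<in>{1, 2}. pd (nu j) (parity f) \<otimes> coord_fun (nu j))
     | Oc Theta1 \<Rightarrow> pd (nu 1) (parity f)
     | Oc Theta2 \<Rightarrow> pd (nu 2) (parity f)
     | Oc Nu1 \<Rightarrow> D_theta 1 (parity f)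
     | Oc Nu2 \<Rightarrow> D_theta 2 (parity f)
     | Jet m I \<Rightarrow> 0)"

definition contact_lift :: "superfun \<Rightarrow> vfield" where
  "contact_lift f = (contact_vf f)(Jet 0 {} := pd Yc f \<otimes> hfun)"

definition cont_inf :: "vfield set" where
  "cont_inf = {prolong (contact_lift f) | f. fun_on_M f}"


section \<open>The differential system and its symmetries\<close>

definition system :: "complex \<Rightarrow> superfun set" where
  "system a =
     {scal (a + 1) (D Yc (D Yc hfun))
        + scal 2 (D (theta 1) (D (theta 2) (D (nu 1) (D (nu 2) hfun)))),
      D Yc (D (theta 1) (D (nu 2) hfun)),
      D Yc (D (theta 2) (D (nu 1) hfun)),
      D Yc (D (theta 1) (D (theta 2) hfun)),
      D Yc (D (nu 1) (D (nu 2) hfun)),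
      D Yc (D (theta 1) (D (nu 1) hfun)) - D Yc (D (theta 2) (D (nu 2) hfun))}
     \<union> {scal (a + 1) (D Yc (D (nu k) hfun))
          - scal ((-1) ^ k) (D (theta (3 - k)) (D (nu 1) (D (nu 2) hfun))) | k. k \<in> {1, 2}}
     \<union> {coord_fun (nu k) \<otimes>
          (scal a (D Yc (D (theta k) hfun))
           - scal ((-1) ^ k) (D (theta 1) (D (theta 2) (D (nu (3 - k)) hfun)))) | k. k \<in> {1, 2}}"

text \<open>
  The ideal of the infinitely prolonged system: the ideal generated by the equations and all
  their total derivatives. The generators are homogeneous, so left multiples suffice.
\<close>

inductive_set system_ideal :: "complex \<Rightarrow> superfun set" for a :: complex where
  equation: "E \<in> system a \<Longrightarrow> E \<in> system_ideal a"
| total: "F \<in> system_ideal a \<Longrightarrow> b \<in> base \<Longrightarrow> D b F \<in> system_ideal a"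
| add: "F \<in> system_ideal a \<Longrightarrow> G \<in> system_ideal a \<Longrightarrow> F + G \<in> system_ideal a"
| mult: "superfun G \<Longrightarrow> F \<in> system_ideal a \<Longrightarrow> G \<otimes> F \<in> system_ideal a"

definition contact_symmetries :: "complex \<Rightarrow> vfield set" where
  "contact_symmetries a =
     {V \<in> cont_inf. \<forall>F\<in>system_ideal a. vf_apply V F \<in> system_ideal a}"


section \<open>The Lie superalgebras \<open>\<Gamma>(s\<^sub>1, s\<^sub>2, s\<^sub>3)\<close> and \<open>D(2,1;a)\<close>\<close>

text \<open>Triples are coefficients with respect to the standard basis X, H, Y.\<close>

type_synonym sl2 = "complex \<times> complex \<times> complex"

datatype xy = Vx | Vy

type_synonym tensor3 = "xy \<Rightarrow> xy \<Rightarrow> xy \<Rightarrow> complex"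

type_synonym gamma = "(sl2 \<times> sl2 \<times> sl2) \<times> tensor3"

fun sl2_scal :: "complex \<Rightarrow> sl2 \<Rightarrow> sl2" where
  "sl2_scal k (x, h, y) = (k * x, k * h, k * y)"

fun sl2_bracket :: "sl2 \<Rightarrow> sl2 \<Rightarrow> sl2" where
  "sl2_bracket (x, h, y) (x', h', y') =
     (2 * (h * x' - x * h'), x * y' - y * x', 2 * (y * h' - h * y'))"

text \<open>Matrix entries (row, column) of an element in the standard representation.\<close>

fun sl2_mat :: "sl2 \<Rightarrow> xy \<Rightarrow> xy \<Rightarrow> complex" where
  "sl2_mat (x, h, y) Vx Vx = h"
| "sl2_mat (x, h, y) Vx Vy = x"
| "sl2_mat (x, h, y) Vy Vx = y"
| "sl2_mat (x, h, y) Vy Vy = - h"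

fun eta :: "xy \<Rightarrow> xy \<Rightarrow> complex" where
  "eta Vx Vy = 1"
| "eta Vy Vx = -1"
| "eta _ _ = 0"

fun phi :: "xy \<Rightarrow> xy \<Rightarrow> sl2" where
  "phi Vx Vx = (1, 0, 0)"
| "phi Vy Vy = (0, 0, -1)"
| "phi _ _ = (0, - 1 / 2, 0)"

fun even_bracket :: "sl2 \<times> sl2 \<times> sl2 \<Rightarrow> sl2 \<times> sl2 \<times> sl2 \<Rightarrow> sl2 \<times> sl2 \<times> sl2" where
  "even_bracket (A1, A2, A3) (B1, B2, B3) =
     (sl2_bracket A1 B1, sl2_bracket A2 B2, sl2_bracket A3 B3)"

fun even_act :: "sl2 \<times> sl2 \<times> sl2 \<Rightarrow> tensor3 \<Rightarrow> tensor3" where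
  "even_act (A1, A2, A3) u = (\<lambda>p q r.
     (\<Sum>t\<in>{Vx, Vy}. sl2_mat A1 p t * u t q r)
     + (\<Sum>t\<in>{Vx, Vy}. sl2_mat A2 q t * u p t r)
     + (\<Sum>t\<in>{Vx, Vy}. sl2_mat A3 r t * u p q t))"

definition odd_bracket ::
    "complex \<Rightarrow> complex \<Rightarrow> complex \<Rightarrow> tensor3 \<Rightarrow> tensor3 \<Rightarrow> sl2 \<times> sl2 \<times> sl2" where
  "odd_bracket s1 s2 s3 u w =
     (\<Sum>(p, q, r)\<in>{Vx, Vy} \<times> {Vx, Vy} \<times> {Vx, Vy}.
      \<Sum>(p', q', r')\<in>{Vx, Vy} \<times> {Vx, Vy} \<times> {Vx, Vy}.
        (sl2_scal (u p q r * w p' q' r' * s1 * eta q q' * eta r r') (phi p p'),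
         sl2_scal (u p q r * w p' q' r' * s2 * eta p p' * eta r r') (phi q q'),
         sl2_scal (u p q r * w p' q' r' * s3 * eta p p' * eta q q') (phi r r')))"

fun gamma_scal :: "complex \<Rightarrow> gamma \<Rightarrow> gamma" where
  "gamma_scal k ((A1, A2, A3), u) =
     ((sl2_scal k A1, sl2_scal k A2, sl2_scal k A3), \<lambda>p q r. k * u p q r)"

fun gamma_bracket :: "complex \<Rightarrow> complex \<Rightarrow> complex \<Rightarrow> gamma \<Rightarrow> gamma \<Rightarrow> gamma" where
  "gamma_bracket s1 s2 s3 (A, u) (B, w) =
     (even_bracket A B + odd_bracket s1 s2 s3 u w, even_act A w - even_act B u)"

definition D21_bracket :: "complex \<Rightarrow> gamma \<Rightarrow> gamma \<Rightarrow> gamma" where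
  "D21_bracket a = gamma_bracket (- 1 - a) 1 a"

text \<open>
  An isomorphism from the Lie superalgebra with underlying superspace \<open>gamma\<close> and given
  bracket onto a set of vector fields, which is then a Lie superalgebra of vector fields.
\<close>

definition lie_superalgebra_iso ::
    "(gamma \<Rightarrow> gamma \<Rightarrow> gamma) \<Rightarrow> vfield set \<Rightarrow> (gamma \<Rightarrow> vfield) \<Rightarrow> bool" where
  "lie_superalgebra_iso br L \<Phi> \<longleftrightarrow>
     bij_betw \<Phi> UNIV L \<and>
     (\<forall>u v. \<Phi> (u + v) = \<Phi> u + \<Phi> v) \<and>
     (\<forall>k u. \<Phi> (gamma_scal k u) = vf_scal k (\<Phi> u)) \<and>
     (\<forall>A. vf_part False (\<Phi> (A, 0)) = \<Phi> (A, 0)) \<and>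
     (\<forall>u. vf_part True (\<Phi> (0, u)) = \<Phi> (0, u)) \<and>
     (\<forall>u v. \<Phi> (br u v) = vf_bracket (\<Phi> u) (\<Phi> v))"

end

theory Submission
  imports Defs "HOL-Complex_Analysis.Complex_Analysis"
begin

text \<open>
  For a function s on M let \<open>W\<^sub>s\<close> be the prolongation of the vertical field \<open>s \<partial>/\<partial>h\<close>. The bracket
  of the lifted contact field \<open>X\<^sub>f\<close> with \<open>W\<^sub>s\<close> is \<open>W\<^sub>k\<close>, where k is the Lagrange bracket
  \<open>{f, s} = X\<^sub>f(s) - f\<^sub>y s\<close>, so the symmetries are the \<open>X\<^sub>f\<close> for which \<open>{f, _}\<close> preserves the
  solutions of the system. The solutions form an explicit space of dimension (9|8), which is closed
  under the Lagrange bracket and isomorphic to \<open>D(2,1;a)\<close>.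

  If f is a solution, then \<open>X\<^sub>f\<close> is a symmetry: modulo the ideal every jet is a combination of 17
  free jets, which are separated by the solutions, so a linear function on the jets that all
  \<open>W\<^sub>s\<close> with s a solution annihilate lies in the ideal. Conversely, let \<open>X\<^sub>f\<close> be a symmetry. The ideal
  contains no non-zero function on M, so \<open>{f, s}\<close> is a solution for every even solution s. Taking
  for s the generating function of the Euler field shows that f is a solution, since no equation of the
  system meets a component of Euler weight 0.
\<close>

section \<open>The algebra of superfunctions\<close>

text \<open>The ideal is generated over all superfunctions on the jet space and under repeated total
  derivatives, so membership cannot be tested directly. It becomes linear algebra because contact
  fields are lifted linearly in h: they send equations to functions linear in the jets with
  coefficients on M, and each \<open>W_s\<close> sends such a function to a function on M. For a
  function on M, membership in the ideal means being zero.

  The constants in the solutions are forced. With y of degree 2 and the odd coordinates of degree 1,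
  the grading element lies in the middle \<open>sl2\<close>, whose parameter \<open>s2 = 1\<close>
  fits the normalisation of the Lagrange bracket. The parameters \<open>s3 = a\<close> and
  \<open>s1 = -(a + 1)\<close> of the other two factors reappear, up to sign, in the cubic terms,
  and \<open>a + 1\<close> again in the quartic one.

  The two equations with a factor \<open>nu k\<close> do not give the expression P behind the factor
  directly. Differentiating them along \<open>nu k\<close> shows that P is congruent to
  \<open>nu k\<close> times its own derivative, and this is enough to reduce P to free jets.\<close>

lemma UNIV_odd_var: "(UNIV :: odd_var set) = {Theta1, Theta2, Nu1, Nu2}"
  using odd_var.exhaust by auto

instance odd_var :: finite
  by standard (simp add: UNIV_odd_var)

lemma sum_odd_var:
  "(\<Sum>i\<in>I. g i) = (\<Sum>i\<in>UNIV. if i \<in> I then g i else (0 :: 'a :: comm_monoid_add))" for I :: "odd_var set"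
  using sum.inter_restrict[of "UNIV :: odd_var set" g I] by simp

lemma all_odd_var: "(\<forall>i. P i) \<longleftrightarrow> P Theta1 \<and> P Theta2 \<and> P Nu1 \<and> P Nu2"
proof
  assume "P Theta1 \<and> P Theta2 \<and> P Nu1 \<and> P Nu2"
  then have "P i" for i by (cases i) auto
  then show "\<forall>i. P i" ..
qed simp

lemma odd_var_set_eq:
  "I = J \<longleftrightarrow> (Theta1 \<in> I \<longleftrightarrow> Theta1 \<in> J) \<and> (Theta2 \<in> I \<longleftrightarrow> Theta2 \<in> J) \<and>
    (Nu1 \<in> I \<longleftrightarrow> Nu1 \<in> J) \<and> (Nu2 \<in> I \<longleftrightarrow> Nu2 \<in> J)"
  unfolding set_eq_iff all_odd_var by blast

lemma odd_code_less: "(\<Sum>i\<in>I. 2 ^ var_rank i) < (16::nat)"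
  by (subst sum_odd_var) (simp add: UNIV_odd_var)

text \<open>A binary expansion: \<open>digit\<close> peels off the lowest digit, and the membership
  of the four variables is read off in turn.\<close>

lemma odd_code_inj:
  assumes "(\<Sum>i\<in>I. 2 ^ var_rank i) = (\<Sum>i\<in>J. 2 ^ var_rank i :: nat)"
  shows "I = J"
proof -
  let ?b = "\<lambda>i I. of_bool (i \<in> I) :: nat"
  let ?s = "\<lambda>I. ?b Theta1 I + 2 * (?b Theta2 I + 2 * (?b Nu1 I + 2 * ?b Nu2 I))"
  have s: "(\<Sum>i\<in>I. 2 ^ var_rank i) = ?s I" for I
    by (subst sum_odd_var) (simp add: UNIV_odd_var of_bool_def)
  have digit: "P = Q \<and> x = y" if "of_bool P + 2 * x = of_bool Q + 2 * y" for P Q and x y :: nat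
    using that by (cases P; cases Q) (simp_all, presburger+)
  have "?s I = ?s J" using assms unfolding s .
  from digit[OF this] have 1: "(Theta1 \<in> I) = (Theta1 \<in> J)"
    and "?b Theta2 I + 2 * (?b Nu1 I + 2 * ?b Nu2 I) = ?b Theta2 J + 2 * (?b Nu1 J + 2 * ?b Nu2 J)"
    by blast+
  from digit[OF this(2)] have 2: "(Theta2 \<in> I) = (Theta2 \<in> J)"
    and "?b Nu1 I + 2 * ?b Nu2 I = ?b Nu1 J + 2 * ?b Nu2 J"
    by blast+
  from digit[OF this(2)] have "(Nu1 \<in> I) = (Nu1 \<in> J)" "(Nu2 \<in> I) = (Nu2 \<in> J)"
    by (simp_all add: of_bool_eq_iff)
  then show ?thesis using 1 2 by (simp add: odd_var_set_eq)
qed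

lemma var_rank_inj: "var_rank i = var_rank j \<longleftrightarrow> i = j"
  by (cases i; cases j) auto

lemma var_rank_lt: "var_rank i < 4"
  by (cases i) auto

text \<open>The coordinates \<open>Oc i\<close> have ranks below 4, and each order \<open>m\<close>
  of jets has its own block of 16 ranks, so different blocks never meet. Oddness matters:
  \<open>Yc\<close> and \<open>Oc Theta1\<close> share the rank 0.\<close>

lemma rank_inj: "is_odd c \<Longrightarrow> is_odd d \<Longrightarrow> rank c = rank d \<longleftrightarrow> c = d"
proof (cases c; cases d)
  fix m I n J assume *: "c = Jet m I" "d = Jet n J"
  let ?s = "\<lambda>I. (\<Sum>i\<in>I. 2 ^ var_rank i) :: nat"
  have "rank c = rank d \<Longrightarrow> m = n \<and> I = J"
    using odd_code_less[of I] odd_code_less[of J] odd_code_inj[of I J] * by (cases m n rule: linorder_cases) auto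
  then show "rank c = rank d \<longleftrightarrow> c = d" using * by auto
next
  fix i n J assume "c = Oc i" "d = Jet n J"
  then show "rank c = rank d \<longleftrightarrow> c = d" using var_rank_lt[of i] by simp
next
  fix i n J assume "d = Oc i" "c = Jet n J"
  then show "rank c = rank d \<longleftrightarrow> c = d" using var_rank_lt[of i] by simp
qed (auto simp: var_rank_inj)

section \<open>Signs of reorderings\<close>

lemma pairs_finite: "finite I \<Longrightarrow> finite J \<Longrightarrow> finite {(i, j). i \<in> I \<and> j \<in> J \<and> P i j}"
  by (rule finite_subset[of _ "I \<times> J"]) auto

text \<open>Inversions are pairs, so their number is additive when one of the two sets is
  split.\<close>

lemma reorder_sign_un_left:
  assumes "finite I" "finite I'" "finite J" "I \<inter> I' = {}"
  shows "reorder_sign (I \<union> I') J = reorder_sign I J * reorder_sign I' J"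
proof -
  let ?A = "\<lambda>I. {(i, j). i \<in> I \<and> j \<in> J \<and> rank j < rank i}"
  have "?A (I \<union> I') = ?A I \<union> ?A I'" by auto
  moreover have "card (?A I \<union> ?A I') = card (?A I) + card (?A I')"
    using assms by (intro card_Un_disjoint pairs_finite) auto
  ultimately show ?thesis by (simp add: reorder_sign_def power_add)
qed

lemma reorder_sign_un_right:
  assumes "finite I" "finite J" "finite J'" "J \<inter> J' = {}"
  shows "reorder_sign I (J \<union> J') = reorder_sign I J * reorder_sign I J'"
proof -
  let ?A = "\<lambda>J. {(i, j). i \<in> I \<and> j \<in> J \<and> rank j < rank i}"
  have "?A (J \<union> J') = ?A J \<union> ?A J'" by auto
  moreover have "card (?A J \<union> ?A J') = card (?A J) + card (?A J')"
    using assms by (intro card_Un_disjoint pairs_finite) auto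
  ultimately show ?thesis by (simp add: reorder_sign_def power_add)
qed

lemma reorder_sign_empty [simp]: "reorder_sign {} J = 1" "reorder_sign I {} = 1"
  by (simp_all add: reorder_sign_def)

lemma reorder_sign_single_left:
  "reorder_sign {c} J = (-1) ^ card {j \<in> J. rank j < rank c}"
proof -
  have "{(i, j). i \<in> {c} \<and> j \<in> J \<and> rank j < rank i} = Pair c ` {j \<in> J. rank j < rank c}"
    by auto
  then show ?thesis by (simp add: reorder_sign_def card_image inj_on_def)
qed

lemma reorder_sign_single_right:
  "reorder_sign I {c} = (-1) ^ card {i \<in> I. rank c < rank i}"
proof -
  have "{(i, j). i \<in> I \<and> j \<in> {c} \<and> rank j < rank i} = (\<lambda>i. (i, c)) ` {i \<in> I. rank c < rank i}"
    by auto
  then show ?thesis by (simp add: reorder_sign_def card_image inj_on_def)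
qed

lemma reorder_sign_insert_left:
  assumes "finite I" "finite J" "c \<notin> I"
  shows "reorder_sign (insert c I) J = reorder_sign {c} J * reorder_sign I J"
  using reorder_sign_un_left[of "{c}" I J] assms by simp

lemma reorder_sign_insert_right:
  assumes "finite I" "finite J" "c \<notin> J"
  shows "reorder_sign I (insert c J) = reorder_sign I {c} * reorder_sign I J"
  using reorder_sign_un_right[of I "{c}" J] assms by simp

lemma Int_Diff_disjoint': "(K - I) \<inter> I = {}"
  by auto

lemma reorder_sign_sq: "reorder_sign I J * reorder_sign I J = 1"
  by (simp add: reorder_sign_def flip: power_add)

text \<open>Ranks of distinct odd coordinates differ, so each of the \<open>card I * card J\<close>
  pairs is an inversion for exactly one of the two orders.\<close>

lemma reorder_sign_swap:
  assumes "finite I" "finite J" "I \<inter> J = {}" "I \<subseteq> {c. is_odd c}" "J \<subseteq> {c. is_odd c}"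
  shows "reorder_sign I J = (-1) ^ (card I * card J) * reorder_sign J I"
proof -
  let ?A = "{(i, j). i \<in> I \<and> j \<in> J \<and> rank j < rank i}"
  let ?B = "{(i, j). i \<in> I \<and> j \<in> J \<and> rank i < rank j}"
  have "I \<times> J = ?A \<union> ?B"
  proof -
    have "rank i \<noteq> rank j" if "i \<in> I" "j \<in> J" for i j
      using that assms by (metis IntI Set.CollectD empty_iff rank_inj subsetD)
    then show ?thesis by (auto simp: neq_iff)
  qed
  moreover have "card (?A \<union> ?B) = card ?A + card ?B"
    using assms by (intro card_Un_disjoint pairs_finite) auto
  ultimately have eq: "card I * card J = card ?A + card ?B"
    by (simp flip: card_cartesian_product)
  have "?B = prod.swap ` {(i, j). i \<in> J \<and> j \<in> I \<and> rank j < rank i}" by auto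
  then have "card ?B = card {(i, j). i \<in> J \<and> j \<in> I \<and> rank j < rank i}"
    by (simp add: card_image)
  then have "(-1) ^ (card I * card J) = reorder_sign I J * reorder_sign J I"
    by (simp add: eq reorder_sign_def power_add)
  then show ?thesis
    using reorder_sign_sq[of J I] by (simp add: mult.assoc)
qed

section \<open>The algebra laws of the product\<close>

lemma sprod_infinite: "infinite K \<Longrightarrow> (F \<otimes> G) K z = 0"
  by (simp add: sprod_def)

lemma sprod_assoc: "(F \<otimes> G) \<otimes> H = F \<otimes> (G \<otimes> H)"
proof (intro ext)
  fix K z
  show "(F \<otimes> G \<otimes> H) K z = (F \<otimes> (G \<otimes> H)) K z"
  proof (cases "finite K")
    case False
    then show ?thesis by (simp add: sprod_infinite)
  next
    case K: True
    let ?l = "\<lambda>(I, J). reorder_sign I (K - I) * (reorder_sign J (I - J) * F J z * G (I - J) z) * H (K - I) z"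
    let ?r = "\<lambda>(J, L). reorder_sign J (K - J) * F J z * (reorder_sign L (K - J - L) * G L z * H (K - J - L) z)"
    have fin: "I \<subseteq> K \<Longrightarrow> finite I" for I using K by (rule finite_subset[rotated])
    have "(F \<otimes> G \<otimes> H) K z = (\<Sum>x\<in>(SIGMA I:Pow K. Pow I). ?l x)"
      unfolding sprod_def sum_distrib_left sum_distrib_right
      using K fin by (subst sum.Sigma) auto
    \<comment> \<open>Both sides sum over ordered splittings of \<open>K\<close> into three blocks:
      the left side records the union of the first two blocks and the first one, the right side the
      first two blocks separately.\<close>
    also have "\<dots> = (\<Sum>x\<in>(SIGMA J:Pow K. Pow (K - J)). ?r x)"
    proof (rule sum.reindex_bij_witness[of _ "\<lambda>(J, L). (J \<union> L, J)" "\<lambda>(I, J). (J, I - J)"], goal_cases)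
      case (5 x)
      then obtain I J where x: "x = (I, J)" and J: "J \<subseteq> I" and I: "I \<subseteq> K" by auto
      have fI: "finite I" "finite J" "finite (I - J)" "finite (K - I)"
        using fin[OF I] K J finite_subset by auto
      have 1: "reorder_sign I (K - I) = reorder_sign J (K - I) * reorder_sign (I - J) (K - I)"
        using reorder_sign_un_left[of J "I - J" "K - I"] fI J by (simp add: Un_absorb1 subset_Un_eq)
      have 2: "K - J - (I - J) = K - I" using J by auto
      have 3: "K - J = (I - J) \<union> (K - I)" using J I by auto
      have 4: "reorder_sign J (K - J) = reorder_sign J (I - J) * reorder_sign J (K - I)"
        unfolding 3 using fI by (intro reorder_sign_un_right) auto
      show ?case unfolding x by (simp add: 1 2 4)
    qed auto
    also have "\<dots> = (F \<otimes> (G \<otimes> H)) K z"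
      unfolding sprod_def sum_distrib_left sum_distrib_right
      using K by (subst sum.Sigma) auto
    finally show ?thesis .
  qed
qed

lemma sprod_add_left: "(F + G) \<otimes> H = F \<otimes> H + G \<otimes> H"
  by (auto simp: sprod_def fun_eq_iff algebra_simps sum.distrib)

lemma sprod_add_right: "F \<otimes> (G + H) = F \<otimes> G + F \<otimes> H"
  by (auto simp: sprod_def fun_eq_iff algebra_simps sum.distrib)

lemma sprod_zero [simp]: "0 \<otimes> F = 0" "F \<otimes> 0 = 0"
  by (auto simp: sprod_def fun_eq_iff)

lemma sprod_minus_left: "(- F) \<otimes> H = - (F \<otimes> H)"
  by (auto simp: sprod_def fun_eq_iff sum_negf)

lemma sprod_minus_right: "F \<otimes> (- H) = - (F \<otimes> H)"
  by (auto simp: sprod_def fun_eq_iff sum_negf)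

lemma sprod_diff_left: "(F - G) \<otimes> H = F \<otimes> H - G \<otimes> H"
  unfolding diff_conv_add_uminus sprod_add_left sprod_minus_left ..

lemma sprod_diff_right: "F \<otimes> (G - H) = F \<otimes> G - F \<otimes> H"
  unfolding diff_conv_add_uminus sprod_add_right sprod_minus_right ..

lemma sprod_scal_left: "scal a F \<otimes> G = scal a (F \<otimes> G)"
  by (auto simp: sprod_def scal_def fun_eq_iff sum_distrib_left mult_ac)

lemma sprod_scal_right: "F \<otimes> scal a G = scal a (F \<otimes> G)"
  by (auto simp: sprod_def scal_def fun_eq_iff sum_distrib_left mult_ac)

lemma sprod_sum_left: "(\<Sum>i\<in>A. F i) \<otimes> G = (\<Sum>i\<in>A. F i \<otimes> G)"
  using sum_comp_morphism[of "\<lambda>X. X \<otimes> G" F A] by (simp add: sprod_add_left o_def)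

lemma sprod_sum_right: "G \<otimes> (\<Sum>i\<in>A. F i) = (\<Sum>i\<in>A. G \<otimes> F i)"
  using sum_comp_morphism[of "\<lambda>X. G \<otimes> X" F A] by (simp add: sprod_add_right o_def)

lemma scal_add: "scal a (F + G) = scal a F + scal a G"
  and scal_diff: "scal a (F - G) = scal a F - scal a G"
  and scal_minus: "scal a (- F) = - scal a F"
  and scal_zero [simp]: "scal a 0 = 0" "scal 0 F = 0"
  and scal_scal [simp]: "scal a (scal b F) = scal (a * b) F"
  and scal_one [simp]: "scal 1 F = F"
  and scal_m1: "scal (- a) F = - scal a F"
  by (auto simp: scal_def fun_eq_iff algebra_simps)

lemma scal_sum: "scal a (\<Sum>i\<in>A. F i) = (\<Sum>i\<in>A. scal a (F i))"
  using sum_comp_morphism[of "scal a" F A] by (simp add: scal_add o_def)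

lemma parity_add: "parity (F + G) = parity F + parity G"
  and parity_zero [simp]: "parity 0 = 0"
  and parity_scal: "parity (scal a F) = scal a (parity F)"
  and parity_one [simp]: "parity one_sf = one_sf"
  by (auto simp: parity_def fun_eq_iff algebra_simps scal_def one_sf_def)

lemma parity_parity [simp]: "parity (parity F) = F"
  by (auto simp: parity_def fun_eq_iff simp flip: power_add mult.assoc)

lemma parity_sum: "parity (\<Sum>i\<in>A. F i) = (\<Sum>i\<in>A. parity (F i))"
  using sum_comp_morphism[of "parity" F A] by (simp add: parity_add o_def)

lemma parity_sprod: "parity (F \<otimes> G) = parity F \<otimes> parity G"
proof (intro ext)
  fix K z
  show "parity (F \<otimes> G) K z = (parity F \<otimes> parity G) K z"
  proof (cases "finite K")
    case True
    have "card K = card I + card (K - I)" if "I \<subseteq> K" for I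
      using that True by (metis card_Diff_subset card_mono finite_subset le_add_diff_inverse)
    then show ?thesis
      unfolding parity_def sprod_def sum_distrib_left
      by (intro sum.cong refl) (simp add: power_add mult_ac)
  qed (simp add: parity_def sprod_def)
qed

section \<open>Parity, homogeneity and supercommutativity\<close>

definition sg :: "bool \<Rightarrow> complex" where
  "sg p = (if p then -1 else 1)"

lemma sg_simps [simp]: "sg True = -1" "sg False = 1" "sg p * sg p = 1"
  "sg p * (sg p * x) = x"
  by (auto simp: sg_def)

lemma sg_neq: "sg (p \<noteq> q) = sg p * sg q"
  by (auto simp: sg_def)

definition hom :: "bool \<Rightarrow> superfun \<Rightarrow> bool" where
  "hom p F \<longleftrightarrow> (\<forall>K z. F K z \<noteq> 0 \<longrightarrow> odd (card K) = p)"

lemma hom_parity: "hom p F \<Longrightarrow> parity F = scal (sg p) F"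
  by (auto simp: hom_def parity_def scal_def fun_eq_iff sg_def)

lemma hom_add: "hom p F \<Longrightarrow> hom p G \<Longrightarrow> hom p (F + G)"
  unfolding hom_def by (metis add_0 plus_fun_apply)

lemma hom_zero [simp]: "hom p 0"
  by (simp add: hom_def)

lemma hom_scal: "hom p F \<Longrightarrow> hom p (scal a F)"
  by (simp add: hom_def scal_def)

lemma hom_minus: "hom p F \<Longrightarrow> hom p (- F)"
  by (simp add: hom_def)

lemma hom_diff: "hom p F \<Longrightarrow> hom p G \<Longrightarrow> hom p (F - G)"
  using hom_add[of p F "- G"] hom_minus[of p G] by simp

lemma hom_sum: "(\<And>i. i \<in> A \<Longrightarrow> hom p (F i)) \<Longrightarrow> hom p (\<Sum>i\<in>A. F i)"
  by (induction A rule: infinite_finite_induct) (auto simp: hom_add)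

lemma hom_one: "hom False one_sf"
  by (auto simp: hom_def one_sf_def)

lemma hom_coord: "hom (is_odd c) (coord_fun c)"
  by (auto simp: hom_def coord_fun_def split: if_splits)

lemma hom_parityI: "hom p F \<Longrightarrow> hom p (parity F)"
  by (simp add: hom_def parity_def)

lemma hom_sprod:
  assumes "hom p F" "hom q G"
  shows "hom (p \<noteq> q) (F \<otimes> G)"
  unfolding hom_def
proof (intro allI impI)
  fix K z assume nz: "(F \<otimes> G) K z \<noteq> 0"
  then have K: "finite K" using sprod_infinite by blast
  from nz obtain I where I: "I \<subseteq> K" "F I z \<noteq> 0" "G (K - I) z \<noteq> 0"
    unfolding sprod_def by (smt (verit) PowD mult_eq_0_iff sum.neutral)
  then have "odd (card I) = p" "odd (card (K - I)) = q"
    using assms by (auto simp: hom_def)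
  moreover have "card K = card I + card (K - I)"
    using I K by (metis card_Diff_subset card_mono finite_subset le_add_diff_inverse)
  ultimately show "odd (card K) = (p \<noteq> q)" by auto
qed

text \<open>Zero alone is homogeneous of both parities. This separates even from odd contributions
  when only their sum is known to vanish.\<close>

lemma hom_eq_zero: "hom p F \<Longrightarrow> hom (\<not> p) F \<Longrightarrow> F = 0"
  by (auto simp: hom_def fun_eq_iff)

text \<open>The type also contains coefficients at infinite sets and at sets with even coordinates.
  Excluding these is the algebraic part of \<open>superfun\<close>, without the analytic conditions,
  and suffices for the commutation and unit laws.\<close>

definition oddsupp :: "superfun \<Rightarrow> bool" where
  "oddsupp F \<longleftrightarrow> (\<forall>K z. F K z \<noteq> 0 \<longrightarrow> finite K \<and> K \<subseteq> {c. is_odd c})"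

text \<open>The price of moving something of parity \<open>p\<close> past \<open>F\<close>, in a
  form that makes sense for inhomogeneous \<open>F\<close> too.\<close>

definition tw :: "bool \<Rightarrow> superfun \<Rightarrow> superfun" where
  "tw p F = (if p then parity F else F)"

lemma tw_simps [simp]: "tw True F = parity F" "tw False F = F"
  by (simp_all add: tw_def)

text \<open>Passing to complements exchanges the two blocks of a splitting, and
  \<open>reorder_sign_swap\<close> gives the sign. As \<open>F\<close> has parity \<open>p\<close>,
  this sign depends only on the block of \<open>G\<close>, where it is absorbed by
  \<open>tw p\<close>.\<close>

lemma sprod_commute:
  assumes "oddsupp F" "oddsupp G" "hom p F"
  shows "F \<otimes> G = tw p G \<otimes> F"
proof (intro ext)
  fix K z
  show "(F \<otimes> G) K z = (tw p G \<otimes> F) K z"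
  proof (cases "finite K")
    case True
    have "(F \<otimes> G) K z = (\<Sum>I\<in>Pow K. reorder_sign (K - I) I * F (K - I) z * G I z)"
      unfolding sprod_def
      by (rule sum.reindex_bij_witness[of _ "\<lambda>I. K - I" "\<lambda>I. K - I"]) (auto simp: double_diff)
    also have "\<dots> = (\<Sum>I\<in>Pow K. reorder_sign I (K - I) * tw p G I z * F (K - I) z)"
    proof (rule sum.cong[OF refl])
      fix I assume I: "I \<in> Pow K"
      show "reorder_sign (K - I) I * F (K - I) z * G I z =
        reorder_sign I (K - I) * tw p G I z * F (K - I) z"
      proof (cases "F (K - I) z = 0 \<or> G I z = 0")
        case False
        then have "odd (card (K - I)) = p"
          "I \<subseteq> {c. is_odd c}" "K - I \<subseteq> {c. is_odd c}" "finite I"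
          using assms by (auto simp: hom_def oddsupp_def)
        then show ?thesis
          using reorder_sign_swap[of "K - I" I, OF _ _ Int_Diff_disjoint'] True
          by (auto simp: tw_def parity_def power_mult uminus_power_if)
      qed (auto simp: tw_def parity_def)
    qed
    finally show ?thesis by (simp add: sprod_def)
  qed (simp add: sprod_infinite)
qed

text \<open>At infinite index sets every product is zero, so the unit laws hold only for
  superfunctions that vanish there.\<close>

lemma one_sprod: "oddsupp F \<Longrightarrow> one_sf \<otimes> F = F"
proof (intro ext)
  fix K z assume F: "oddsupp F"
  show "(one_sf \<otimes> F) K z = F K z"
  proof (cases "finite K")
    case True
    have "(one_sf \<otimes> F) K z = (\<Sum>I\<in>Pow K. if I = {} then F K z else 0)"
      unfolding sprod_def by (rule sum.cong) (auto simp: one_sf_def)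
    then show ?thesis using True by simp
  qed (use F in \<open>auto simp: sprod_infinite oddsupp_def\<close>)
qed

lemma sprod_one: "oddsupp F \<Longrightarrow> F \<otimes> one_sf = F"
proof (intro ext)
  fix K z assume F: "oddsupp F"
  show "(F \<otimes> one_sf) K z = F K z"
  proof (cases "finite K")
    case True
    have "(F \<otimes> one_sf) K z = (\<Sum>I\<in>Pow K. if I = K then F K z else 0)"
      unfolding sprod_def by (rule sum.cong) (auto simp: one_sf_def)
    then show ?thesis using True by simp
  qed (use F in \<open>auto simp: sprod_infinite oddsupp_def\<close>)
qed

section \<open>Closure properties and derivations\<close>

lemma superfun_inD:
  assumes "superfun_in S F"
  shows "F K z \<noteq> 0 \<Longrightarrow> K \<subseteq> S \<inter> {c. is_odd c}"
    and "(\<And>c. c \<in> S \<Longrightarrow> \<not> is_odd c \<Longrightarrow> z c = z' c) \<Longrightarrow> F K z = F K z'"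
    and "continuous_on UNIV (F K)"
    and "(\<lambda>t. F K (z(c := t))) holomorphic_on UNIV"
proof -
  show "F K z \<noteq> 0 \<Longrightarrow> K \<subseteq> S \<inter> {c. is_odd c}" using assms unfolding superfun_in_def by auto
  show "(\<And>c. c \<in> S \<Longrightarrow> \<not> is_odd c \<Longrightarrow> z c = z' c) \<Longrightarrow> F K z = F K z'"
    using assms unfolding superfun_in_def by metis
  show "continuous_on UNIV (F K)" "(\<lambda>t. F K (z(c := t))) holomorphic_on UNIV"
    using assms unfolding superfun_in_def by simp_all
qed

lemma superfun_inI:
  assumes "\<And>K z. F K z \<noteq> 0 \<Longrightarrow> K \<subseteq> S \<inter> {c. is_odd c}"
    and "\<And>K z z'. (\<And>c. c \<in> S \<Longrightarrow> \<not> is_odd c \<Longrightarrow> z c = z' c) \<Longrightarrow> F K z = F K z'"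
    and "\<And>K. continuous_on UNIV (F K)"
    and "\<And>K z c. (\<lambda>t. F K (z(c := t))) holomorphic_on UNIV"
  shows "superfun_in S F"
  unfolding superfun_in_def
proof (intro conjI allI impI)
  show "K \<subseteq> {c \<in> S. is_odd c}" if "F K z \<noteq> 0" for K z using assms(1)[OF that] by auto
  show "F K z = F K z'" if "\<forall>c\<in>S. \<not> is_odd c \<longrightarrow> z c = z' c" for K z z'
    using that by (intro assms(2)) auto
qed (rule assms)+

lemma superfun_in_mono: "superfun_in S F \<Longrightarrow> S \<subseteq> T \<Longrightarrow> superfun_in T F"
proof (rule superfun_inI)
  assume F: "superfun_in S F" and S: "S \<subseteq> T"
  show "K \<subseteq> T \<inter> {c. is_odd c}" if "F K z \<noteq> 0" for K z
    using superfun_inD(1)[OF F that] S by auto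
  show "F K z = F K z'" if "\<And>c. c \<in> T \<Longrightarrow> \<not> is_odd c \<Longrightarrow> z c = z' c" for K z z'
    using S by (intro superfun_inD(2)[OF F] that) auto
qed (rule superfun_inD; assumption)+

lemma superfun_in_zero [simp]: "superfun_in S 0"
  by (rule superfun_inI) auto

lemma superfun_in_add: "superfun_in S F \<Longrightarrow> superfun_in S G \<Longrightarrow> superfun_in S (F + G)"
proof (rule superfun_inI)
  assume F: "superfun_in S F" and G: "superfun_in S G"
  show "K \<subseteq> S \<inter> {c. is_odd c}" if "(F + G) K z \<noteq> 0" for K z
    using that superfun_inD(1)[OF F, of K z] superfun_inD(1)[OF G, of K z] by (cases "F K z = 0") auto
  show "(F + G) K z = (F + G) K z'" if "\<And>c. c \<in> S \<Longrightarrow> \<not> is_odd c \<Longrightarrow> z c = z' c" for K z z'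
    using superfun_inD(2)[OF F that] superfun_inD(2)[OF G that] by simp
  show "continuous_on UNIV ((F + G) K)" for K
    using continuous_on_add[OF superfun_inD(3)[OF F] superfun_inD(3)[OF G], of K K] by (simp add: plus_fun_def)
  show "(\<lambda>t. (F + G) K (z(c := t))) holomorphic_on UNIV" for K z c
    using holomorphic_on_add[OF superfun_inD(4)[OF F] superfun_inD(4)[OF G], of K z c K z c] by simp
qed

lemma superfun_in_scal: "superfun_in S F \<Longrightarrow> superfun_in S (scal a F)"
proof (rule superfun_inI)
  assume F: "superfun_in S F"
  show "K \<subseteq> S \<inter> {c. is_odd c}" if "scal a F K z \<noteq> 0" for K z
    using that superfun_inD(1)[OF F, of K z] by (auto simp: scal_def)
  show "scal a F K z = scal a F K z'" if "\<And>c. c \<in> S \<Longrightarrow> \<not> is_odd c \<Longrightarrow> z c = z' c" for K z z'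
    using superfun_inD(2)[OF F that] by (simp add: scal_def)
  show "continuous_on UNIV (scal a F K)" for K
    unfolding scal_def by (intro continuous_on_mult continuous_on_const superfun_inD(3)[OF F])
  show "(\<lambda>t. scal a F K (z(c := t))) holomorphic_on UNIV" for K z c
    unfolding scal_def by (intro holomorphic_on_mult holomorphic_on_const superfun_inD(4)[OF F])
qed

lemma superfun_in_minus: "superfun_in S F \<Longrightarrow> superfun_in S (- F)"
  using superfun_in_scal[of S F "-1"] by (simp add: scal_m1)

lemma superfun_in_diff: "superfun_in S F \<Longrightarrow> superfun_in S G \<Longrightarrow> superfun_in S (F - G)"
  using superfun_in_add[of S F "- G"] superfun_in_minus[of S G] by simp

lemma superfun_in_sum: "(\<And>i. i \<in> A \<Longrightarrow> superfun_in S (F i)) \<Longrightarrow> superfun_in S (\<Sum>i\<in>A. F i)"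
  by (induction A rule: infinite_finite_induct) (simp_all add: superfun_in_add)

lemma superfun_in_parity: "superfun_in S F \<Longrightarrow> superfun_in S (parity F)"
proof (rule superfun_inI)
  assume F: "superfun_in S F"
  show "K \<subseteq> S \<inter> {c. is_odd c}" if "parity F K z \<noteq> 0" for K z
    using that superfun_inD(1)[OF F, of K z] by (auto simp: parity_def)
  show "parity F K z = parity F K z'" if "\<And>c. c \<in> S \<Longrightarrow> \<not> is_odd c \<Longrightarrow> z c = z' c" for K z z'
    using superfun_inD(2)[OF F that] by (simp add: parity_def)
  show "continuous_on UNIV (parity F K)" for K
    unfolding parity_def by (intro continuous_on_mult continuous_on_const superfun_inD(3)[OF F])
  show "(\<lambda>t. parity F K (z(c := t))) holomorphic_on UNIV" for K z c
    unfolding parity_def by (intro holomorphic_on_mult holomorphic_on_const superfun_inD(4)[OF F])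
qed

lemma superfun_in_one [simp]: "superfun_in S one_sf"
  by (rule superfun_inI) (auto simp: one_sf_def split: if_splits)

lemma superfun_in_coord: "c \<in> S \<Longrightarrow> superfun_in S (coord_fun c)"
proof (rule superfun_inI, goal_cases)
  case (3 K)
  then show ?case by (cases "is_odd c"; cases "K = {}") (auto simp: coord_fun_def intro!: continuous_intros)
next
  case (4 K z d)
  then show ?case
    by (cases "is_odd c"; cases "K = {}"; cases "c = d") (auto simp: coord_fun_def intro!: holomorphic_intros)
qed (auto simp: coord_fun_def split: if_splits)

lemma superfun_in_sprod:
  assumes F: "superfun_in S F" and G: "superfun_in S G"
  shows "superfun_in S (F \<otimes> G)"
proof (rule superfun_inI)
  fix K z assume "(F \<otimes> G) K z \<noteq> 0"
  then obtain I where "I \<subseteq> K" "F I z \<noteq> 0" "G (K - I) z \<noteq> 0"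
    unfolding sprod_def by (smt (verit) PowD mult_eq_0_iff sum.neutral)
  then show "K \<subseteq> S \<inter> {c. is_odd c}"
    using superfun_inD(1)[OF F] superfun_inD(1)[OF G] by blast
next
  fix K z z' assume "\<And>c. c \<in> S \<Longrightarrow> \<not> is_odd c \<Longrightarrow> z c = (z' c :: complex)"
  then have "F I z = F I z'" "G I z = G I z'" for I
    by (intro superfun_inD(2)[OF F] superfun_inD(2)[OF G]; simp)+
  then show "(F \<otimes> G) K z = (F \<otimes> G) K z'" by (simp add: sprod_def)
next
  fix K show "continuous_on UNIV ((F \<otimes> G) K)"
    unfolding sprod_def
    by (intro continuous_on_sum continuous_on_mult continuous_on_const
        superfun_inD(3)[OF F] superfun_inD(3)[OF G])
next
  fix K z c show "(\<lambda>t. (F \<otimes> G) K (z(c := t))) holomorphic_on UNIV"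
    unfolding sprod_def
    by (intro holomorphic_on_sum holomorphic_on_mult holomorphic_on_const
        superfun_inD(4)[OF F] superfun_inD(4)[OF G])
qed

section \<open>Regularity of partial derivatives along even coordinates\<close>

lemma continuous_upd:
  fixes g :: "'b::topological_space \<Rightarrow> 'a \<Rightarrow> complex"
  assumes "continuous_on A g" "continuous_on A h"
  shows "continuous_on A (\<lambda>x. (g x)(c := h x))"
proof (rule continuous_on_coordinatewise_then_product)
  fix i
  have "continuous_on A (\<lambda>x. g x i)"
    using assms(1) by (rule continuous_on_product_then_coordinatewise)
  then show "continuous_on A (\<lambda>x. ((g x)(c := h x)) i)"
    using assms(2) by (cases "i = c") auto
qed

text \<open>Compactness of \<open>C\<close> turns joint continuity into an estimate uniform in
  \<open>t\<close>. It feeds Cauchy's inequality on a disc and, later, the uniform convergence of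
  difference quotients.\<close>

lemma tube:
  fixes g :: "'a::topological_space \<Rightarrow> 'b::topological_space \<Rightarrow> complex"
  assumes "continuous_on (UNIV \<times> C) (\<lambda>(x, t). g x t)" "compact C" "0 < e"
  obtains X where "open X" "x0 \<in> X" "\<And>x t. x \<in> X \<Longrightarrow> t \<in> C \<Longrightarrow> dist (g x t) (g x0 t) \<le> e"
proof -
  obtain X where X: "x0 \<in> X" "open X"
    "\<forall>x\<in>X \<inter> UNIV. \<forall>t\<in>C. dist ((\<lambda>(x, t). g x t) (x, t)) ((\<lambda>(x, t). g x t) (x0, t)) \<le> e"
    by (rule continuous_on_prod_compactE[OF assms(1,2) UNIV_I assms(3)])
  show ?thesis
  proof (rule that[OF X(2,1)])
    fix x t assume "x \<in> X" "t \<in> C"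
    then show "dist (g x t) (g x0 t) \<le> e" using X(3) by simp
  qed
qed

text \<open>Near \<open>z0\<close> the recentred functions \<open>g z\<close> and
  \<open>g z0\<close> are uniformly close on the unit disc, and Cauchy's inequality transfers the
  closeness to their derivatives at the centre.\<close>

lemma continuous_partial_deriv:
  fixes f :: "('a \<Rightarrow> complex) \<Rightarrow> complex"
  assumes cont: "continuous_on UNIV f"
    and hol: "\<And>z. (\<lambda>t. f (z(c := t))) holomorphic_on UNIV"
  shows "continuous_on UNIV (\<lambda>z. deriv (\<lambda>t. f (z(c := t))) (z c))"
proof -
  define g where "g z s = f (z(c := z c + s))" for z s
  have holg: "g z holomorphic_on UNIV" for z
  proof -
    have "(\<lambda>s. z c + s) holomorphic_on UNIV" by (intro holomorphic_intros)
    from holomorphic_on_compose[OF this holomorphic_on_subset[OF hol[of z]]] show ?thesis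
      by (simp add: g_def[abs_def] o_def)
  qed
  have dg: "deriv (\<lambda>t. f (z(c := t))) (z c) = deriv (g z) 0" for z
  proof -
    have "((\<lambda>t. f (z(c := t))) has_field_derivative deriv (\<lambda>t. f (z(c := t))) (z c)) (at (z c))"
      using holomorphic_derivI[OF hol[of z] open_UNIV] by simp
    then have "(g z has_field_derivative deriv (\<lambda>t. f (z(c := t))) (z c)) (at 0)"
      using DERIV_shift[of "\<lambda>t. f (z(c := t))" _ 0 "z c"] by (simp add: g_def[abs_def] add.commute)
    then show ?thesis by (simp add: DERIV_imp_deriv)
  qed
  have contg: "continuous_on (UNIV \<times> cball 0 1) (\<lambda>(z, s). g z s)"
  proof -
    have "continuous_on A (\<lambda>x :: ('a \<Rightarrow> complex) \<times> complex. fst x c + snd x)" for A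
      by (rule continuous_on_add[OF continuous_on_product_then_coordinatewise[OF continuous_on_fst]
            continuous_on_snd]; rule continuous_on_id)
    from continuous_upd[OF continuous_on_fst[OF continuous_on_id] this, of _ c]
    have "continuous_on (UNIV \<times> cball 0 1)
        (\<lambda>x :: ('a \<Rightarrow> complex) \<times> complex. (fst x)(c := fst x c + snd x))"
      by blast
    from continuous_on_compose2[OF cont this] show ?thesis
      by (simp add: g_def split_beta)
  qed
  have "continuous_on UNIV (\<lambda>z. deriv (g z) 0)"
  proof (rule continuous_on_def[THEN iffD2], rule ballI)
    fix z0
    show "((\<lambda>z. deriv (g z) 0) \<longlongrightarrow> deriv (g z0) 0) (at z0 within UNIV)"
    proof (rule tendstoI)
      fix e :: real assume e: "0 < e"
      then have e2: "0 < e / 2" by simp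
      obtain X0 where X0: "open X0" "z0 \<in> X0"
        "\<And>z s. z \<in> X0 \<Longrightarrow> s \<in> cball 0 1 \<Longrightarrow> dist (g z s) (g z0 s) \<le> e / 2"
        using tube[OF contg compact_cball e2, of z0] by metis
      have "dist (deriv (g z) 0) (deriv (g z0) 0) < e" if "z \<in> X0" for z
      proof -
        have fd: "g z field_differentiable at 0" "g z0 field_differentiable at 0"
          using holg by (auto intro: holomorphic_on_imp_differentiable_at)
        have "norm ((deriv ^^ 1) (\<lambda>s. g z s - g z0 s) 0) \<le> fact 1 * (e / 2) / 1 ^ 1"
        proof (rule Cauchy_inequality)
          show "(\<lambda>s. g z s - g z0 s) holomorphic_on ball 0 1"
            using holg by (intro holomorphic_on_diff) (blast intro: holomorphic_on_subset)+
          show "continuous_on (cball 0 1) (\<lambda>s. g z s - g z0 s)"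
            using holg by (intro continuous_on_diff holomorphic_on_imp_continuous_on)
              (blast intro: holomorphic_on_subset)+
          show "norm (g z s - g z0 s) \<le> e / 2" if "norm (0 - s) = 1" for s
            using X0(3)[OF \<open>z \<in> X0\<close>, of s] that by (simp add: dist_norm)
        qed simp
        then show ?thesis using fd e by (simp add: dist_norm)
      qed
      then show "\<forall>\<^sub>F z in at z0 within UNIV. dist (deriv (g z) 0) (deriv (g z0) 0) < e"
        using X0(1,2) unfolding eventually_at_topological by blast
    qed
  qed
  then show ?thesis by (simp add: dg)
qed

text \<open>For \<open>c = d\<close> this is the derivative of one entire function. Otherwise it is
  a limit of difference quotients that are entire in \<open>t\<close>; the limit is uniform on discs
  because the partial derivative is jointly continuous.\<close>

lemma holomorphic_partial_deriv:
  fixes f :: "('a \<Rightarrow> complex) \<Rightarrow> complex"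
  assumes cont: "continuous_on UNIV f"
    and hol: "\<And>z c. (\<lambda>t. f (z(c := t))) holomorphic_on UNIV"
  shows "(\<lambda>t. deriv (\<lambda>s. f (z(d := t, c := s))) ((z(d := t)) c)) holomorphic_on UNIV"
proof (cases "c = d")
  case True
  then show ?thesis using holomorphic_deriv[OF hol[of z d]] by simp
next
  case False
  define h where "h t s = f (z(d := t, c := s))" for t s
  define s0 where "s0 = z c"
  define h' where "h' t s = deriv (h t) s" for t s
  have hol_s: "h t holomorphic_on UNIV" for t
    unfolding h_def using hol[of "z(d := t)" c] by simp
  have hol_t: "(\<lambda>t. h t s) holomorphic_on UNIV" for s
    unfolding h_def using hol[of "z(c := s)" d] False by (simp add: fun_upd_twist)
  have conth': "continuous_on (UNIV \<times> cball t r) (\<lambda>(s, t). h' t s)" for t r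
  proof -
    have "h' t s = deriv (\<lambda>u. f (((z(d := t, c := s))(c := u)))) ((z(d := t, c := s)) c)" for t s
      by (simp add: h'_def h_def[abs_def])
    moreover have "continuous_on (UNIV \<times> cball t r) (\<lambda>x. z(d := snd x, c := fst x))"
      by (rule continuous_upd[OF continuous_upd[OF continuous_on_const continuous_on_snd]
            continuous_on_fst]; rule continuous_on_id)
    from continuous_on_compose2[OF continuous_partial_deriv[OF cont hol[of _ c]] this subset_UNIV]
    have "continuous_on (UNIV \<times> cball t r) (\<lambda>x. deriv (\<lambda>u. f ((z(d := snd x, c := fst x))(c := u)))
      ((z(d := snd x, c := fst x)) c))" .
    ultimately show ?thesis
      unfolding split_beta by (simp only:)
  qed
  have "(\<lambda>t. h' t s0) holomorphic_on UNIV"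
  proof (rule holomorphic_uniform_sequence)
    let ?q = "\<lambda>n t. (h t (s0 + 1 / of_nat (Suc n)) - h t s0) * of_nat (Suc n)"
    show "?q n holomorphic_on UNIV" for n
      by (intro holomorphic_intros hol_t)
    fix t0 :: complex
    have "uniform_limit (cball t0 1) ?q (\<lambda>t. h' t s0) sequentially"
    proof (rule uniform_limitI)
      fix e :: real assume e: "0 < e"
      from tube[OF conth'[of t0 1] compact_cball half_gt_zero[OF e], of s0]
      obtain X0 where X0: "open X0" "s0 \<in> X0"
        "\<And>s t. s \<in> X0 \<Longrightarrow> t \<in> cball t0 1 \<Longrightarrow> dist (h' t s) (h' t s0) \<le> e / 2"
        by metis
      then obtain \<delta> where \<delta>: "0 < \<delta>" "cball s0 \<delta> \<subseteq> X0"
        using open_contains_cball by blast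
      have "\<forall>\<^sub>F n in sequentially. 1 / real (Suc n) < \<delta>"
        using \<delta>(1) order_tendstoD(2)[OF LIMSEQ_inverse_real_of_nat] by (simp add: inverse_eq_divide)
      then show "\<forall>\<^sub>F n in sequentially. \<forall>t\<in>cball t0 1. dist (?q n t) (h' t s0) < e"
      proof (rule eventually_mono, safe)
        fix n t assume n: "1 / real (Suc n) < \<delta>" and t: "t \<in> cball t0 1"
        let ?s = "s0 + 1 / of_nat (Suc n)"
        \<comment> \<open>Subtracting the linear term turns the error of the difference quotient
          into an increment of \<open>?k\<close>, whose derivative is bounded by
          \<open>e / 2\<close> on the disc.\<close>
        let ?k = "\<lambda>s. h t s - s * h' t s0"
        have ns: "norm (?s - s0) = 1 / real (Suc n)"
          by (simp only: add_diff_cancel_left' norm_divide norm_one norm_of_nat)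
        have "norm (?k ?s - ?k s0) \<le> e / 2 * norm (?s - s0)"
        proof (rule field_differentiable_bound)
          show "convex (cball s0 \<delta>)" by simp
          show "(?k has_field_derivative h' t s - h' t s0) (at s within cball s0 \<delta>)" for s
            unfolding h'_def
            by (rule DERIV_subset[of _ _ _ UNIV])
              (auto intro!: derivative_eq_intros holomorphic_derivI[OF hol_s])
          show "norm (h' t s - h' t s0) \<le> e / 2" if "s \<in> cball s0 \<delta>" for s
            using X0(3)[of s t] \<delta> that t by (auto simp: dist_norm)
          show "?s \<in> cball s0 \<delta>" using ns n by (simp add: dist_norm norm_minus_commute)
          show "s0 \<in> cball s0 \<delta>" using \<delta> by simp
        qed
        then have "norm (?k ?s - ?k s0) * real (Suc n) \<le> e / 2"
          unfolding ns by (simp add: field_simps)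
        moreover have "?q n t - h' t s0 = (?k ?s - ?k s0) * of_nat (Suc n)"
        proof -
          have "(x - y) * c - w = (x - (s0 + 1 / c) * w - (y - s0 * w)) * c" if "c \<noteq> 0" for x y w c :: complex
            using that by (simp add: field_simps)
          then show ?thesis by (metis of_nat_eq_0_iff nat.simps(3))
        qed
        ultimately have "norm (?q n t - h' t s0) \<le> e / 2"
          by (metis norm_mult norm_of_nat)
        then show "dist (?q n t) (h' t s0) < e"
          using e by (simp add: dist_norm)
      qed
    qed
    then show "\<exists>r>0. cball t0 r \<subseteq> UNIV \<and> uniform_limit (cball t0 r) ?q (\<lambda>t. h' t s0) sequentially"
      by (intro exI[of _ 1]) auto
  qed simp
  then show ?thesis using False by (simp add: h'_def h_def[abs_def] s0_def)
qed

lemma superfun_in_deriv_const: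
  assumes "superfun_in S F" "\<not> is_odd c" "c \<notin> S"
  shows "pd c F = 0"
proof -
  have "F K (z(c := t)) = F K z" for K z t
    using assms superfun_inD(2)[OF assms(1)] by (metis fun_upd_other)
  then show ?thesis using assms(2) by (simp add: pd_def fun_eq_iff)
qed

lemma superfun_in_pd:
  assumes F: "superfun_in S F"
  shows "superfun_in S (pd c F)"
proof (cases "is_odd c")
  case True
  show ?thesis
  proof (rule superfun_inI)
    fix K z assume "pd c F K z \<noteq> 0"
    then show "K \<subseteq> S \<inter> {c. is_odd c}"
      using superfun_inD(1)[OF F, of "insert c K" z] True by (auto simp: pd_def split: if_splits)
  next
    fix K z z' assume "\<And>c. c \<in> S \<Longrightarrow> \<not> is_odd c \<Longrightarrow> z c = (z' c :: complex)"
    then have "F (insert c K) z = F (insert c K) z'" by (rule superfun_inD(2)[OF F])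
    then show "pd c F K z = pd c F K z'" using True by (simp add: pd_def)
  next
    fix K show "continuous_on UNIV (pd c F K)"
      using True superfun_inD(3)[OF F] by (cases "c \<in> K") (auto simp: pd_def intro!: continuous_intros)
  next
    fix K z d show "(\<lambda>t. pd c F K (z(d := t))) holomorphic_on UNIV"
      using True superfun_inD(4)[OF F] by (cases "c \<in> K") (auto simp: pd_def intro!: holomorphic_intros)
  qed
next
  case False
  show ?thesis
  proof (cases "c \<in> S")
    case True
    show ?thesis
    proof (rule superfun_inI)
      fix K z assume nz: "pd c F K z \<noteq> 0"
      have "\<exists>t. F K (z(c := t)) \<noteq> 0"
      proof (rule ccontr)
        assume "\<nexists>t. F K (z(c := t)) \<noteq> 0"
        then show False using nz False by (simp add: pd_def)
      qed
      then show "K \<subseteq> S \<inter> {c. is_odd c}" using superfun_inD(1)[OF F] by blast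
    next
      fix K z z' assume *: "\<And>c. c \<in> S \<Longrightarrow> \<not> is_odd c \<Longrightarrow> z c = (z' c :: complex)"
      then have "F K (z(c := t)) = F K (z'(c := t))" for t
        by (intro superfun_inD(2)[OF F]) auto
      then show "pd c F K z = pd c F K z'" using False True * by (simp add: pd_def)
    next
      fix K show "continuous_on UNIV (pd c F K)"
        using continuous_partial_deriv[of "F K" c, OF superfun_inD(3)[OF F] superfun_inD(4)[OF F]] False
        by (simp add: pd_def)
    next
      fix K z d show "(\<lambda>t. pd c F K (z(d := t))) holomorphic_on UNIV"
        using holomorphic_partial_deriv[of "F K" z d c, OF superfun_inD(3)[OF F] superfun_inD(4)[OF F]] False
        by (simp add: pd_def)
    qed
  qed (use superfun_in_deriv_const[OF F False] in simp)
qed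

lemma superfun_in_pd_zero:
  assumes "superfun_in S F" "c \<notin> S"
  shows "pd c F = 0"
proof (cases "is_odd c")
  case True
  have "F (insert c K) z = 0" for K z
    using superfun_inD(1)[OF assms(1)] assms(2) by blast
  then show ?thesis using True by (simp add: pd_def fun_eq_iff)
qed (use superfun_in_deriv_const assms in blast)

lemma superfunI: "finite S \<Longrightarrow> superfun_in S F \<Longrightarrow> superfun F"
  by (auto simp: superfun_def)

lemma superfun_add: "superfun F \<Longrightarrow> superfun G \<Longrightarrow> superfun (F + G)"
  and superfun_diff: "superfun F \<Longrightarrow> superfun G \<Longrightarrow> superfun (F - G)"
  and superfun_sprod: "superfun F \<Longrightarrow> superfun G \<Longrightarrow> superfun (F \<otimes> G)"
  unfolding superfun_def
  by (metis finite_UnI superfun_in_add superfun_in_diff superfun_in_sprod superfun_in_mono sup_ge1 sup_ge2)+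

lemma superfun_zero [simp]: "superfun 0"
  and superfun_one [simp]: "superfun one_sf"
  and superfun_coord [simp]: "superfun (coord_fun c)"
  and superfun_scal: "superfun F \<Longrightarrow> superfun (scal a F)"
  and superfun_minus: "superfun F \<Longrightarrow> superfun (- F)"
  and superfun_parity: "superfun F \<Longrightarrow> superfun (parity F)"
  and superfun_pd: "superfun F \<Longrightarrow> superfun (pd c F)"
  unfolding superfun_def
  by (metis finite.emptyI finite.insertI insertI1 superfun_in_zero superfun_in_one superfun_in_scal
      superfun_in_minus superfun_in_parity superfun_in_pd superfun_in_coord)+

lemma superfun_tw: "superfun F \<Longrightarrow> superfun (tw p F)"
  by (simp add: tw_def superfun_parity)

lemma superfun_sum: "(\<And>i. i \<in> A \<Longrightarrow> superfun (F i)) \<Longrightarrow> superfun (\<Sum>i\<in>A. F i)"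
  by (induction A rule: infinite_finite_induct) (simp_all add: superfun_add)

lemma superfun_in_oddsupp: "superfun_in S F \<Longrightarrow> finite S \<Longrightarrow> oddsupp F"
  using superfun_inD(1) unfolding oddsupp_def by (meson finite_Int finite_subset inf.boundedE subset_refl)

lemma superfun_oddsupp: "superfun F \<Longrightarrow> oddsupp F"
  using superfun_in_oddsupp superfun_def by blast


subsection \<open>Partial derivatives\<close>

lemma DERIV_pd:
  assumes "superfun F" "\<not> is_odd c"
  shows "((\<lambda>t. F K (z(c := t))) has_field_derivative pd c F K z) (at (z c))"
proof -
  obtain S where "superfun_in S F" using assms(1) by (auto simp: superfun_def)
  from holomorphic_derivI[OF superfun_inD(4)[OF this, of K z c] open_UNIV UNIV_I]
  show ?thesis using assms(2) by (simp add: pd_def)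
qed

lemma pd_eqI:
  assumes "\<not> is_odd c" "((\<lambda>t. F K (z(c := t))) has_field_derivative w) (at (z c))"
  shows "pd c F K z = w"
  using assms by (simp add: pd_def DERIV_imp_deriv)

lemma pd_zero [simp]: "pd c 0 = 0"
  by (auto simp: pd_def fun_eq_iff)

lemma pd_add:
  assumes "superfun F" "superfun G"
  shows "pd c (F + G) = pd c F + pd c G"
proof (cases "is_odd c")
  case False
  have "((\<lambda>t. (F + G) K (z(c := t))) has_field_derivative (pd c F + pd c G) K z) (at (z c))" for K z
    using DERIV_add[OF DERIV_pd[OF assms(1) False, of K z] DERIV_pd[OF assms(2) False, of K z]] by simp
  then show ?thesis using pd_eqI[OF False] by (intro ext) blast
qed (auto simp: pd_def fun_eq_iff algebra_simps)

lemma pd_scal: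
  assumes "superfun F"
  shows "pd c (scal a F) = scal a (pd c F)"
proof (cases "is_odd c")
  case False
  have "((\<lambda>t. (scal a F) K (z(c := t))) has_field_derivative (scal a (pd c F)) K z) (at (z c))" for K z
    using DERIV_cmult[OF DERIV_pd[OF assms False, of K z], of a] by (simp add: scal_def)
  then show ?thesis using pd_eqI[OF False] by (intro ext) blast
qed (auto simp: pd_def scal_def fun_eq_iff algebra_simps)

lemma pd_minus: "superfun F \<Longrightarrow> pd c (- F) = - pd c F"
  using pd_scal[of F c "-1"] by (simp add: scal_m1)

lemma pd_diff: "superfun F \<Longrightarrow> superfun G \<Longrightarrow> pd c (F - G) = pd c F - pd c G"
  using pd_add[of F "- G" c] by (simp add: superfun_minus pd_minus)

lemma pd_sum: "(\<And>i. i \<in> A \<Longrightarrow> superfun (F i)) \<Longrightarrow> pd c (\<Sum>i\<in>A. F i) = (\<Sum>i\<in>A. pd c (F i))"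
  by (induction A rule: infinite_finite_induct) (simp_all add: superfun_sum pd_add)

lemma pd_parity:
  assumes "superfun F"
  shows "pd c (parity F) = scal (sg (is_odd c)) (parity (pd c F))"
proof (cases "is_odd c")
  case True
  have "pd c (parity F) K z = scal (sg (is_odd c)) (parity (pd c F)) K z" for K z
  proof (cases "c \<in> K \<or> infinite K")
    case False
    then show ?thesis using True by (simp add: pd_def parity_def scal_def)
  next
    case True': True
    have "F (insert c K) z = 0" if "infinite K"
      using superfun_oddsupp[OF assms] that by (auto simp: oddsupp_def)
    then show ?thesis using True True' by (auto simp: pd_def parity_def scal_def)
  qed
  then show ?thesis by blast
next
  case False
  have "((\<lambda>t. parity F K (z(c := t))) has_field_derivative parity (pd c F) K z) (at (z c))" for K z
    using DERIV_cmult[OF DERIV_pd[OF assms False, of K z], of "(-1) ^ card K"] by (simp add: parity_def)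
  then have "pd c (parity F) = parity (pd c F)" using pd_eqI[OF False] by (intro ext) blast
  then show ?thesis using False by simp
qed

text \<open>Homogeneity is read off from the eigenvalue under \<open>parity\<close>, for which
  \<open>pd_parity\<close> gives the commutation rule.\<close>

lemma hom_pd:
  assumes "superfun F" "hom p F"
  shows "hom (p \<noteq> is_odd c) (pd c F)"
proof -
  have "parity (pd c F) = scal (sg p * sg (is_odd c)) (pd c F)"
  proof -
    have "scal (sg (is_odd c)) (parity (pd c F)) = scal (sg p) (pd c F)"
      using pd_parity[OF assms(1), of c] hom_parity[OF assms(2)] pd_scal[OF assms(1)] by simp
    then have "scal (sg (is_odd c)) (scal (sg (is_odd c)) (parity (pd c F))) =
        scal (sg (is_odd c)) (scal (sg p) (pd c F))" by simp
    then show ?thesis by (simp add: mult.commute)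
  qed
  then have eq: "parity (pd c F) K z = scal (sg p * sg (is_odd c)) (pd c F) K z" for K z
    by simp
  have "(-1) ^ card K = sg p * sg (is_odd c)" if "pd c F K z \<noteq> 0" for K z
    using eq[of K z] that unfolding parity_def scal_def by simp
  moreover have "odd (card K) = (p \<noteq> is_odd c)" if "(-1) ^ card K = sg p * sg (is_odd c)" for K :: "coord set"
    using that by (cases p; cases "is_odd c"; cases "even (card K)") auto
  ultimately show ?thesis unfolding hom_def by blast
qed

lemma card_filter_insert:
  assumes "finite K" "c \<notin> K"
  shows "card {j \<in> insert c K. P j} = card {j \<in> K. P j} + of_bool (P c)"
proof -
  have "{j \<in> insert c K. P j} = (if P c then insert c {j \<in> K. P j} else {j \<in> K. P j})" by auto
  then show ?thesis using assms by simp
qed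

lemma card_lt_gt:
  assumes "finite I" "c \<notin> I" "is_odd c" "I \<subseteq> {c. is_odd c}"
  shows "card I = card {i \<in> I. rank i < rank c} + card {i \<in> I. rank c < rank i}"
proof -
  have "rank i < rank c \<or> rank c < rank i" if "i \<in> I" for i
  proof -
    have "rank i \<noteq> rank c" using rank_inj[of i c] that assms by auto
    then show ?thesis by auto
  qed
  then have "I = {i \<in> I. rank i < rank c} \<union> {i \<in> I. rank c < rank i}" by auto
  then show ?thesis
    using assms by (subst card_Un_disjoint[symmetric]) auto
qed

lemma sum_Pow_insert:
  fixes h :: "'a set \<Rightarrow> 'b::comm_monoid_add"
  assumes "finite K" "c \<notin> K"
  shows "(\<Sum>I\<in>Pow (insert c K). h I) = (\<Sum>I\<in>Pow K. h I + h (insert c I))"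
proof -
  have "(\<Sum>I\<in>insert c ` Pow K. h I) = (\<Sum>I\<in>Pow K. h (insert c I))"
  proof (rule sum.reindex_cong[OF _ refl refl])
    show "inj_on (insert c) (Pow K)"
      by (rule inj_on_inverseI[where g = "\<lambda>I. I - {c}"]) (use assms in auto)
  qed
  moreover have "(\<Sum>I\<in>Pow K \<union> insert c ` Pow K. h I) = (\<Sum>I\<in>Pow K. h I) + (\<Sum>I\<in>insert c ` Pow K. h I)"
    using assms by (intro sum.union_disjoint) auto
  ultimately show ?thesis by (simp add: Pow_insert sum.distrib)
qed

text \<open>A splitting of \<open>insert c K\<close> puts \<open>c\<close> into the left or the
  right block, which gives the two terms of the Leibniz rule. Moving \<open>c\<close> past the left
  block \<open>I\<close> costs \<open>(-1) ^ card I\<close>, hence the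
  \<open>parity F\<close>.\<close>

lemma pd_odd_sprod:
  assumes F: "oddsupp F" and G: "oddsupp G" and c: "is_odd c"
  shows "pd c (F \<otimes> G) = pd c F \<otimes> G + parity F \<otimes> pd c G"
proof (intro ext)
  fix K z
  define \<epsilon> where "\<epsilon> I = (-1::complex) ^ card {i \<in> I. rank i < rank c}" for I
  show "pd c (F \<otimes> G) K z = (pd c F \<otimes> G + parity F \<otimes> pd c G) K z"
  proof (cases "finite K")
    case False
    then show ?thesis using c by (simp add: pd_def sprod_infinite)
  next
    case K: True
    have eps: "reorder_sign {c} I = \<epsilon> I" for I
      by (simp add: \<epsilon>_def reorder_sign_single_left)
    have eps_mult: "\<epsilon> (I \<union> J) = \<epsilon> I * \<epsilon> J" if "finite I" "finite J" "I \<inter> J = {}" for I J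
      using reorder_sign_un_right[of "{c}" I J] that by (simp add: eps)
    \<comment> \<open>Taking \<open>c\<close> from the right end of \<open>I\<close> to its left end
      passes every element of \<open>I\<close> exactly once.\<close>
    have eps_right: "reorder_sign I {c} = (-1) ^ card I * \<epsilon> I"
      if "finite I" "c \<notin> I" "I \<subseteq> {c. is_odd c}" for I
      using card_lt_gt[OF that(1,2) c that(3)]
      by (simp add: reorder_sign_single_right \<epsilon>_def power_add flip: power_mult_distrib mult.assoc)
    have sq: "\<epsilon> I * \<epsilon> I = 1" "\<epsilon> I * (\<epsilon> I * x) = x" for I x
      by (simp_all add: \<epsilon>_def flip: power_add mult.assoc)
    have pdc: "pd c F I z = \<epsilon> I * F (insert c I) z" if "c \<notin> I" for F I
      using that c by (simp add: pd_def \<epsilon>_def)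
    have finP: "finite I" if "I \<subseteq> K" for I using that K finite_subset by blast
    show ?thesis
    proof (cases "c \<in> K")
      case False
      have "pd c (F \<otimes> G) K z = \<epsilon> K * (\<Sum>I\<in>Pow K.
          reorder_sign I (insert c (K - I)) * F I z * G (insert c (K - I)) z +
          reorder_sign (insert c I) (K - I) * F (insert c I) z * G (K - I) z)"
        using c False K
      proof -
        have "insert c K - I = insert c (K - I)" "insert c K - insert c I = K - I" if "I \<in> Pow K" for I
          using that False by auto
        then show ?thesis
          unfolding pdc[OF False] sprod_def sum_Pow_insert[OF K False]
          by (intro arg_cong[of _ _ "\<lambda>x. \<epsilon> K * x"] sum.cong refl) simp
      qed
      also have "\<dots> = (\<Sum>I\<in>Pow K. reorder_sign I (K - I) * pd c F I z * G (K - I) z +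
          reorder_sign I (K - I) * parity F I z * pd c G (K - I) z)"
        unfolding sum_distrib_left
      proof (rule sum.cong[OF refl])
        fix I assume "I \<in> Pow K"
        then have I: "I \<subseteq> K" "finite I" "finite (K - I)" "c \<notin> I" "c \<notin> K - I"
          using finP False K by auto
        have eK: "\<epsilon> K = \<epsilon> I * \<epsilon> (K - I)"
          using eps_mult[of I "K - I"] I by (simp add: Un_absorb1)
        have "F I z = 0 \<or> I \<subseteq> {c. is_odd c}" using F by (auto simp: oddsupp_def)
        then have 1: "\<epsilon> K * (reorder_sign I (insert c (K - I)) * F I z * G (insert c (K - I)) z) =
            reorder_sign I (K - I) * parity F I z * pd c G (K - I) z"
        proof
          assume "I \<subseteq> {c. is_odd c}"
          then show ?thesis
            using I c reorder_sign_insert_right[of I "K - I" c] eps_right[of I]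
            by (simp add: pdc parity_def eK sq mult_ac)
        qed (simp add: parity_def)
        have 2: "\<epsilon> K * (reorder_sign (insert c I) (K - I) * F (insert c I) z * G (K - I) z) =
            reorder_sign I (K - I) * pd c F I z * G (K - I) z"
          using I c reorder_sign_insert_left[of I "K - I" c]
          by (simp add: pdc eps eK sq mult_ac)
        show "\<epsilon> K * (reorder_sign I (insert c (K - I)) * F I z * G (insert c (K - I)) z +
          reorder_sign (insert c I) (K - I) * F (insert c I) z * G (K - I) z) =
          reorder_sign I (K - I) * pd c F I z * G (K - I) z +
          reorder_sign I (K - I) * parity F I z * pd c G (K - I) z"
          unfolding distrib_left 1 2 by simp
      qed
      finally show ?thesis by (simp add: sprod_def sum.distrib)
    next
      \<comment> \<open>Here the left side is zero by definition of \<open>pd\<close>. On the right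
        \<open>c\<close> lies in the factor that is not differentiated, and the two positions of
        \<open>c\<close> cancel.\<close>
      case True
      define L where "L = K - {c}"
      have L: "K = insert c L" "c \<notin> L" "finite L" using True K by (auto simp: L_def)
      have "(pd c F \<otimes> G + parity F \<otimes> pd c G) K z = (\<Sum>I\<in>Pow L.
          reorder_sign I (insert c (L - I)) * pd c F I z * G (insert c (L - I)) z +
          reorder_sign (insert c I) (L - I) * parity F (insert c I) z * pd c G (L - I) z)"
      proof -
        have 1: "(pd c F \<otimes> G) K z = (\<Sum>I\<in>Pow L. reorder_sign I (insert c (L - I)) * pd c F I z * G (insert c (L - I)) z)"
          unfolding sprod_def L(1) sum_Pow_insert[OF L(3,2)]
          using L c by (intro sum.cong refl) (auto simp: insert_Diff_if pd_def)
        have 2: "(parity F \<otimes> pd c G) K z = (\<Sum>I\<in>Pow L. reorder_sign (insert c I) (L - I) * parity F (insert c I) z * pd c G (L - I) z)"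
          unfolding sprod_def L(1) sum_Pow_insert[OF L(3,2)]
          using L c by (intro sum.cong refl) (auto simp: insert_Diff_if pd_def)
        show ?thesis using 1 2 by (simp add: sum.distrib)
      qed
      also have "\<dots> = 0"
      proof (rule sum.neutral, rule ballI)
        fix I assume "I \<in> Pow L"
        then have I: "I \<subseteq> L" "finite I" "finite (L - I)" "c \<notin> I" "c \<notin> L - I"
          using finP L by auto
        have "F (insert c I) z = 0 \<or> I \<subseteq> {c. is_odd c}" using F by (auto simp: oddsupp_def)
        then show "reorder_sign I (insert c (L - I)) * pd c F I z * G (insert c (L - I)) z +
          reorder_sign (insert c I) (L - I) * parity F (insert c I) z * pd c G (L - I) z = 0"
        proof
          assume "I \<subseteq> {c. is_odd c}"
          then show ?thesis
            using I c reorder_sign_insert_right[of I "L - I" c] eps_right[of I]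
              reorder_sign_insert_left[of I "L - I" c]
            by (simp add: pdc parity_def sq eps mult_ac)
        qed (use I in \<open>simp add: parity_def pdc\<close>)
      qed
      finally show ?thesis using True c by (simp add: pd_def)
    qed
  qed
qed

lemma pd_even_sprod:
  assumes F: "superfun F" and G: "superfun G" and c: "\<not> is_odd c"
  shows "pd c (F \<otimes> G) = pd c F \<otimes> G + F \<otimes> pd c G"
proof (intro ext)
  fix K z
  have "((\<lambda>t. (F \<otimes> G) K (z(c := t))) has_field_derivative
    (\<Sum>I\<in>Pow K. reorder_sign I (K - I) * (pd c F I z * G (K - I) z + F I z * pd c G (K - I) z))) (at (z c))"
    unfolding sprod_def mult.assoc
  proof (intro DERIV_sum DERIV_cmult)
    fix I
    show "((\<lambda>t. F I (z(c := t)) * G (K - I) (z(c := t))) has_field_derivative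
      pd c F I z * G (K - I) z + F I z * pd c G (K - I) z) (at (z c))"
      using DERIV_mult[OF DERIV_pd[OF F c, of I z] DERIV_pd[OF G c, of "K - I" z]]
      by (simp add: mult_ac)
  qed
  from pd_eqI[of c "F \<otimes> G", OF c this]
  show "pd c (F \<otimes> G) K z = (pd c F \<otimes> G + F \<otimes> pd c G) K z"
    by (simp add: sprod_def algebra_simps sum.distrib)
qed

lemma pd_sprod:
  assumes "superfun F" "superfun G"
  shows "pd c (F \<otimes> G) = pd c F \<otimes> G + tw (is_odd c) F \<otimes> pd c G"
  using assms pd_even_sprod pd_odd_sprod superfun_oddsupp by (cases "is_odd c") simp_all

lemma pd_coord: "pd d (coord_fun c) = (if d = c then one_sf else 0)"
proof (intro ext)
  fix K :: "coord set" and z :: "coord \<Rightarrow> complex"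
  consider "is_odd d" | "\<not> is_odd d" "is_odd c" | "\<not> is_odd d" "\<not> is_odd c" "K \<noteq> {}"
    | "\<not> is_odd d" "\<not> is_odd c" "K = {}" "c = d" | "\<not> is_odd d" "\<not> is_odd c" "K = {}" "c \<noteq> d"
    by blast
  then show "pd d (coord_fun c) K z = (if d = c then one_sf else 0) K z"
  proof cases
    case 1
    have "insert d K = {c} \<and> d \<notin> K \<longleftrightarrow> d = c \<and> K = {}" by auto
    then show ?thesis using 1 by (auto simp: pd_def coord_fun_def one_sf_def)
  qed (auto simp: pd_def coord_fun_def one_sf_def)
qed

lemma pd_one [simp]: "pd c one_sf = 0"
  by (auto simp: pd_def one_sf_def fun_eq_iff)

lemmas pointwise = plus_fun_apply zero_fun_apply minus_apply uminus_apply

(* With these as simp rules, eta-expanded sums of superfunctions are silently unfolded. *)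
declare pointwise [simp del]

section \<open>Vector fields as superderivations\<close>

definition hom_vf :: "bool \<Rightarrow> vfield \<Rightarrow> bool" where
  "hom_vf p V \<longleftrightarrow> (\<forall>c. hom (p \<noteq> is_odd c) (V c) \<and> superfun (V c))"

lemma hom_vfD: "hom_vf p V \<Longrightarrow> hom (p \<noteq> is_odd c) (V c)" "hom_vf p V \<Longrightarrow> superfun (V c)"
  by (auto simp: hom_vf_def)

text \<open>The index set in \<open>vf_apply\<close> depends on \<open>F\<close>; a common finite
  set makes the sums for different superfunctions comparable term by term.\<close>

lemma vf_apply_eq:
  assumes "superfun_in S F" "finite T" "S \<subseteq> T"
  shows "vf_apply V F = (\<Sum>c\<in>T. V c \<otimes> pd c F)"
  unfolding vf_apply_def
proof (rule sum.mono_neutral_left)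
  show "{c. pd c F \<noteq> 0} \<subseteq> T" using superfun_in_pd_zero[OF assms(1)] assms(3) by blast
qed (use assms in auto)

lemma superfun_common:
  assumes "superfun F" "superfun G"
  obtains S where "finite S" "superfun_in S F" "superfun_in S G"
  using assms superfun_in_mono unfolding superfun_def
  by (metis finite_UnI sup_ge1 sup_ge2)

lemma vf_apply_zero [simp]: "vf_apply V 0 = 0"
  by (simp add: vf_apply_def)

lemma vf_apply_add:
  assumes "superfun F" "superfun G"
  shows "vf_apply V (F + G) = vf_apply V F + vf_apply V G"
proof -
  from superfun_common[OF assms] obtain S where S: "finite S" "superfun_in S F" "superfun_in S G" .
  show ?thesis
    using vf_apply_eq[OF superfun_in_add[OF S(2,3)] S(1) order_refl]
      vf_apply_eq[OF S(2) S(1) order_refl] vf_apply_eq[OF S(3) S(1) order_refl]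
    by (simp add: pd_add assms sprod_add_right sum.distrib)
qed

lemma vf_apply_scal:
  assumes "superfun F"
  shows "vf_apply V (scal a F) = scal a (vf_apply V F)"
proof -
  from assms obtain S where S: "finite S" "superfun_in S F" by (auto simp: superfun_def)
  show ?thesis
    using vf_apply_eq[OF superfun_in_scal[OF S(2)] S(1) order_refl]
      vf_apply_eq[OF S(2) S(1) order_refl]
    by (simp add: pd_scal assms sprod_scal_right scal_sum)
qed

lemma vf_apply_minus: "superfun F \<Longrightarrow> vf_apply V (- F) = - vf_apply V F"
  using vf_apply_scal[of F V "-1"] by (simp add: scal_m1)

lemma vf_apply_diff:
  "superfun F \<Longrightarrow> superfun G \<Longrightarrow> vf_apply V (F - G) = vf_apply V F - vf_apply V G"
  using vf_apply_add[of F "- G" V] by (simp add: superfun_minus vf_apply_minus)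

lemma vf_apply_sum:
  "(\<And>i. i \<in> A \<Longrightarrow> superfun (F i)) \<Longrightarrow> vf_apply V (\<Sum>i\<in>A. F i) = (\<Sum>i\<in>A. vf_apply V (F i))"
  by (induction A rule: infinite_finite_induct) (simp_all add: superfun_sum vf_apply_add)

lemma vf_apply_coord: "oddsupp (V c) \<Longrightarrow> vf_apply V (coord_fun c) = V c"
  using vf_apply_eq[OF superfun_in_coord, of c "{c}" "{c}" V] by (simp add: pd_coord sprod_one)

lemma vf_apply_one [simp]: "vf_apply V one_sf = 0"
  by (simp add: vf_apply_def)

lemma superfun_vf_apply: "(\<And>c. superfun (V c)) \<Longrightarrow> superfun F \<Longrightarrow> superfun (vf_apply V F)"
  unfolding vf_apply_def by (intro superfun_sum superfun_sprod superfun_pd)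

lemma vf_apply_field_add:
  "vf_apply (\<lambda>c. V c + W c) F = vf_apply V F + vf_apply W F"
  by (simp add: vf_apply_def sprod_add_left sum.distrib)

lemma tw_tw: "tw p (tw q F) = tw (p \<noteq> q) F"
  by (simp add: tw_def)

lemma tw_sprod: "tw p (F \<otimes> G) = tw p F \<otimes> tw p G"
  by (simp add: tw_def parity_sprod)

lemma tw_hom: "hom q F \<Longrightarrow> tw p F = scal (sg (p \<and> q)) F"
  by (cases p) (simp_all add: hom_parity)

lemma tw_scal: "tw p (scal a F) = scal a (tw p F)"
  by (simp add: tw_def parity_scal)

lemma tw_add: "tw p (F + G) = tw p F + tw p G"
  by (simp add: tw_def parity_add)

text \<open>Left multiplication by \<open>V c\<close> is moved past F; the signs of \<open>V c\<close> and of the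
  partial derivative along c combine to the parity of V.\<close>

lemma vf_apply_sprod:
  assumes V: "hom_vf p V" and F: "superfun F" and G: "superfun G"
  shows "vf_apply V (F \<otimes> G) = vf_apply V F \<otimes> G + tw p F \<otimes> vf_apply V G"
proof -
  from superfun_common[OF F G] obtain S where S: "finite S" "superfun_in S F" "superfun_in S G" .
  have "V c \<otimes> tw (is_odd c) F = tw p F \<otimes> V c" for c
    using sprod_commute[of "V c" "tw (is_odd c) F" "p \<noteq> is_odd c"] hom_vfD[OF V, of c]
      superfun_oddsupp superfun_tw[OF F] by (simp add: tw_tw) (cases p; cases "is_odd c"; simp)
  then have *: "V c \<otimes> (tw (is_odd c) F \<otimes> H) = tw p F \<otimes> (V c \<otimes> H)" for c H
    by (simp flip: sprod_assoc)
  show ?thesis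
    using vf_apply_eq[OF superfun_in_sprod[OF S(2,3)] S(1) order_refl]
      vf_apply_eq[OF S(2) S(1) order_refl] vf_apply_eq[OF S(3) S(1) order_refl]
    by (simp add: pd_sprod F G sprod_add_right sum.distrib sprod_sum_left sprod_sum_right sprod_assoc *)
qed

lemma hom_vf_apply:
  assumes V: "hom_vf p V" and F: "superfun F" "hom q F"
  shows "hom (p \<noteq> q) (vf_apply V F)"
  unfolding vf_apply_def
proof (rule hom_sum)
  fix c
  have "hom ((p \<noteq> is_odd c) \<noteq> (q \<noteq> is_odd c)) (V c \<otimes> pd c F)"
    by (intro hom_sprod hom_vfD(1)[OF V] hom_pd F)
  moreover have "((p \<noteq> is_odd c) \<noteq> (q \<noteq> is_odd c)) = (p \<noteq> q)" by auto
  ultimately show "hom (p \<noteq> q) (V c \<otimes> pd c F)" by simp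
qed

lemma parity_vf_apply:
  assumes V: "hom_vf p V" and F: "superfun F"
  shows "parity (vf_apply V F) = scal (sg p) (vf_apply V (parity F))"
proof -
  from F obtain S where S: "finite S" "superfun_in S F" by (auto simp: superfun_def)
  have "parity (V c \<otimes> pd c F) = scal (sg p) (V c \<otimes> pd c (parity F))" for c
    using hom_parity[OF hom_vfD(1)[OF V]] sg_neq[of p "is_odd c"] F
    by (simp add: parity_sprod pd_parity sprod_scal_left sprod_scal_right)
  then show ?thesis
    using vf_apply_eq[OF S(2) S(1) order_refl, of V]
      vf_apply_eq[OF superfun_in_parity[OF S(2)] S(1) order_refl, of V]
    by (simp add: parity_sum scal_sum)
qed

lemma hom_vf_part: "hom_vf p V \<Longrightarrow> vf_part q V = (if p = q then V else 0)"
proof (intro ext)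
  fix c K z assume "hom_vf p V"
  then have "odd (card K) = (p \<noteq> is_odd c)" if "V c K z \<noteq> 0"
    using that by (auto simp: hom_vf_def hom_def)
  then show "vf_part q V c K z = (if p = q then V else 0) c K z"
    by (cases "V c K z = 0") (auto simp: vf_part_def pointwise)
qed


section \<open>Functions on M and linear functions on the jets\<close>

lemma finite_base: "finite base" by (simp add: base_def)

lemma base_cases:
  assumes "b \<in> base"
  obtains "b = Yc" | i where "b = Oc i"
  using assms by (auto simp: base_def)

lemma Yc_base [simp]: "Yc \<in> base" by (simp add: base_def)
lemma Oc_base [simp]: "Oc i \<in> base" by (cases i) (simp_all add: base_def)
lemma Jet_base [simp]: "Jet m I \<notin> base" by (simp add: base_def)
lemma theta_base [simp]: "theta k \<in> base" by (simp add: theta_def)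
lemma nu_base [simp]: "nu k \<in> base" by (simp add: nu_def)

lemma fun_on_M_superfun: "fun_on_M g \<Longrightarrow> superfun g"
  unfolding fun_on_M_def using superfunI finite_base by blast

lemma fun_on_M_intros [intro, simp]:
  "fun_on_M 0" "fun_on_M one_sf"
  "b \<in> base \<Longrightarrow> fun_on_M (coord_fun b)"
  "fun_on_M f \<Longrightarrow> fun_on_M g \<Longrightarrow> fun_on_M (f + g)"
  "fun_on_M f \<Longrightarrow> fun_on_M g \<Longrightarrow> fun_on_M (f - g)"
  "fun_on_M f \<Longrightarrow> fun_on_M (- f)"
  "fun_on_M f \<Longrightarrow> fun_on_M (scal a f)"
  "fun_on_M f \<Longrightarrow> fun_on_M (parity f)"
  "fun_on_M f \<Longrightarrow> fun_on_M g \<Longrightarrow> fun_on_M (f \<otimes> g)"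
  "fun_on_M f \<Longrightarrow> fun_on_M (pd c f)"
  unfolding fun_on_M_def
  by (rule superfun_in_zero superfun_in_one superfun_in_coord superfun_in_add superfun_in_diff
    superfun_in_minus superfun_in_scal superfun_in_parity superfun_in_sprod superfun_in_pd; assumption)+

lemma fun_on_M_tw [intro, simp]: "fun_on_M f \<Longrightarrow> fun_on_M (tw p f)"
  by (simp add: tw_def)

lemma fun_on_M_sum [intro, simp]: "(\<And>i. i \<in> A \<Longrightarrow> fun_on_M (F i)) \<Longrightarrow> fun_on_M (\<Sum>i\<in>A. F i)"
  unfolding fun_on_M_def by (rule superfun_in_sum)

lemma vf_apply_M: "fun_on_M g \<Longrightarrow> vf_apply V g = (\<Sum>c\<in>base. V c \<otimes> pd c g)"
  unfolding fun_on_M_def using vf_apply_eq finite_base by blast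

text \<open>Total derivatives and the prolongations used here preserve this class. It avoids
  products of jets, so identities between such operators need checking only on functions on M and on
  their products with one jet. The part without jets accommodates vertical fields, which map jets to
  functions on M.\<close>

inductive_set jet_affine :: "superfun set" where
  base: "fun_on_M g \<Longrightarrow> g \<in> jet_affine"
| jet: "fun_on_M g \<Longrightarrow> g \<otimes> coord_fun (Jet m I) \<in> jet_affine"
| add: "F \<in> jet_affine \<Longrightarrow> G \<in> jet_affine \<Longrightarrow> F + G \<in> jet_affine"

inductive_set jet_linear :: "superfun set" where
  zero: "0 \<in> jet_linear"
| jet: "fun_on_M g \<Longrightarrow> g \<otimes> coord_fun (Jet m I) \<in> jet_linear"
| add: "F \<in> jet_linear \<Longrightarrow> G \<in> jet_linear \<Longrightarrow> F + G \<in> jet_linear"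

lemma jet_linear_affine: "F \<in> jet_linear \<Longrightarrow> F \<in> jet_affine"
  by (induction rule: jet_linear.induct) (auto intro: jet_affine.intros)

lemma jet_affine_superfun: "F \<in> jet_affine \<Longrightarrow> superfun F"
  by (induction rule: jet_affine.induct)
    (simp_all add: fun_on_M_superfun superfun_add superfun_sprod)

lemma jet_linear_superfun: "F \<in> jet_linear \<Longrightarrow> superfun F"
  using jet_affine_superfun jet_linear_affine by blast

lemma one_sprod_superfun: "superfun F \<Longrightarrow> one_sf \<otimes> F = F"
  and sprod_one_superfun: "superfun F \<Longrightarrow> F \<otimes> one_sf = F"
  by (simp_all add: one_sprod sprod_one superfun_oddsupp)

lemma jet_linear_coord: "coord_fun (Jet m I) \<in> jet_linear"
  using jet_linear.jet[of one_sf m I] by (simp add: one_sprod_superfun)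

lemma jet_affine_sprod: "F \<in> jet_affine \<Longrightarrow> fun_on_M g \<Longrightarrow> g \<otimes> F \<in> jet_affine"
proof (induction rule: jet_affine.induct)
  case (jet h m I)
  then have "(g \<otimes> h) \<otimes> coord_fun (Jet m I) \<in> jet_affine" by (intro jet_affine.jet) simp
  then show ?case by (simp add: sprod_assoc)
qed (auto intro: jet_affine.intros simp: sprod_add_right)

lemma jet_linear_sprod: "F \<in> jet_linear \<Longrightarrow> fun_on_M g \<Longrightarrow> g \<otimes> F \<in> jet_linear"
proof (induction rule: jet_linear.induct)
  case (jet h m I)
  then have "(g \<otimes> h) \<otimes> coord_fun (Jet m I) \<in> jet_linear" by (intro jet_linear.jet) simp
  then show ?case by (simp add: sprod_assoc)
qed (auto intro: jet_linear.intros simp: sprod_add_right)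

lemma scal_one_sprod: "superfun F \<Longrightarrow> scal a F = scal a one_sf \<otimes> F"
  by (simp add: sprod_scal_left one_sprod_superfun)

lemma jet_affine_scal: "F \<in> jet_affine \<Longrightarrow> scal a F \<in> jet_affine"
  using jet_affine_sprod[of F "scal a one_sf"] scal_one_sprod[OF jet_affine_superfun] by simp

lemma jet_linear_scal: "F \<in> jet_linear \<Longrightarrow> scal a F \<in> jet_linear"
  using jet_linear_sprod[of F "scal a one_sf"] scal_one_sprod[OF jet_linear_superfun] by simp

lemma jet_affine_diff: "F \<in> jet_affine \<Longrightarrow> G \<in> jet_affine \<Longrightarrow> F - G \<in> jet_affine"
  using jet_affine.add[of F "scal (-1) G"] jet_affine_scal[of G "-1"] by (simp add: scal_m1)

lemma jet_linear_diff: "F \<in> jet_linear \<Longrightarrow> G \<in> jet_linear \<Longrightarrow> F - G \<in> jet_linear"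
  using jet_linear.add[of F "scal (-1) G"] jet_linear_scal[of G "-1"] by (simp add: scal_m1)

lemma jet_affine_sum: "(\<And>i. i \<in> A \<Longrightarrow> F i \<in> jet_affine) \<Longrightarrow> (\<Sum>i\<in>A. F i) \<in> jet_affine"
  by (induction A rule: infinite_finite_induct) (auto intro: jet_affine.intros)

lemma jet_linear_sum: "(\<And>i. i \<in> A \<Longrightarrow> F i \<in> jet_linear) \<Longrightarrow> (\<Sum>i\<in>A. F i) \<in> jet_linear"
  by (induction A rule: infinite_finite_induct) (auto intro: jet_linear.intros)

lemma jet_affine_tw: "F \<in> jet_affine \<Longrightarrow> tw p F \<in> jet_affine"
proof (induction rule: jet_affine.induct)
  case (jet g m I)
  then show ?case
    by (simp add: tw_sprod tw_hom[OF hom_coord] jet_affine_scal sprod_scal_right jet_affine.jet)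
qed (auto intro: jet_affine.intros simp: tw_add)

lemma jet_linear_vf_apply:
  assumes V: "hom_vf p V" and J: "\<And>m I. V (Jet m I) \<in> jet_linear"
    and M: "\<And>g. fun_on_M g \<Longrightarrow> fun_on_M (vf_apply V g)"
  shows "F \<in> jet_linear \<Longrightarrow> vf_apply V F \<in> jet_linear"
proof (induction rule: jet_linear.induct)
  case (jet g m I)
  have "vf_apply V (coord_fun (Jet m I)) = V (Jet m I)"
    by (intro vf_apply_coord superfun_oddsupp hom_vfD[OF V])
  then show ?case
    using jet M J
    by (simp add: vf_apply_sprod[OF V] fun_on_M_superfun jet_linear.add jet_linear.jet jet_linear_sprod)
qed (simp_all add: jet_linear.intros vf_apply_add jet_linear_superfun)

lemma jet_affine_vf_apply:
  assumes V: "hom_vf p V" and J: "\<And>m I. V (Jet m I) \<in> jet_affine"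
    and M: "\<And>g. fun_on_M g \<Longrightarrow> fun_on_M (vf_apply V g)"
  shows "F \<in> jet_affine \<Longrightarrow> vf_apply V F \<in> jet_affine"
proof (induction rule: jet_affine.induct)
  case (jet g m I)
  have "vf_apply V (coord_fun (Jet m I)) = V (Jet m I)"
    by (intro vf_apply_coord superfun_oddsupp hom_vfD[OF V])
  then show ?case
    using jet M J
    by (simp add: vf_apply_sprod[OF V] fun_on_M_superfun jet_affine.add jet_affine.jet jet_affine_sprod)
qed (use M in \<open>simp_all add: jet_affine.intros vf_apply_add jet_affine_superfun\<close>)

lemma jet_affine_eqI:
  assumes add: "\<And>F G. F \<in> jet_affine \<Longrightarrow> G \<in> jet_affine \<Longrightarrow> u F = v F \<Longrightarrow> u G = v G \<Longrightarrow> u (F + G) = v (F + G)"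
    and M: "\<And>g. fun_on_M g \<Longrightarrow> u g = v g"
    and jet: "\<And>g m I. fun_on_M g \<Longrightarrow> u (g \<otimes> coord_fun (Jet m I)) = v (g \<otimes> coord_fun (Jet m I))"
  shows "F \<in> jet_affine \<Longrightarrow> u F = v F"
  by (induction rule: jet_affine.induct) (auto intro: assms)

section \<open>Total derivatives\<close>

text \<open>The sign of moving the derivative along \<open>i\<close> from the front to its place in
  the fixed order of the derivatives indexed by \<open>I\<close>.\<close>

definition eps :: "odd_var \<Rightarrow> odd_var set \<Rightarrow> complex" where
  "eps i I = (-1) ^ card {j \<in> I. var_rank j < var_rank i}"

lemma eps_sq [simp]: "eps i I * eps i I = 1"
  by (simp add: eps_def flip: power_add)

lemma eps_insert: "k \<notin> I \<Longrightarrow> eps i (insert k I) = eps i I * sg (var_rank k < var_rank i)"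
  unfolding eps_def by (subst card_filter_insert) (simp_all add: power_add sg_def)

lemma eps_eval:
  "eps Theta1 I = 1"
  "eps Theta2 I = sg (Theta1 \<in> I)"
  "eps Nu1 I = sg (Theta1 \<in> I) * sg (Theta2 \<in> I)"
  "eps Nu2 I = sg (Theta1 \<in> I) * sg (Theta2 \<in> I) * sg (Nu1 \<in> I)"
proof -
  have *: "(-1) ^ card {j \<in> I. P j} = (\<Prod>j\<in>UNIV. sg (j \<in> I \<and> P j))" for P
  proof -
    have "(\<Prod>j\<in>UNIV. sg (j \<in> I \<and> P j)) = (\<Prod>j\<in>UNIV. if j \<in> {j \<in> I. P j} then -1 else 1)"
      by (intro prod.cong refl) (simp add: sg_def)
    also have "\<dots> = (\<Prod>j\<in>{j \<in> I. P j}. - 1)"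
      by (subst prod.inter_restrict[symmetric]) auto
    finally show ?thesis by simp
  qed
  show "eps Theta1 I = 1" "eps Theta2 I = sg (Theta1 \<in> I)"
    "eps Nu1 I = sg (Theta1 \<in> I) * sg (Theta2 \<in> I)"
    "eps Nu2 I = sg (Theta1 \<in> I) * sg (Theta2 \<in> I) * sg (Nu1 \<in> I)"
    unfolding eps_def * by (simp_all add: UNIV_odd_var)
qed

lemma hom_vf_total:
  assumes "b \<in> base"
  shows "hom_vf (is_odd b) (total_vf b)"
  using assms
proof (rule base_cases)
  assume b: "b = Yc"
  show ?thesis
    unfolding hom_vf_def
  proof
    fix c
    show "hom (is_odd b \<noteq> is_odd c) (total_vf b c) \<and> superfun (total_vf b c)"
    proof (cases c)
      case (Jet m I)
      then show ?thesis using b hom_coord[of "Jet (Suc m) I"] by simp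
    qed (use b in \<open>simp_all add: hom_one\<close>)
  qed
next
  fix i assume b: "b = Oc i"
  show ?thesis
    unfolding hom_vf_def
  proof
    fix c
    show "hom (is_odd b \<noteq> is_odd c) (total_vf b c) \<and> superfun (total_vf b c)"
    proof (cases c)
      case (Jet m I)
      then show ?thesis
        using b hom_coord[of "Jet m (insert i I)"]
        by (cases "i \<in> I") (auto intro: hom_scal superfun_scal)
    qed (use b in \<open>auto simp: hom_one\<close>)
  qed
qed

lemma D_zero [simp]: "D b 0 = 0"
  and D_one [simp]: "D b one_sf = 0"
  and D_add: "superfun F \<Longrightarrow> superfun G \<Longrightarrow> D b (F + G) = D b F + D b G"
  and D_diff: "superfun F \<Longrightarrow> superfun G \<Longrightarrow> D b (F - G) = D b F - D b G"
  and D_scal: "superfun F \<Longrightarrow> D b (scal a F) = scal a (D b F)"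
  by (simp_all add: D_def vf_apply_add vf_apply_diff vf_apply_scal)

lemma D_sum: "(\<And>i. i \<in> A \<Longrightarrow> superfun (F i)) \<Longrightarrow> D b (\<Sum>i\<in>A. F i) = (\<Sum>i\<in>A. D b (F i))"
  by (simp add: D_def vf_apply_sum)

lemma superfun_D: "b \<in> base \<Longrightarrow> superfun F \<Longrightarrow> superfun (D b F)"
  unfolding D_def using superfun_vf_apply hom_vfD(2)[OF hom_vf_total] by blast

lemma D_sprod:
  "b \<in> base \<Longrightarrow> superfun F \<Longrightarrow> superfun G \<Longrightarrow>
    D b (F \<otimes> G) = D b F \<otimes> G + tw (is_odd b) F \<otimes> D b G"
  unfolding D_def by (rule vf_apply_sprod[OF hom_vf_total])

lemma hom_D: "b \<in> base \<Longrightarrow> superfun F \<Longrightarrow> hom q F \<Longrightarrow> hom (is_odd b \<noteq> q) (D b F)"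
  unfolding D_def by (rule hom_vf_apply[OF hom_vf_total])

lemma tw_vf_apply:
  "hom_vf p V \<Longrightarrow> superfun F \<Longrightarrow> tw q (vf_apply V F) = scal (sg (p \<and> q)) (vf_apply V (tw q F))"
  by (cases q) (simp_all add: parity_vf_apply)

lemma tw_D: "b \<in> base \<Longrightarrow> superfun F \<Longrightarrow> tw q (D b F) = scal (sg (is_odd b \<and> q)) (D b (tw q F))"
  unfolding D_def by (rule tw_vf_apply[OF hom_vf_total])

lemma D_coord: "b \<in> base \<Longrightarrow> D b (coord_fun c) = total_vf b c"
  unfolding D_def using hom_vfD(2)[OF hom_vf_total] superfun_oddsupp by (intro vf_apply_coord) blast

lemma D_M:
  assumes "b \<in> base" "fun_on_M g"
  shows "D b g = pd b g"
proof -
  have "D b g = (\<Sum>c\<in>base. total_vf b c \<otimes> pd c g)"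
    unfolding D_def using assms by (simp add: vf_apply_M)
  also have "\<dots> = (\<Sum>c\<in>base. if c = b then pd c g else 0)"
  proof (rule sum.cong[OF refl])
    fix c assume "c \<in> base"
    then show "total_vf b c \<otimes> pd c g = (if c = b then pd c g else 0)"
      using assms by (elim base_cases) (auto simp: one_sprod_superfun fun_on_M_superfun)
  qed
  also have "\<dots> = pd b g" using assms finite_base by simp
  finally show ?thesis .
qed

lemma D_Yc_jet [simp]: "D Yc (coord_fun (Jet m I)) = coord_fun (Jet (Suc m) I)"
  by (simp add: D_coord)

lemma D_Oc_jet [simp]:
  "D (Oc i) (coord_fun (Jet m I)) =
    (if i \<in> I then 0 else scal (eps i I) (coord_fun (Jet m (insert i I))))"
  by (simp add: D_coord eps_def)

lemma total_vf_jet: "b \<in> base \<Longrightarrow> total_vf b (Jet m I) \<in> jet_linear"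
  by (erule base_cases) (auto intro: jet_linear_coord jet_linear.zero jet_linear_scal)

lemma D_linear: "b \<in> base \<Longrightarrow> F \<in> jet_linear \<Longrightarrow> D b F \<in> jet_linear"
  unfolding D_def
  by (rule jet_linear_vf_apply[OF hom_vf_total]) (simp_all add: total_vf_jet D_M flip: D_def)

lemma D_affine: "b \<in> base \<Longrightarrow> F \<in> jet_affine \<Longrightarrow> D b F \<in> jet_affine"
  unfolding D_def
  by (rule jet_affine_vf_apply[OF hom_vf_total])
    (simp_all add: total_vf_jet D_M jet_linear_affine flip: D_def)

text \<open>Adjoining \<open>b\<close> to the index set changes the sign for \<open>c\<close>
  exactly when \<open>b\<close> ranks below \<open>c\<close>. This affects one of the two orders,
  whence the minus sign.\<close>

lemma pd_odd_commute:
  assumes "superfun F" "is_odd b" "is_odd c"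
  shows "pd b (pd c F) = - pd c (pd b F)"
proof (intro ext)
  fix K z
  define e where "e c K = (-1::complex) ^ card {i \<in> K. rank i < rank c}" for c K
  have e: "e c (insert b K) = e c K * sg (rank b < rank c)" if "finite K" "b \<notin> K" for b c K
    unfolding e_def using that by (subst card_filter_insert) (simp_all add: power_add sg_def)
  have pdc: "pd c F K z = e c K * F (insert c K) z" if "c \<notin> K" "is_odd c" for c F K
    using that by (simp add: pd_def e_def)
  show "pd b (pd c F) K z = (- pd c (pd b F)) K z"
  proof (cases "finite K \<and> b \<noteq> c \<and> b \<notin> K \<and> c \<notin> K")
    case True
    have "rank b \<noteq> rank c" using True assms rank_inj by blast
    then have "sg (rank b < rank c) = - sg (rank c < rank b)" by (auto simp: sg_def)
    moreover have "c \<notin> insert b K" "b \<notin> insert c K" using True by auto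
    ultimately show ?thesis
      using True e[of K b c] e[of K c b] assms
      by (simp add: pdc pointwise insert_commute del: insert_iff)
  next
    case False
    have "F (insert c (insert b K)) z = 0" if "infinite K"
      using superfun_oddsupp[OF assms(1)] that unfolding oddsupp_def by (metis finite_insert)
    then show ?thesis using False assms by (auto simp: pd_def pointwise insert_commute)
  qed
qed

lemma pd_even_odd_commute:
  assumes "superfun F" "\<not> is_odd b" "is_odd c"
  shows "pd b (pd c F) = pd c (pd b F)"
proof (intro ext)
  fix K z
  show "pd b (pd c F) K z = pd c (pd b F) K z"
  proof (rule pd_eqI[OF assms(2)])
    show "((\<lambda>t. pd c F K (z(b := t))) has_field_derivative pd c (pd b F) K z) (at (z b))"
    proof (cases "c \<in> K")
      case False
      show ?thesis
        using DERIV_cmult[OF DERIV_pd[OF assms(1,2), of "insert c K" z],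
            of "(-1) ^ card {i \<in> K. rank i < rank c}"] False assms
        by (simp add: pd_def[of c])
    qed (simp add: pd_def[of c] assms)
  qed
qed

text \<open>The only even coordinate in \<open>base\<close> is \<open>Yc\<close>, so the symmetry of
  mixed even derivatives never comes up.\<close>

lemma pd_commute:
  assumes "superfun F" "b \<in> base" "c \<in> base"
  shows "pd b (pd c F) = scal (sg (is_odd b \<and> is_odd c)) (pd c (pd b F))"
proof (cases "is_odd b"; cases "is_odd c")
  assume "is_odd b" "is_odd c"
  then show ?thesis using pd_odd_commute[OF assms(1), of b c] by (simp add: scal_m1)
next
  assume "is_odd b" "\<not> is_odd c"
  then show ?thesis using pd_even_odd_commute[OF assms(1), of c b] by simp
next
  assume "\<not> is_odd b" "is_odd c"
  then show ?thesis using pd_even_odd_commute[OF assms(1), of b c] by simp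
next
  assume "\<not> is_odd b" "\<not> is_odd c"
  then have "b = Yc" "c = Yc" using assms by (auto simp: base_def)
  then show ?thesis by simp
qed

text \<open>The total derivatives are superderivations, so it suffices to know the rule on functions
  on M, where it is \<open>pd_commute\<close>, and on single jets, where it is a comparison of the
  signs \<open>eps\<close>.\<close>

lemma D_commute:
  assumes b: "b \<in> base" and c: "c \<in> base"
  shows "F \<in> jet_affine \<Longrightarrow> D b (D c F) = scal (sg (is_odd b \<and> is_odd c)) (D c (D b F))"
proof (erule jet_affine_eqI[rotated -1])
  fix F G
  assume FG: "F \<in> jet_affine" "G \<in> jet_affine"
    and "D b (D c F) = scal (sg (is_odd b \<and> is_odd c)) (D c (D b F))"
      "D b (D c G) = scal (sg (is_odd b \<and> is_odd c)) (D c (D b G))"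
  then show "D b (D c (F + G)) = scal (sg (is_odd b \<and> is_odd c)) (D c (D b (F + G)))"
    using b c by (simp add: D_add jet_affine_superfun superfun_D scal_add)
next
  fix g assume g: "fun_on_M g"
  then show "D b (D c g) = scal (sg (is_odd b \<and> is_odd c)) (D c (D b g))"
    using b c pd_commute[OF fun_on_M_superfun[OF g] b c] by (simp add: D_M)
next
  fix g m I assume g: "fun_on_M g"
  let ?J = "coord_fun (Jet m I)" and ?s = "sg (is_odd b \<and> is_odd c)"
  have J: "D b (D c ?J) = scal ?s (D c (D b ?J))"
    using b
  proof (rule base_cases)
    assume b': "b = Yc"
    from c show ?thesis
      by (rule base_cases) (simp_all add: b' D_scal)
  next
    fix i assume b': "b = Oc i"
    from c show ?thesis
    proof (rule base_cases)
      fix j assume c': "c = Oc j"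
      show ?thesis
      proof (cases "i = j \<or> i \<in> I \<or> j \<in> I")
        case False
        then have "sg (var_rank i < var_rank j) = - sg (var_rank j < var_rank i)"
          using var_rank_inj[of i j] by (auto simp: sg_def)
        then show ?thesis
          using False by (auto simp: b' c' D_scal eps_insert insert_commute mult_ac)
      qed (auto simp: b' c' D_scal)
    qed (simp_all add: b' D_scal)
  qed
  have sJ: "superfun (D b ?J)" "superfun (D c ?J)" "superfun (D b g)" "superfun (D c g)"
    "superfun g" "superfun (tw p g)" for p
    using b c g by (simp_all add: superfun_D fun_on_M_superfun)
  have 1: "D b (D c g) = scal ?s (D c (D b g))"
    using b c pd_commute[OF sJ(5) b c] g by (simp add: D_M)
  show "D b (D c (g \<otimes> ?J)) = scal ?s (D c (D b (g \<otimes> ?J)))"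
    using b c sJ tw_D[OF b sJ(5), of "is_odd c"] tw_D[OF c sJ(5), of "is_odd b"]
    by (simp add: D_sprod D_add superfun_sprod superfun_D superfun_scal J 1 scal_add
        sprod_scal_left sprod_scal_right tw_tw conj_commute add_ac)
      (cases "is_odd b"; cases "is_odd c"; simp add: add_ac)
qed

lemma D_pow_affine: "F \<in> jet_affine \<Longrightarrow> (D Yc ^^ m) F \<in> jet_affine"
  by (induction m) (simp_all add: D_affine)

lemma D_Oc_Yc_pow: "F \<in> jet_affine \<Longrightarrow> D (Oc i) ((D Yc ^^ m) F) = (D Yc ^^ m) (D (Oc i) F)"
  by (induction m) (simp_all add: D_commute[of "Oc i" Yc] D_pow_affine)

lemma D_Oc_anticommute: "F \<in> jet_affine \<Longrightarrow> D (Oc i) (D (Oc j) F) = - D (Oc j) (D (Oc i) F)"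
  using D_commute[of "Oc i" "Oc j" F] by (simp add: scal_m1)

lemma D_Oc_sq:
  assumes "F \<in> jet_affine"
  shows "D (Oc i) (D (Oc i) F) = 0"
proof (intro ext)
  fix K z
  have self_neg: "x = 0" if "x = - x" for x :: complex
  proof -
    have "2 * x = 0" using that add_eq_0_iff[of x x] unfolding mult_2 by blast
    then show ?thesis by simp
  qed
  have "D (Oc i) (D (Oc i) F) K z = (- D (Oc i) (D (Oc i) F)) K z"
    using D_Oc_anticommute[OF assms, of i i] by (rule arg_cong[of _ _ "\<lambda>X. X K z"])
  then show "D (Oc i) (D (Oc i) F) K z = 0 K z"
    unfolding pointwise by (rule self_neg)
qed

lemma D_minus: "superfun F \<Longrightarrow> D b (- F) = - D b F"
  by (simp add: D_def vf_apply_minus)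

definition D_odd :: "odd_var set \<Rightarrow> superfun \<Rightarrow> superfun" where
  "D_odd I F = foldr (\<lambda>i G. if i \<in> I then D (Oc i) G else G) [Theta1, Theta2, Nu1, Nu2] F"

lemma D_multi_odd: "D_multi m I F = (D Yc ^^ m) (D_odd I F)"
  by (simp add: D_multi_def D_odd_def)

lemma D_odd_affine: "F \<in> jet_affine \<Longrightarrow> D_odd I F \<in> jet_affine"
  by (simp add: D_odd_def D_affine)

lemma D_multi_affine: "F \<in> jet_affine \<Longrightarrow> D_multi m I F \<in> jet_affine"
  by (simp add: D_multi_odd D_pow_affine D_odd_affine)

text \<open>The iterated derivatives of any \<open>F\<close> obey the recursion of the jet
  coordinates, with the same signs. This lets statements about prolongations be proved by induction
  over jets.\<close>

lemma D_Oc_odd: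
  assumes F: "F \<in> jet_affine"
  shows "D (Oc i) (D_odd I F) = (if i \<in> I then 0 else scal (eps i I) (D_odd (insert i I) F))"
proof -
  have a: "D (Oc j) G \<in> jet_affine" "superfun (D (Oc j) G)" if "G \<in> jet_affine" for j G
    using that D_affine jet_affine_superfun by simp_all
  \<comment> \<open>Only pairs in the wrong order are swapped, so rewriting sorts the derivatives
    and stops.\<close>
  note ac = D_Oc_anticommute[of _ Theta2 Theta1] D_Oc_anticommute[of _ Nu1 Theta1]
    D_Oc_anticommute[of _ Nu2 Theta1] D_Oc_anticommute[of _ Nu1 Theta2]
    D_Oc_anticommute[of _ Nu2 Theta2] D_Oc_anticommute[of _ Nu2 Nu1]
  show ?thesis
    by (cases i; cases "Theta1 \<in> I"; cases "Theta2 \<in> I"; cases "Nu1 \<in> I"; cases "Nu2 \<in> I";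
        simp add: D_odd_def eps_eval ac D_Oc_sq a F jet_affine_superfun D_minus scal_m1)
qed

lemma D_pow_scal: "F \<in> jet_affine \<Longrightarrow> (D Yc ^^ m) (scal a F) = scal a ((D Yc ^^ m) F)"
  by (induction m) (simp_all add: D_scal D_pow_affine jet_affine_superfun)

lemma D_pow_add:
  "F \<in> jet_affine \<Longrightarrow> G \<in> jet_affine \<Longrightarrow> (D Yc ^^ m) (F + G) = (D Yc ^^ m) F + (D Yc ^^ m) G"
  by (induction m) (simp_all add: D_add D_pow_affine jet_affine_superfun)

lemma D_pow_zero [simp]: "(D Yc ^^ m) 0 = 0"
  by (induction m) simp_all

lemma D_multi_Suc: "D Yc (D_multi m I F) = D_multi (Suc m) I F"
  by (simp add: D_multi_odd)

lemma D_multi_insert: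
  assumes F: "F \<in> jet_affine"
  shows "D (Oc i) (D_multi m I F) = (if i \<in> I then 0 else scal (eps i I) (D_multi m (insert i I) F))"
  by (simp add: D_multi_odd D_Oc_Yc_pow D_odd_affine F D_Oc_odd D_pow_scal)

lemma D_multi_zero [simp]: "D_multi 0 {} F = F"
  by (simp add: D_multi_odd D_odd_def)

lemma jet_induct [case_names h Suc insert]:
  fixes P :: "nat \<Rightarrow> odd_var set \<Rightarrow> bool"
  assumes "P 0 {}" "\<And>m I. P m I \<Longrightarrow> P (Suc m) I" "\<And>m I i. P m I \<Longrightarrow> i \<notin> I \<Longrightarrow> P m (insert i I)"
  shows "P m I"
proof -
  have "P m {}" by (induction m) (use assms in auto)
  moreover have "finite I" by simp
  ultimately show ?thesis by (induction I rule: finite_induct[rotated]) (use assms in auto)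
qed

lemma scal_eps_cancel: "scal (eps i I) F = scal (eps i I) G \<longleftrightarrow> F = G"
proof
  assume "scal (eps i I) F = scal (eps i I) G"
  then have "scal (eps i I) (scal (eps i I) F) = scal (eps i I) (scal (eps i I) G)" by simp
  then show "F = G" by simp
qed simp

lemma hom_scal_eps: "hom p (scal (eps i I) F) \<longleftrightarrow> hom p F"
  using hom_scal[of p "scal (eps i I) F" "eps i I"] hom_scal[of p F "eps i I"] by auto

lemma hfun_affine [simp]: "hfun \<in> jet_affine"
  by (simp add: hfun_def jet_linear_coord jet_linear_affine)

lemma D_odd_scal: "F \<in> jet_affine \<Longrightarrow> D_odd I (scal a F) = scal a (D_odd I F)"
  by (simp add: D_odd_def D_scal jet_affine_superfun D_affine)

lemma D_odd_add: "F \<in> jet_affine \<Longrightarrow> G \<in> jet_affine \<Longrightarrow> D_odd I (F + G) = D_odd I F + D_odd I G"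
  by (simp add: D_odd_def D_add jet_affine_superfun D_affine)

lemma D_multi_scal: "F \<in> jet_affine \<Longrightarrow> D_multi m I (scal a F) = scal a (D_multi m I F)"
  by (simp add: D_multi_odd D_odd_scal D_pow_scal D_odd_affine)

lemma D_multi_add:
  "F \<in> jet_affine \<Longrightarrow> G \<in> jet_affine \<Longrightarrow> D_multi m I (F + G) = D_multi m I F + D_multi m I G"
  by (simp add: D_multi_odd D_odd_add D_pow_add D_odd_affine)

lemma hom_D_multi:
  assumes "F \<in> jet_affine" "hom p F"
  shows "hom (p \<noteq> odd (card I)) (D_multi m I F)"
proof (induction m I rule: jet_induct)
  case (Suc m I)
  then show ?case
    using hom_D[of Yc "D_multi m I F"] D_multi_affine[OF assms(1)] jet_affine_superfun
    by (simp add: D_multi_Suc)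
next
  case (insert m I i)
  have "hom (is_odd (Oc i) \<noteq> (p \<noteq> odd (card I))) (D (Oc i) (D_multi m I F))"
    by (rule hom_D[OF Oc_base jet_affine_superfun[OF D_multi_affine[OF assms(1)]] insert(1)])
  moreover have "(is_odd (Oc i) \<noteq> (p \<noteq> odd (card I))) = (p \<noteq> odd (card (insert i I)))"
    using insert(2) by auto
  ultimately show ?case
    using insert(2) unfolding D_multi_insert[OF assms(1)] by (simp add: hom_scal_eps)
qed (use assms in simp)


section \<open>Prolongations\<close>

text \<open>Broad enough for lifted contact fields, whose coefficient along h is a multiple of h,
  and for vertical fields, where it is a function on M; narrow enough that prolongations stay within
  \<open>jet_affine\<close>.\<close>

definition admissible :: "bool \<Rightarrow> vfield \<Rightarrow> bool" where
  "admissible p V \<longleftrightarrow> (\<forall>b\<in>base. fun_on_M (V b) \<and> hom (p \<noteq> is_odd b) (V b)) \<and>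
     V (Jet 0 {}) \<in> jet_affine \<and> hom p (V (Jet 0 {}))"

lemma admissibleD:
  assumes "admissible p V"
  shows "b \<in> base \<Longrightarrow> fun_on_M (V b)" "b \<in> base \<Longrightarrow> hom (p \<noteq> is_odd b) (V b)"
    "V (Jet 0 {}) \<in> jet_affine" "hom p (V (Jet 0 {}))"
  using assms by (auto simp: admissible_def)

lemma characteristic_affine:
  "admissible p V \<Longrightarrow> characteristic V \<in> jet_affine"
  unfolding characteristic_def
  by (intro jet_affine_diff jet_affine_sum jet_affine_sprod D_affine) (auto simp: admissibleD)

lemma hom_characteristic:
  assumes "admissible p V"
  shows "hom p (characteristic V)"
  unfolding characteristic_def
proof (intro hom_diff hom_sum)
  fix b assume b: "b \<in> base"
  have "hom ((p \<noteq> is_odd b) \<noteq> (is_odd b \<noteq> False)) (V b \<otimes> D b hfun)"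
    using b hom_coord[of "Jet 0 {}"]
    by (intro hom_sprod admissibleD[OF assms] hom_D) (simp_all add: hfun_def)
  then show "hom p (V b \<otimes> D b hfun)" by (cases "is_odd b") simp_all
qed (use assms in \<open>simp add: admissibleD\<close>)

lemma parity_pow_hom: "hom p F \<Longrightarrow> (parity ^^ n) F = scal (sg (p \<and> odd n)) F"
  by (induction n) (auto simp: hom_parity parity_scal sg_def)

lemma prolong_base [simp]: "b \<in> base \<Longrightarrow> prolong V b = V b"
  by (erule base_cases) (simp_all add: prolong_def)

lemma prolong_jet:
  assumes "admissible p V"
  shows "prolong V (Jet m I) = (\<Sum>b\<in>base. V b \<otimes> D b (coord_fun (Jet m I)))
     + scal (sg (p \<and> odd (card I))) (D_multi m I (characteristic V))"
  by (simp add: prolong_def parity_pow_hom[OF hom_characteristic[OF assms]] D_multi_scal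
      characteristic_affine[OF assms])

lemma prolong_h: "admissible p V \<Longrightarrow> prolong V (Jet 0 {}) = V (Jet 0 {})"
  using prolong_jet[of p V 0 "{}"] by (simp add: characteristic_def hfun_def)

lemma prolong_jet_affine: "admissible p V \<Longrightarrow> prolong V (Jet m I) \<in> jet_affine"
  unfolding prolong_jet
  by (intro jet_affine.add jet_affine_sum jet_affine_sprod jet_affine_scal D_affine D_multi_affine
      characteristic_affine) (auto simp: admissibleD jet_linear_affine jet_linear_coord)

lemma hom_vf_prolong:
  assumes V: "admissible p V"
  shows "hom_vf p (prolong V)"
  unfolding hom_vf_def
proof
  fix c
  show "hom (p \<noteq> is_odd c) (prolong V c) \<and> superfun (prolong V c)"
  proof (cases "c \<in> base")
    case True
    then show ?thesis
      using admissibleD(1,2)[OF V True] fun_on_M_superfun[of "V c"] unfolding prolong_base[OF True] by blast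
  next
    case False
    then obtain m I where c: "c = Jet m I" using Oc_base Yc_base by (cases c) auto
    have "hom (p \<noteq> odd (card I)) (V b \<otimes> D b (coord_fun (Jet m I)))" if b: "b \<in> base" for b
    proof -
      have "hom ((p \<noteq> is_odd b) \<noteq> (is_odd b \<noteq> odd (card I))) (V b \<otimes> D b (coord_fun (Jet m I)))"
        using b hom_coord[of "Jet m I"] by (intro hom_sprod admissibleD[OF V] hom_D) simp_all
      then show ?thesis by (cases "is_odd b"; cases p) simp_all
    qed
    then have "hom (p \<noteq> odd (card I)) (prolong V c)"
      unfolding c prolong_jet[OF V]
      by (intro hom_add hom_sum hom_scal hom_D_multi characteristic_affine[OF V] hom_characteristic[OF V])
    then show ?thesis using c prolong_jet_affine[OF V] jet_affine_superfun by simp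
  qed
qed

lemma prolong_apply_M:
  "admissible p V \<Longrightarrow> fun_on_M g \<Longrightarrow> vf_apply (prolong V) g = (\<Sum>c\<in>base. V c \<otimes> pd c g)"
  by (simp add: vf_apply_M cong: sum.cong)

lemma prolong_M: "admissible p V \<Longrightarrow> fun_on_M g \<Longrightarrow> fun_on_M (vf_apply (prolong V) g)"
  by (simp add: prolong_apply_M admissibleD)

lemma prolong_affine: "admissible p V \<Longrightarrow> F \<in> jet_affine \<Longrightarrow> vf_apply (prolong V) F \<in> jet_affine"
  by (rule jet_affine_vf_apply[OF hom_vf_prolong]) (simp_all add: prolong_jet_affine prolong_M)

lemma prolong_coord: "admissible p V \<Longrightarrow> vf_apply (prolong V) (coord_fun c) = prolong V c"
  using hom_vfD(2)[OF hom_vf_prolong] superfun_oddsupp by (intro vf_apply_coord) blast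

section \<open>Brackets of prolongations\<close>

lemma sg_signs:
  "sg (b \<and> (p \<noteq> c)) * sg (b \<and> c) = sg (p \<and> b)"
  "sg (p \<and> (q \<noteq> b)) = sg (p \<and> b) * sg (p \<and> q)"
  "sg (p \<and> (b \<noteq> (q \<noteq> c))) * sg (p \<and> c) = sg (p \<and> b) * sg (p \<and> q)"
  "sg (b \<and> c) * sg (b \<and> (p \<noteq> c)) = sg (p \<and> b)"
  "sg (p \<and> c) * sg (p \<and> (b \<noteq> (q \<noteq> c))) = sg (p \<and> b) * sg (p \<and> q)"
  by (auto simp: sg_def)

text \<open>Treats even and odd directions at once: a total derivative multiplies and relabels a
  jet, and does the same to the iterated derivatives of every \<open>F\<close>. The value
  \<open>e = 0\<close> covers a repeated odd derivative.\<close>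

lemma D_multi_step:
  assumes b: "b \<in> base"
  shows "\<exists>e m' I'. D b (coord_fun (Jet m I)) = scal e (coord_fun (Jet m' I')) \<and>
    (\<forall>F\<in>jet_affine. D b (D_multi m I F) = scal e (D_multi m' I' F)) \<and>
    (e \<noteq> 0 \<longrightarrow> odd (card I') = (odd (card I) \<noteq> is_odd b))"
  using b
proof (rule base_cases)
  assume "b = Yc"
  then show ?thesis
    by (intro exI[of _ 1] exI[of _ "Suc m"] exI[of _ I]) (simp add: D_multi_Suc)
next
  fix i assume bi: "b = Oc i"
  show ?thesis
  proof (cases "i \<in> I")
    case True
    then show ?thesis
      by (intro exI[of _ 0] exI[of _ m] exI[of _ I]) (simp add: bi D_multi_insert)
  next
    case False
    then show ?thesis
      by (intro exI[of _ "eps i I"] exI[of _ m] exI[of _ "insert i I"]) (simp add: bi D_multi_insert)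
  qed
qed

text \<open>The evolutionary part does not act on functions on M, so only the commutation of partial
  derivatives and the Leibniz rule enter.\<close>

lemma prolong_D_M:
  assumes V: "admissible p V" and b: "b \<in> base" and g: "fun_on_M g"
  shows "vf_apply (prolong V) (D b g) =
    scal (sg (p \<and> is_odd b)) (D b (vf_apply (prolong V) g) - (\<Sum>c\<in>base. D b (V c) \<otimes> D c g))"
proof -
  have sV: "superfun (V c)" if "c \<in> base" for c
    using admissibleD(1)[OF V that] by (rule fun_on_M_superfun)
  have "D b (V c \<otimes> pd c g) - D b (V c) \<otimes> D c g = scal (sg (p \<and> is_odd b)) (V c \<otimes> pd c (pd b g))"
    if c: "c \<in> base" for c
  proof -
    have "D b (V c \<otimes> pd c g) = D b (V c) \<otimes> D c g + tw (is_odd b) (V c) \<otimes> pd b (pd c g)"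
      using b c g sV[OF c] by (simp add: D_sprod D_M fun_on_M_superfun)
    also have "tw (is_odd b) (V c) \<otimes> pd b (pd c g) = scal (sg (p \<and> is_odd b)) (V c \<otimes> pd c (pd b g))"
      unfolding tw_hom[OF admissibleD(2)[OF V c]] pd_commute[OF fun_on_M_superfun[OF g] b c]
        sprod_scal_left sprod_scal_right scal_scal sg_signs(4) ..
    finally show ?thesis by simp
  qed
  then have "(\<Sum>c\<in>base. D b (V c \<otimes> pd c g) - D b (V c) \<otimes> D c g) =
      (\<Sum>c\<in>base. scal (sg (p \<and> is_odd b)) (V c \<otimes> pd c (pd b g)))"
    by (intro sum.cong refl)
  moreover have "D b (vf_apply (prolong V) g) = (\<Sum>c\<in>base. D b (V c \<otimes> pd c g))"
    unfolding prolong_apply_M[OF V g] using sV g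
    by (intro D_sum superfun_sprod) (simp_all add: fun_on_M_superfun)
  ultimately have "D b (vf_apply (prolong V) g) - (\<Sum>c\<in>base. D b (V c) \<otimes> D c g) =
      scal (sg (p \<and> is_odd b)) (vf_apply (prolong V) (D b g))"
    using b g by (simp add: sum_subtractf scal_sum D_M prolong_apply_M[OF V])
  then show ?thesis by simp
qed

text \<open>On jets the evolutionary part is \<open>D_multi\<close> of the characteristic up to
  sign. By \<open>D_multi_step\<close> it supercommutes with \<open>D b\<close>, so the correction
  comes entirely from the terms \<open>V c \<otimes> D c\<close>.\<close>

lemma prolong_D_jet:
  assumes V: "admissible p V" and b: "b \<in> base"
  shows "vf_apply (prolong V) (D b (coord_fun (Jet m I))) =
    scal (sg (p \<and> is_odd b)) (D b (prolong V (Jet m I)) - (\<Sum>c\<in>base. D b (V c) \<otimes> D c (coord_fun (Jet m I))))"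
proof -
  let ?J = "coord_fun (Jet m I)" and ?Q = "characteristic V" and ?s = "sg (p \<and> is_odd b)"
  have sV: "superfun (V c)" if "c \<in> base" for c
    using admissibleD(1)[OF V that] by (rule fun_on_M_superfun)
  have Jaff: "?J \<in> jet_affine" by (simp add: jet_linear_affine jet_linear_coord)
  have Q: "?Q \<in> jet_affine" using characteristic_affine[OF V] .
  have l: "vf_apply (prolong V) (D b ?J) = (\<Sum>c\<in>base. V c \<otimes> D c (D b ?J)) +
      scal (?s * sg (p \<and> odd (card I))) (D b (D_multi m I ?Q))"
  proof -
    obtain e m' I' where e: "D b ?J = scal e (coord_fun (Jet m' I'))"
      "\<And>F. F \<in> jet_affine \<Longrightarrow> D b (D_multi m I F) = scal e (D_multi m' I' F)"
      "e \<noteq> 0 \<Longrightarrow> odd (card I') = (odd (card I) \<noteq> is_odd b)"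
      using D_multi_step[OF b, of m I] by blast
    have "vf_apply (prolong V) (D b ?J) = scal e (prolong V (Jet m' I'))"
      unfolding e(1) by (simp add: vf_apply_scal prolong_coord[OF V])
    also have "\<dots> = (\<Sum>c\<in>base. V c \<otimes> D c (D b ?J)) +
      scal (e * sg (p \<and> odd (card I'))) (D_multi m' I' ?Q)"
      unfolding prolong_jet[OF V] e(1) scal_add scal_sum by (simp add: D_scal sprod_scal_right)
    also have "scal (e * sg (p \<and> odd (card I'))) (D_multi m' I' ?Q) =
      scal (?s * sg (p \<and> odd (card I))) (D b (D_multi m I ?Q))"
    proof (cases "e = 0")
      case False
      then show ?thesis
        unfolding e(2)[OF Q] e(3)[OF False] scal_scal sg_signs(2) by (simp add: mult_ac)
    qed (simp add: e(2)[OF Q])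
    finally show ?thesis .
  qed
  have "D b (V c \<otimes> D c ?J) - D b (V c) \<otimes> D c ?J = scal ?s (V c \<otimes> D c (D b ?J))"
    if c: "c \<in> base" for c
  proof -
    have "D b (V c \<otimes> D c ?J) = D b (V c) \<otimes> D c ?J + tw (is_odd b) (V c) \<otimes> D b (D c ?J)"
      using b c sV[OF c] by (simp add: D_sprod superfun_D)
    also have "tw (is_odd b) (V c) \<otimes> D b (D c ?J) = scal ?s (V c \<otimes> D c (D b ?J))"
      unfolding tw_hom[OF admissibleD(2)[OF V c]] D_commute[OF b c Jaff]
        sprod_scal_left sprod_scal_right scal_scal sg_signs(4) ..
    finally show ?thesis by simp
  qed
  then have "(\<Sum>c\<in>base. D b (V c \<otimes> D c ?J) - D b (V c) \<otimes> D c ?J) =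
      (\<Sum>c\<in>base. scal ?s (V c \<otimes> D c (D b ?J)))"
    by (intro sum.cong refl)
  then have 2: "(\<Sum>c\<in>base. D b (V c \<otimes> D c ?J)) - (\<Sum>c\<in>base. D b (V c) \<otimes> D c ?J) =
      scal ?s (\<Sum>c\<in>base. V c \<otimes> D c (D b ?J))"
    by (simp add: sum_subtractf scal_sum)
  have "D b (prolong V (Jet m I)) = (\<Sum>c\<in>base. D b (V c \<otimes> D c ?J)) +
      scal (sg (p \<and> odd (card I))) (D b (D_multi m I ?Q))"
  proof -
    have "superfun (V c \<otimes> D c ?J)" if "c \<in> base" for c
      using that sV by (simp add: superfun_sprod superfun_D)
    moreover have "superfun (D_multi m I ?Q)"
      using D_multi_affine[OF Q] jet_affine_superfun by blast
    ultimately show ?thesis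
      unfolding prolong_jet[OF V] by (simp add: D_add D_sum D_scal superfun_sum superfun_scal)
  qed
  then have "D b (prolong V (Jet m I)) - (\<Sum>c\<in>base. D b (V c) \<otimes> D c ?J) =
      scal ?s (\<Sum>c\<in>base. V c \<otimes> D c (D b ?J)) + scal (sg (p \<and> odd (card I))) (D b (D_multi m I ?Q))"
    using 2 by (simp add: algebra_simps)
  then show ?thesis unfolding l by (simp add: scal_add)
qed

text \<open>The supercommutator of a prolonged field with a total derivative is a combination of
  total derivatives. Together with the values on \<open>base\<close> and h this rule determines the
  prolongation.\<close>

lemma prolong_D:
  assumes V: "admissible p V" and b: "b \<in> base"
  shows "F \<in> jet_affine \<Longrightarrow> vf_apply (prolong V) (D b F) =
    scal (sg (p \<and> is_odd b)) (D b (vf_apply (prolong V) F) - (\<Sum>c\<in>base. D b (V c) \<otimes> D c F))"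
proof (erule jet_affine_eqI[rotated -1])
  let ?s = "sg (p \<and> is_odd b)"
  let ?X = "vf_apply (prolong V)"
  have sV: "superfun (V c)" if "c \<in> base" for c
    using admissibleD(1)[OF V that] by (rule fun_on_M_superfun)
  have sX: "superfun (?X F)" if "F \<in> jet_affine" for F
    using prolong_affine[OF V that] by (rule jet_affine_superfun)
  {
    fix F G
    assume FG: "F \<in> jet_affine" "G \<in> jet_affine"
      and eq: "?X (D b F) = scal ?s (D b (?X F) - (\<Sum>c\<in>base. D b (V c) \<otimes> D c F))"
        "?X (D b G) = scal ?s (D b (?X G) - (\<Sum>c\<in>base. D b (V c) \<otimes> D c G))"
    have "(\<Sum>c\<in>base. D b (V c) \<otimes> D c (F + G)) =
        (\<Sum>c\<in>base. D b (V c) \<otimes> D c F) + (\<Sum>c\<in>base. D b (V c) \<otimes> D c G)"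
      using FG by (simp add: D_add jet_affine_superfun sprod_add_right sum.distrib)
    then show "?X (D b (F + G)) = scal ?s (D b (?X (F + G)) - (\<Sum>c\<in>base. D b (V c) \<otimes> D c (F + G)))"
      using FG b eq
      by (simp add: D_add vf_apply_add jet_affine_superfun D_affine sX scal_add scal_diff)
  next
    fix g assume "fun_on_M g"
    then show "?X (D b g) = scal ?s (D b (?X g) - (\<Sum>c\<in>base. D b (V c) \<otimes> D c g))"
      by (rule prolong_D_M[OF V b])
  next
    fix g m I assume g: "fun_on_M g"
    let ?J = "coord_fun (Jet m I)"
    have sg: "superfun g" "superfun (tw q g)" "superfun (D b g)" "superfun (?X g)"
      "superfun (prolong V (Jet m I))" "superfun (D b ?J)" for q
      using g b by (simp_all add: fun_on_M_superfun superfun_D sX jet_affine.base prolong_jet_affine[OF V] jet_affine_superfun)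
    have tX: "?X (tw q g) = scal (sg (p \<and> q)) (tw q (?X g))" for q
      using tw_vf_apply[OF hom_vf_prolong[OF V] sg(1), of q] by simp
    have tD: "tw p (D b g) = scal ?s (D b (tw p g))"
      using tw_D[OF b sg(1), of p] by (simp add: conj_commute)
    have "?X (D b (g \<otimes> ?J)) = ?X (D b g \<otimes> ?J + tw (is_odd b) g \<otimes> D b ?J)"
      using b sg by (simp add: D_sprod)
    also have "\<dots> = ?X (D b g) \<otimes> ?J + tw p (D b g) \<otimes> prolong V (Jet m I) +
        (?X (tw (is_odd b) g) \<otimes> D b ?J + tw p (tw (is_odd b) g) \<otimes> ?X (D b ?J))"
      using sg by (simp add: vf_apply_add superfun_sprod vf_apply_sprod[OF hom_vf_prolong[OF V]] prolong_coord[OF V])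
    also have "\<dots> = scal ?s ((D b (?X g) \<otimes> ?J + tw (is_odd b) (?X g) \<otimes> D b ?J +
        (D b (tw p g) \<otimes> prolong V (Jet m I) + tw (is_odd b) (tw p g) \<otimes> D b (prolong V (Jet m I))))
        - ((\<Sum>c\<in>base. D b (V c) \<otimes> D c g) \<otimes> ?J +
           tw p (tw (is_odd b) g) \<otimes> (\<Sum>c\<in>base. D b (V c) \<otimes> D c ?J)))"
    proof -
      have "tw (is_odd b) (tw p g) = tw p (tw (is_odd b) g)"
        unfolding tw_tw by (rule arg_cong[of _ _ "\<lambda>q. tw q g"]) auto
      then show ?thesis
        unfolding prolong_D_M[OF V b g] prolong_D_jet[OF V b] tX tD
        by (simp add: sprod_scal_left sprod_scal_right sprod_diff_left sprod_diff_right scal_add scal_diff algebra_simps)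
    qed
    also have "(\<Sum>c\<in>base. D b (V c) \<otimes> D c g) \<otimes> ?J + tw p (tw (is_odd b) g) \<otimes> (\<Sum>c\<in>base. D b (V c) \<otimes> D c ?J)
        = (\<Sum>c\<in>base. D b (V c) \<otimes> D c (g \<otimes> ?J))"
      \<comment> \<open>Termwise: moving \<open>D b (V c)\<close> past \<open>g\<close> cancels the
        parity of \<open>c\<close> against the twist in the Leibniz rule for
        \<open>D c\<close>.\<close>
      unfolding sprod_sum_left sprod_sum_right sum.distrib[symmetric]
    proof (rule sum.cong[OF refl])
      fix c assume c: "c \<in> base"
      have sD: "superfun (D b (V c))" using b sV[OF c] by (rule superfun_D)
      have "hom (is_odd b \<noteq> (p \<noteq> is_odd c)) (D b (V c))"
        by (rule hom_D[OF b sV[OF c] admissibleD(2)[OF V c]])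
      from sprod_commute[OF superfun_oddsupp[OF sD] superfun_oddsupp this, of "tw (is_odd c) g"] sg(2)
      have "D b (V c) \<otimes> tw (is_odd c) g = tw (is_odd b \<noteq> (p \<noteq> is_odd c)) (tw (is_odd c) g) \<otimes> D b (V c)"
        by blast
      also have "tw (is_odd b \<noteq> (p \<noteq> is_odd c)) (tw (is_odd c) g) = tw p (tw (is_odd b) g)"
        unfolding tw_tw by (rule arg_cong[of _ _ "\<lambda>q. tw q g"]) auto
      finally have "D b (V c) \<otimes> (tw (is_odd c) g \<otimes> D c ?J) = tw p (tw (is_odd b) g) \<otimes> (D b (V c) \<otimes> D c ?J)"
        by (simp flip: sprod_assoc)
      then show "D b (V c) \<otimes> D c g \<otimes> ?J + tw p (tw (is_odd b) g) \<otimes> (D b (V c) \<otimes> D c ?J) =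
          D b (V c) \<otimes> D c (g \<otimes> ?J)"
        using c sg by (simp add: D_sprod sprod_add_right sprod_assoc)
    qed
    also have "D b (?X g) \<otimes> ?J + tw (is_odd b) (?X g) \<otimes> D b ?J +
        (D b (tw p g) \<otimes> prolong V (Jet m I) + tw (is_odd b) (tw p g) \<otimes> D b (prolong V (Jet m I)))
        = D b (?X (g \<otimes> ?J))"
      using b sg
      by (simp add: vf_apply_sprod[OF hom_vf_prolong[OF V]] prolong_coord[OF V] D_add D_sprod superfun_sprod)
    finally show "?X (D b (g \<otimes> ?J)) = scal ?s (D b (?X (g \<otimes> ?J)) - (\<Sum>c\<in>base. D b (V c) \<otimes> D c (g \<otimes> ?J)))" .
  }
qed

section \<open>Supercommutators as derivations, and uniqueness of the prolongation\<close>

definition supercommutator :: "bool \<Rightarrow> bool \<Rightarrow> vfield \<Rightarrow> vfield \<Rightarrow> superfun \<Rightarrow> superfun" where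
  "supercommutator p q V W F =
     vf_apply V (vf_apply W F) - scal (sg (p \<and> q)) (vf_apply W (vf_apply V F))"

lemma vf_apply_zero_field [simp]: "vf_apply 0 F = 0"
  by (simp add: vf_apply_def zero_fun_apply)

lemma vf_bracket_hom:
  assumes V: "hom_vf p V" and W: "hom_vf q W"
  shows "vf_bracket V W c = supercommutator p q V W (coord_fun c)"
proof -
  have c: "vf_apply V (coord_fun c) = V c" "vf_apply W (coord_fun c) = W c"
    using hom_vfD(2)[OF V] hom_vfD(2)[OF W] by (simp_all add: vf_apply_coord superfun_oddsupp)
  show ?thesis
    unfolding vf_bracket_def hom_vf_part[OF V] hom_vf_part[OF W] supercommutator_def c
    by (cases p; cases q) (simp_all add: zero_fun_apply)
qed

lemma supercommutator_add:
  assumes "hom_vf p V" "hom_vf q W" "superfun F" "superfun G"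
  shows "supercommutator p q V W (F + G) = supercommutator p q V W F + supercommutator p q V W G"
  using superfun_vf_apply[OF hom_vfD(2)[OF assms(1)]] superfun_vf_apply[OF hom_vfD(2)[OF assms(2)]] assms(3,4)
  by (simp add: supercommutator_def vf_apply_add scal_add algebra_simps)

lemma supercommutator_scal:
  assumes "hom_vf p V" "hom_vf q W" "superfun F"
  shows "supercommutator p q V W (scal a F) = scal a (supercommutator p q V W F)"
  using superfun_vf_apply[OF hom_vfD(2)[OF assms(1)]] superfun_vf_apply[OF hom_vfD(2)[OF assms(2)]] assms(3)
  by (simp add: supercommutator_def vf_apply_scal scal_diff mult.commute)

lemma supercommutator_sprod:
  assumes V: "hom_vf p V" and W: "hom_vf q W" and F: "superfun F" and G: "superfun G"
  shows "supercommutator p q V W (F \<otimes> G) =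
    supercommutator p q V W F \<otimes> G + tw (p \<noteq> q) F \<otimes> supercommutator p q V W G"
proof -
  note sf = superfun_vf_apply[OF hom_vfD(2)[OF V]] superfun_vf_apply[OF hom_vfD(2)[OF W]]
    F G superfun_tw superfun_sprod
  have 1: "tw p (vf_apply W F) = scal (sg (p \<and> q)) (vf_apply W (tw p F))"
    using tw_vf_apply[OF W F, of p] by (simp add: conj_commute)
  have 2: "tw q (vf_apply V F) = scal (sg (p \<and> q)) (vf_apply V (tw q F))"
    using tw_vf_apply[OF V F, of q] by simp
  have 3: "tw q (tw p F) = tw (p \<noteq> q) F" "tw p (tw q F) = tw (p \<noteq> q) F"
    unfolding tw_tw by (auto intro: arg_cong[of _ _ "\<lambda>q. tw q F"])
  show ?thesis
    by (simp add: supercommutator_def vf_apply_sprod[OF V] vf_apply_sprod[OF W] vf_apply_add sf 1 2 3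
        sprod_scal_left sprod_scal_right sprod_diff_left sprod_diff_right scal_add scal_diff algebra_simps)
qed

text \<open>\<open>prolong_D\<close> applied twice. The terms are arranged so that those cancelling
  in the supercommutator appear in the same shape when \<open>V\<close> and \<open>W\<close> are
  exchanged.\<close>

lemma prolong_prolong_D:
  assumes V: "admissible p V" and W: "admissible q W" and b: "b \<in> base" and F: "F \<in> jet_affine"
  defines "X \<equiv> vf_apply (prolong V)" and "Y \<equiv> vf_apply (prolong W)"
  shows "X (Y (D b F)) = scal (sg (p \<and> is_odd b) * sg (q \<and> is_odd b))
    (D b (X (Y F)) - (\<Sum>c\<in>base. D b (V c) \<otimes> D c (Y F)) - (\<Sum>c\<in>base. D b (X (W c)) \<otimes> D c F)
     + (\<Sum>c\<in>base. \<Sum>e\<in>base. D b (V e) \<otimes> (D e (W c) \<otimes> D c F))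
     - scal (sg (p \<and> q)) (\<Sum>c\<in>base. D b (W c) \<otimes> D c (X F))
     + scal (sg (p \<and> q)) (\<Sum>c\<in>base. \<Sum>e\<in>base. D b (W e) \<otimes> (D e (V c) \<otimes> D c F)))"
proof -
  let ?s = "sg (p \<and> is_odd b)" and ?t = "sg (q \<and> is_odd b)" and ?st = "sg (p \<and> q)"
  have YF: "Y F \<in> jet_affine" unfolding Y_def by (rule prolong_affine[OF W F])
  have Wc: "W c \<in> jet_affine" "superfun (W c)" if "c \<in> base" for c
    using admissibleD(1)[OF W that] by (auto intro: jet_affine.base fun_on_M_superfun)
  have sF: "superfun F" using F by (rule jet_affine_superfun)
  have summand: "X (D b (W c) \<otimes> D c F) = scal ?s (D b (X (W c)) \<otimes> D c F
      - (\<Sum>e\<in>base. D b (V e) \<otimes> (D e (W c) \<otimes> D c F))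
      + scal ?st (D b (W c) \<otimes> D c (X F)) - scal ?st (\<Sum>e\<in>base. D b (W c) \<otimes> (D c (V e) \<otimes> D e F)))"
    if c: "c \<in> base" for c
  proof -
    have "X (D b (W c) \<otimes> D c F) = X (D b (W c)) \<otimes> D c F + tw p (D b (W c)) \<otimes> X (D c F)"
      unfolding X_def by (rule vf_apply_sprod[OF hom_vf_prolong[OF V]]) (use b c Wc sF in \<open>auto intro: superfun_D\<close>)
    also have "X (D b (W c)) = scal ?s (D b (X (W c)) - (\<Sum>e\<in>base. D b (V e) \<otimes> D e (W c)))"
      unfolding X_def by (rule prolong_D[OF V b Wc(1)[OF c]])
    also have "tw p (D b (W c)) \<otimes> X (D c F) = scal (?s * ?st)
        (D b (W c) \<otimes> (D c (X F) - (\<Sum>e\<in>base. D c (V e) \<otimes> D e F)))"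
      unfolding X_def prolong_D[OF V c F] tw_hom[OF hom_D[OF b Wc(2)[OF c] admissibleD(2)[OF W c]]]
        sprod_scal_left sprod_scal_right scal_scal sg_signs(5) ..
    finally show ?thesis
      by (simp add: sprod_scal_left sprod_diff_left sprod_diff_right sprod_sum_left sprod_sum_right
          scal_add scal_diff sprod_assoc algebra_simps)
  qed
  have sD: "superfun (D b (W c) \<otimes> D c F)" if "c \<in> base" for c
    using that b Wc sF by (simp add: superfun_sprod superfun_D)
  have "X (Y (D b F)) = X (scal ?t (D b (Y F) - (\<Sum>c\<in>base. D b (W c) \<otimes> D c F)))"
    unfolding Y_def prolong_D[OF W b F] ..
  also have "\<dots> = scal ?t (X (D b (Y F)) - (\<Sum>c\<in>base. X (D b (W c) \<otimes> D c F)))"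
  proof -
    have "superfun (D b (Y F))" using b YF by (intro jet_affine_superfun D_affine)
    then show ?thesis
      unfolding X_def using sD
      by (simp add: vf_apply_scal vf_apply_diff vf_apply_sum superfun_sum superfun_diff)
  qed
  also have "X (D b (Y F)) = scal ?s (D b (X (Y F)) - (\<Sum>c\<in>base. D b (V c) \<otimes> D c (Y F)))"
    unfolding X_def by (rule prolong_D[OF V b YF])
  also have "(\<Sum>c\<in>base. X (D b (W c) \<otimes> D c F)) = scal ?s (
      (\<Sum>c\<in>base. D b (X (W c)) \<otimes> D c F) - (\<Sum>c\<in>base. \<Sum>e\<in>base. D b (V e) \<otimes> (D e (W c) \<otimes> D c F))
      + scal ?st (\<Sum>c\<in>base. D b (W c) \<otimes> D c (X F))
      - scal ?st (\<Sum>c\<in>base. \<Sum>e\<in>base. D b (W c) \<otimes> (D c (V e) \<otimes> D e F)))"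
    by (simp only: summand sum.distrib sum_subtractf scal_sum scal_add scal_diff cong: sum.cong)
  \<comment> \<open>Renaming the indices gives this double sum the form of the one that stems from
    the opposite order.\<close>
  also have "(\<Sum>c\<in>base. \<Sum>e\<in>base. D b (W c) \<otimes> (D c (V e) \<otimes> D e F)) =
      (\<Sum>c\<in>base. \<Sum>e\<in>base. D b (W e) \<otimes> (D e (V c) \<otimes> D c F))"
    by (rule sum.swap)
  finally show ?thesis
    by (simp add: scal_add scal_diff mult_ac algebra_simps)
qed

text \<open>The first order terms that mix the two fields and the double sums cancel, so the
  supercommutator obeys the rule of \<open>prolong_D\<close> with its own coefficients in place of
  \<open>V c\<close>.\<close>

lemma supercommutator_D:
  assumes V: "admissible p V" and W: "admissible q W" and b: "b \<in> base" and F: "F \<in> jet_affine"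
  defines "U \<equiv> supercommutator p q (prolong V) (prolong W)"
  shows "U (D b F) = scal (sg ((p \<noteq> q) \<and> is_odd b))
    (D b (U F) - (\<Sum>c\<in>base. D b (U (coord_fun c)) \<otimes> D c F))"
proof -
  let ?X = "vf_apply (prolong V)" and ?Y = "vf_apply (prolong W)" and ?st = "sg (p \<and> q)"
  have XY: "?X F \<in> jet_affine" "?Y F \<in> jet_affine" "?X (?Y F) \<in> jet_affine" "?Y (?X F) \<in> jet_affine"
    using prolong_affine[OF V] prolong_affine[OF W] F by blast+
  have coord: "D b (U (coord_fun c)) = D b (?X (W c)) - scal ?st (D b (?Y (V c)))" if c: "c \<in> base" for c
  proof -
    have "?X (W c) \<in> jet_affine" "?Y (V c) \<in> jet_affine"
      using prolong_M[OF V admissibleD(1)[OF W c]] prolong_M[OF W admissibleD(1)[OF V c]]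
      by (auto intro: jet_affine.base)
    then show ?thesis
      using c by (simp add: U_def supercommutator_def prolong_coord[OF V] prolong_coord[OF W]
          D_diff D_scal jet_affine_superfun superfun_scal)
  qed
  have DU: "D b (U F) = D b (?X (?Y F)) - scal ?st (D b (?Y (?X F)))"
    using XY by (simp add: U_def supercommutator_def D_diff D_scal jet_affine_superfun superfun_scal)
  have sum: "(\<Sum>c\<in>base. D b (U (coord_fun c)) \<otimes> D c F) =
      (\<Sum>c\<in>base. D b (?X (W c)) \<otimes> D c F) - scal ?st (\<Sum>c\<in>base. D b (?Y (V c)) \<otimes> D c F)"
    by (simp add: coord sprod_diff_left sprod_scal_left sum_subtractf scal_sum cong: sum.cong)
  have qp: "sg (q \<and> p) = ?st" by (simp add: conj_commute)
  have s: "sg ((p \<noteq> q) \<and> is_odd b) = sg (p \<and> is_odd b) * sg (q \<and> is_odd b)"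
    by (auto simp: sg_def)
  \<comment> \<open>The pure cancellation pattern: \<open>B\<close> and \<open>E\<close> recur in
    the second expansion with a factor \<open>r\<close>, as do \<open>B'\<close> and
    \<open>E'\<close> in the first, and \<open>r * r = 1\<close>.\<close>
  have comb: "scal (s * t) (A - B - C + E - scal r B' + scal r E') -
      scal r (scal (t * s) (A' - B' - C' + E' - scal r B + scal r E)) =
      scal (s * t) (A - scal r A' - (C - scal r C'))"
    if "r * r = 1" for s t r A B C E A' B' C' E'
  proof -
    have r: "r * (r * x) = x" for x
      using that by (simp flip: mult.assoc)
    show ?thesis by (simp add: r scal_def fun_eq_iff pointwise algebra_simps)
  qed
  have "U (D b F) = ?X (?Y (D b F)) - scal ?st (?Y (?X (D b F)))"
    by (simp add: U_def supercommutator_def)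
  then show ?thesis
    unfolding prolong_prolong_D[OF V W b F] prolong_prolong_D[OF W V b F] DU sum s qp
    using comb[of ?st "sg (p \<and> is_odd b)" "sg (q \<and> is_odd b)"] by simp
qed

text \<open>Both sides satisfy the same commutation rule with total derivatives, and every jet
  arises from h by total derivatives, so agreement on \<open>base\<close> and h propagates to all
  jets.\<close>

lemma supercommutator_jet:
  assumes V: "admissible p V" and W: "admissible q W" and U: "admissible (p \<noteq> q) U"
    and eq: "\<And>c. c \<in> insert (Jet 0 {}) base \<Longrightarrow>
      supercommutator p q (prolong V) (prolong W) (coord_fun c) = U c"
  shows "supercommutator p q (prolong V) (prolong W) (coord_fun (Jet m I)) = prolong U (Jet m I)"
proof (induction m I rule: jet_induct)
  case h
  then show ?case using eq prolong_h[OF U] by simp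
next
  case (Suc m I)
  have J: "coord_fun (Jet m I) \<in> jet_affine" by (simp add: jet_linear_affine jet_linear_coord)
  show ?case
    using supercommutator_D[OF V W Yc_base J] prolong_D[OF U Yc_base J] Suc eq
    by (simp add: prolong_coord[OF U] cong: sum.cong)
next
  case (insert m I i)
  have J: "coord_fun (Jet m I) \<in> jet_affine" by (simp add: jet_linear_affine jet_linear_coord)
  let ?U = "supercommutator p q (prolong V) (prolong W)"
  have "?U (D (Oc i) (coord_fun (Jet m I))) = vf_apply (prolong U) (D (Oc i) (coord_fun (Jet m I)))"
    unfolding supercommutator_D[OF V W Oc_base J] prolong_D[OF U Oc_base J]
    using insert(1) eq by (simp add: prolong_coord[OF U] cong: sum.cong)
  then have "scal (eps i I) (?U (coord_fun (Jet m (insert i I)))) =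
      scal (eps i I) (prolong U (Jet m (insert i I)))"
    using insert(2)
    by (simp add: supercommutator_scal[OF hom_vf_prolong[OF V] hom_vf_prolong[OF W]] vf_apply_scal prolong_coord[OF U])
  then show ?case by (simp add: scal_eps_cancel)
qed

theorem vf_bracket_prolong:
  assumes V: "admissible p V" and W: "admissible q W" and U: "admissible (p \<noteq> q) U"
    and eq: "\<And>c. c \<in> insert (Jet 0 {}) base \<Longrightarrow>
      supercommutator p q (prolong V) (prolong W) (coord_fun c) = U c"
  shows "vf_bracket (prolong V) (prolong W) = prolong U"
proof
  fix c
  show "vf_bracket (prolong V) (prolong W) c = prolong U c"
    unfolding vf_bracket_hom[OF hom_vf_prolong[OF V] hom_vf_prolong[OF W]]
    using supercommutator_jet[OF assms] eq by (cases c) auto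
qed

text \<open>Both sides are derivations of the same parity that vanish on functions on M, so
  agreement on jets suffices.\<close>

lemma supercommutator_affine:
  assumes V: "admissible p V" and W: "admissible q W" and U: "admissible (p \<noteq> q) U"
    and eq: "supercommutator p q (prolong V) (prolong W) hfun = U (Jet 0 {})"
    and U0: "\<And>b. b \<in> base \<Longrightarrow> U b = 0"
    and M: "\<And>g. fun_on_M g \<Longrightarrow> supercommutator p q (prolong V) (prolong W) g = 0"
  shows "F \<in> jet_affine \<Longrightarrow> supercommutator p q (prolong V) (prolong W) F = vf_apply (prolong U) F"
proof (erule jet_affine_eqI[rotated -1])
  let ?U = "supercommutator p q (prolong V) (prolong W)"
  note h = hom_vf_prolong[OF V] hom_vf_prolong[OF W]
  fix F G
  assume "F \<in> jet_affine" "G \<in> jet_affine" "?U F = vf_apply (prolong U) F" "?U G = vf_apply (prolong U) G"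
  then show "?U (F + G) = vf_apply (prolong U) (F + G)"
    by (simp add: supercommutator_add[OF h] vf_apply_add jet_affine_superfun)
next
  fix g assume g: "fun_on_M g"
  then show "supercommutator p q (prolong V) (prolong W) g = vf_apply (prolong U) g"
    by (simp add: M prolong_apply_M[OF U] U0)
next
  let ?U = "supercommutator p q (prolong V) (prolong W)"
  note h = hom_vf_prolong[OF V] hom_vf_prolong[OF W]
  fix g m I assume g: "fun_on_M g"
  have "?U (coord_fun c) = U c" if "c \<in> insert (Jet 0 {}) base" for c
    using that eq U0 M by (auto simp: hfun_def)
  from supercommutator_jet[OF V W U this]
  have J: "?U (coord_fun (Jet m I)) = prolong U (Jet m I)" by blast
  have "vf_apply (prolong U) g = 0" using g by (simp add: prolong_apply_M[OF U] U0)
  then show "?U (g \<otimes> coord_fun (Jet m I)) = vf_apply (prolong U) (g \<otimes> coord_fun (Jet m I))"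
    using g by (simp add: supercommutator_sprod[OF h] vf_apply_sprod[OF hom_vf_prolong[OF U]]
        fun_on_M_superfun M J prolong_coord[OF U])
qed

section \<open>Contact fields\<close>

text \<open>The odd frame \<open>\<partial>/\<partial>\<theta> + \<nu> \<partial>/\<partial>y\<close>, \<open>\<partial>/\<partial>\<nu>\<close> of the contact distribution; dual
  frame fields have the supercommutator \<open>\<partial>/\<partial>y\<close>, all others supercommute.\<close>

fun dual :: "odd_var \<Rightarrow> odd_var" where
  "dual Theta1 = Nu1"
| "dual Theta2 = Nu2"
| "dual Nu1 = Theta1"
| "dual Nu2 = Theta2"

fun shift :: "odd_var \<Rightarrow> superfun" where
  "shift Theta1 = coord_fun (Oc Nu1)"
| "shift Theta2 = coord_fun (Oc Nu2)"
| "shift Nu1 = 0"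
| "shift Nu2 = 0"

definition frame :: "odd_var \<Rightarrow> superfun \<Rightarrow> superfun" where
  "frame i f = pd (Oc i) f + shift i \<otimes> pd Yc f"

lemma dual_dual [simp]: "dual (dual i) = i" by (cases i) simp_all
lemma dual_eq_iff: "dual i = j \<longleftrightarrow> i = dual j" by (cases i; cases j) simp_all

lemma shift_M [simp]: "fun_on_M (shift i)" by (cases i) simp_all
lemma hom_shift: "hom True (shift i)"
  using hom_coord[of "Oc Nu1"] hom_coord[of "Oc Nu2"] by (cases i) simp_all

lemma frame_M [simp]: "fun_on_M f \<Longrightarrow> fun_on_M (frame i f)"
  by (simp add: frame_def)

lemma frame_add: "fun_on_M f \<Longrightarrow> fun_on_M g \<Longrightarrow> frame i (f + g) = frame i f + frame i g"
  by (simp add: frame_def pd_add fun_on_M_superfun sprod_add_right algebra_simps)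

lemma frame_scal: "fun_on_M f \<Longrightarrow> frame i (scal a f) = scal a (frame i f)"
  by (simp add: frame_def pd_scal fun_on_M_superfun sprod_scal_right scal_add)

lemma frame_diff: "fun_on_M f \<Longrightarrow> fun_on_M g \<Longrightarrow> frame i (f - g) = frame i f - frame i g"
  by (simp add: frame_def pd_diff fun_on_M_superfun sprod_diff_right algebra_simps)

lemma frame_sum: "(\<And>j. j \<in> A \<Longrightarrow> fun_on_M (F j)) \<Longrightarrow> frame i (\<Sum>j\<in>A. F j) = (\<Sum>j\<in>A. frame i (F j))"
  by (simp add: frame_def pd_sum fun_on_M_superfun sprod_sum_right sum.distrib)

lemma shift_commute: "fun_on_M f \<Longrightarrow> shift i \<otimes> f = parity f \<otimes> shift i"
  using sprod_commute[OF _ _ hom_shift, of i f] by (simp add: superfun_oddsupp fun_on_M_superfun)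

lemma frame_sprod:
  assumes f: "fun_on_M f" and g: "fun_on_M g"
  shows "frame i (f \<otimes> g) = frame i f \<otimes> g + parity f \<otimes> frame i g"
proof -
  have "shift i \<otimes> (f \<otimes> pd Yc g) = parity f \<otimes> (shift i \<otimes> pd Yc g)"
    using shift_commute[OF f, of i] by (simp flip: sprod_assoc)
  then show ?thesis
    using f g by (simp add: frame_def pd_sprod fun_on_M_superfun sprod_add_left sprod_add_right
        sprod_assoc algebra_simps)
qed

lemma hom_frame: "fun_on_M f \<Longrightarrow> hom p f \<Longrightarrow> hom (\<not> p) (frame i f)"
  using hom_pd[of f p "Oc i"] hom_sprod[OF hom_shift hom_pd[of f p Yc], of i]
  by (auto simp: frame_def fun_on_M_superfun intro: hom_add)

lemma hom_dy: "fun_on_M f \<Longrightarrow> hom p f \<Longrightarrow> hom p (pd Yc f)"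
  using hom_pd[of f p Yc] by (simp add: fun_on_M_superfun)

lemma pd_shift:
  "pd Yc (shift i) = 0"
  "pd (Oc i) (shift j) = (if i = dual j \<and> j \<in> {Theta1, Theta2} then one_sf else 0)"
  by (cases i; simp add: pd_coord) (cases i; cases j; simp add: pd_coord)

lemma pd_Yc_Oc: "fun_on_M f \<Longrightarrow> pd Yc (pd (Oc i) f) = pd (Oc i) (pd Yc f)"
  by (rule pd_even_odd_commute) (simp_all add: fun_on_M_superfun)

lemma dy_frame: "fun_on_M f \<Longrightarrow> pd Yc (frame i f) = frame i (pd Yc f)"
  by (simp add: frame_def pd_add pd_sprod fun_on_M_superfun superfun_sprod superfun_pd pd_shift
      pd_Yc_Oc)

text \<open>The Heisenberg relations of the contact distribution: the only contribution beyond
  anticommutation comes from an odd derivative hitting a coefficient \<open>shift\<close>.\<close>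

lemma frame_frame:
  assumes f: "fun_on_M f"
  shows "frame i (frame j f) = - frame j (frame i f) + (if j = dual i then pd Yc f else 0)"
proof -
  note sf = fun_on_M_superfun superfun_sprod superfun_pd
  have expand: "frame i (frame j f) = pd (Oc i) (pd (Oc j) f) + pd (Oc i) (shift j) \<otimes> pd Yc f
      - shift j \<otimes> pd (Oc i) (pd Yc f) + shift i \<otimes> pd (Oc j) (pd Yc f)
      + shift i \<otimes> (shift j \<otimes> pd Yc (pd Yc f))" for i j
    using f hom_parity[OF hom_shift]
    by (simp add: frame_def pd_add pd_sprod sf pd_shift pd_Yc_Oc sprod_add_right
        scal_m1 sprod_minus_left algebra_simps)
  have "shift i \<otimes> shift j = - (shift j \<otimes> shift i)"
    using shift_commute[of "shift j" i] hom_parity[OF hom_shift] by (simp add: scal_m1 sprod_minus_left)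
  then have 1: "shift i \<otimes> (shift j \<otimes> pd Yc (pd Yc f)) = - (shift j \<otimes> (shift i \<otimes> pd Yc (pd Yc f)))"
    by (simp add: sprod_minus_left flip: sprod_assoc)
  have 2: "pd (Oc i) (pd (Oc j) f) = - pd (Oc j) (pd (Oc i) f)"
    by (rule pd_odd_commute) (simp_all add: fun_on_M_superfun f)
  \<comment> \<open>For a dual pair exactly one of the two directions carries a shift, so the sum is
    the unit and not twice the unit.\<close>
  have 3: "pd (Oc i) (shift j) + pd (Oc j) (shift i) = (if j = dual i then one_sf else 0)"
    unfolding pd_shift by (cases i; cases j) simp_all
  have "pd (Oc i) (shift j) \<otimes> pd Yc f + pd (Oc j) (shift i) \<otimes> pd Yc f = (if j = dual i then pd Yc f else 0)"
    unfolding sprod_add_left[symmetric] 3 using f by (simp add: one_sprod_superfun sf)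
  then show ?thesis
    unfolding expand[of i j] expand[of j i] 1 2 by (simp add: algebra_simps)
qed

lemma contact_vf_Oc: "contact_vf f (Oc i) = frame (dual i) (parity f)"
  by (cases i) (simp_all add: contact_vf_def frame_def D_theta_def theta_def nu_def)

lemma contact_vf_Yc: "contact_vf f Yc = f + (\<Sum>i\<in>UNIV. frame (dual i) (parity f) \<otimes> shift i)"
  by (simp add: contact_vf_def UNIV_odd_var frame_def nu_def)

lemma contact_lift_base: "b \<in> base \<Longrightarrow> contact_lift f b = contact_vf f b"
  by (auto simp: contact_lift_def base_def)

lemma contact_lift_h: "contact_lift f (Jet 0 {}) = pd Yc f \<otimes> hfun"
  by (simp add: contact_lift_def)

lemma admissible_contact:
  assumes f: "fun_on_M f" and p: "hom p f"
  shows "admissible p (contact_lift f)"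
  unfolding admissible_def
proof (intro conjI ballI)
  fix b assume b: "b \<in> base"
  show "fun_on_M (contact_lift f b)"
    unfolding contact_lift_base[OF b] using b
    by (rule base_cases) (simp_all add: contact_vf_Oc contact_vf_Yc f)
  have h: "hom (\<not> p) (frame (dual i) (parity f))" for i
    using f p by (simp add: hom_frame hom_parityI)
  have "hom p (frame (dual i) (parity f) \<otimes> shift i)" for i
    using hom_sprod[OF h hom_shift] by simp
  then show "hom (p \<noteq> is_odd b) (contact_lift f b)"
    unfolding contact_lift_base[OF b] using b h p
    by (elim base_cases) (auto simp: contact_vf_Oc contact_vf_Yc intro!: hom_add hom_sum)
next
  show "contact_lift f (Jet 0 {}) \<in> jet_affine"
    unfolding contact_lift_h by (rule jet_affine_sprod) (simp_all add: f)
  show "hom p (contact_lift f (Jet 0 {}))"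
    unfolding contact_lift_h
    using hom_sprod[OF hom_dy[OF f p] hom_coord[of "Jet 0 {}"]] by (simp add: hfun_def)
qed

text \<open>The contact field written in the frame: the terms with \<open>nu\<close> in its
  y-coefficient are absorbed by the frame derivatives, which leaves \<open>f\<close> in front of the
  y-derivative.\<close>

definition contact_op :: "superfun \<Rightarrow> superfun \<Rightarrow> superfun" where
  "contact_op f g = f \<otimes> pd Yc g + (\<Sum>i\<in>UNIV. frame (dual i) (parity f) \<otimes> frame i g)"

lemma sum_base: "(\<Sum>c\<in>base. h c) = h Yc + (\<Sum>i\<in>UNIV. h (Oc i))"
  by (simp add: base_def UNIV_odd_var)

lemma contact_apply_M:
  assumes f: "fun_on_M f" and p: "hom p f" and g: "fun_on_M g"
  shows "vf_apply (prolong (contact_lift f)) g = contact_op f g"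
  unfolding prolong_apply_M[OF admissible_contact[OF f p] g] sum_base
  by (simp add: contact_lift_base contact_vf_Oc contact_vf_Yc contact_op_def frame_def sprod_add_left
      sprod_add_right sprod_sum_left sprod_assoc sum.distrib algebra_simps)

definition lagrange :: "superfun \<Rightarrow> superfun \<Rightarrow> superfun" where
  "lagrange f g = contact_op f g - pd Yc f \<otimes> g"

lemma contact_op_M [simp]: "fun_on_M f \<Longrightarrow> fun_on_M g \<Longrightarrow> fun_on_M (contact_op f g)"
  by (simp add: contact_op_def)

lemma lagrange_M [simp]: "fun_on_M f \<Longrightarrow> fun_on_M g \<Longrightarrow> fun_on_M (lagrange f g)"
  by (simp add: lagrange_def)

lemma contact_op_hom:
  assumes "fun_on_M f" "hom p f"
  shows "contact_op f g = f \<otimes> pd Yc g + scal (sg p) (\<Sum>i\<in>UNIV. frame (dual i) f \<otimes> frame i g)"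
  using assms by (simp add: contact_op_def hom_parity frame_scal sprod_scal_left scal_sum)

lemma hom_lagrange:
  assumes f: "fun_on_M f" "hom p f" and g: "fun_on_M g" "hom q g"
  shows "hom (p \<noteq> q) (lagrange f g)"
proof -
  have "hom (p \<noteq> q) (frame (dual i) f \<otimes> frame i g)" for i
    using hom_sprod[OF hom_frame[OF f] hom_frame[OF g], of "dual i" i] by (cases p; cases q) simp_all
  then show ?thesis
    unfolding lagrange_def contact_op_hom[OF f]
    by (intro hom_diff hom_add hom_scal hom_sum hom_sprod[OF f(2) hom_dy[OF g]] hom_sprod[OF hom_dy[OF f] g(2)])
qed

lemma sprod_commute_M:
  assumes "fun_on_M f" "fun_on_M g" "hom p f" "hom q g"
  shows "f \<otimes> g = scal (sg (p \<and> q)) (g \<otimes> f)"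
  using sprod_commute[OF superfun_oddsupp superfun_oddsupp assms(3)] assms
  by (simp add: fun_on_M_superfun tw_hom sprod_scal_left)

lemma sum_dual: "(\<Sum>i\<in>UNIV. h (dual i)) = (\<Sum>i\<in>UNIV. h i)"
  by (rule sum.reindex_bij_witness[of _ dual dual]) auto

text \<open>The frame part is a sum over dual pairs and is superskew by reindexing along
  \<open>dual\<close>; only the y-derivatives spoil superskewness. Equivalently,
  \<open>lagrange\<close> is superskew.\<close>

lemma contact_op_swap:
  assumes f: "fun_on_M f" "hom p f" and g: "fun_on_M g" "hom q g"
  shows "scal (sg (p \<and> q)) (contact_op g f) = pd Yc f \<otimes> g + f \<otimes> pd Yc g - contact_op f g"
proof -
  have 1: "g \<otimes> pd Yc f = scal (sg (p \<and> q)) (pd Yc f \<otimes> g)"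
    using sprod_commute_M[OF g(1) _ g(2) hom_dy[OF f]] f by (simp add: conj_commute)
  have 2: "frame (dual i) g \<otimes> frame i f = scal (sg (\<not> p \<and> \<not> q)) (frame i f \<otimes> frame (dual i) g)" for i
    using sprod_commute_M[OF _ _ hom_frame[OF g] hom_frame[OF f], of "dual i" i] f g
    by (simp add: conj_commute)
  have "(\<Sum>i\<in>UNIV. frame (dual i) g \<otimes> frame i f) =
      scal (sg (\<not> p \<and> \<not> q)) (\<Sum>i\<in>UNIV. frame (dual i) f \<otimes> frame i g)"
    using sum_dual[of "\<lambda>i. frame (dual i) f \<otimes> frame i g"] by (simp add: 2 flip: scal_sum)
  then show ?thesis
    unfolding contact_op_hom[OF f] contact_op_hom[OF g] 1
    by (cases p; cases q) (simp_all add: scal_add scal_m1)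
qed

text \<open>The components of the bracket of two contact fields along the odd coordinates. In
  \<open>?S1\<close> the outer frame derivative falls on \<open>f\<close>, in \<open>?S2\<close> on
  \<open>g\<close>; the relations \<open>frame_frame\<close> supply the remaining terms.\<close>

lemma frame_lagrange:
  assumes f: "fun_on_M f" "hom p f" and g: "fun_on_M g" "hom q g"
  shows "contact_op f (frame i (parity g)) - scal (sg (p \<and> q)) (contact_op g (frame i (parity f))) =
    frame i (parity (lagrange f g))"
proof -
  let ?S1 = "\<Sum>j\<in>UNIV. frame i (frame (dual j) f) \<otimes> frame j g"
  let ?S2 = "\<Sum>j\<in>UNIV. frame (dual j) f \<otimes> frame j (frame i g)"
  note M = f(1) g(1)
  have pf: "parity f = scal (sg p) f" and pg: "parity g = scal (sg q) g"
    using f g by (simp_all add: hom_parity)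
  have cf: "contact_op f (scal a h) = scal a (contact_op f h)"
    and cg: "contact_op g (scal a h) = scal a (contact_op g h)" if "fun_on_M h" for a h
    using that M by (simp_all add: contact_op_def pd_scal fun_on_M_superfun frame_scal sprod_scal_right
        scal_add scal_sum)
  have A: "contact_op f (frame i g) = f \<otimes> frame i (pd Yc g) + scal (sg p) ?S2"
    using M by (simp add: contact_op_hom[OF f] dy_frame)
  \<comment> \<open>Swapping the arguments first avoids expanding the frame derivatives of
    \<open>frame i f\<close> on the wrong side: the result is already in terms of
    \<open>frame j g\<close>.\<close>
  have B: "scal (sg (\<not> p \<and> q)) (contact_op g (frame i f)) =
     frame i (pd Yc f) \<otimes> g - scal (sg p) (?S1 - pd Yc f \<otimes> frame i g)"
  proof -
    have hf: "fun_on_M (frame i f)" "hom (\<not> p) (frame i f)" using f by (simp_all add: hom_frame)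
    have "frame (dual j) (frame i f) = (if j = i then pd Yc f else 0) - frame i (frame (dual j) f)" for j
      using frame_frame[OF M(1), of "dual j" i] by (auto simp: dual_eq_iff)
    then have "(\<Sum>j\<in>UNIV. frame (dual j) (frame i f) \<otimes> frame j g) = pd Yc f \<otimes> frame i g - ?S1"
      by (simp add: sprod_diff_left sum_subtractf if_distrib[of "\<lambda>x. x \<otimes> _"] cong: if_cong)
    then have "contact_op (frame i f) g = frame i f \<otimes> pd Yc g + scal (sg (\<not> p)) (pd Yc f \<otimes> frame i g - ?S1)"
      by (simp add: contact_op_hom[OF hf])
    then show ?thesis
      using contact_op_swap[OF hf g] M
      by (cases p; cases q) (simp_all add: dy_frame scal_m1 algebra_simps)
  qed
  have C: "frame i (contact_op f g) = scal (sg p) (f \<otimes> frame i (pd Yc g)) + scal (sg p) ?S1 + ?S2"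
  proof -
    have "frame i (frame (dual j) f \<otimes> frame j g) = frame i (frame (dual j) f) \<otimes> frame j g
        + scal (sg p) (frame (dual j) f \<otimes> frame j (frame i g))
        - scal (sg p) (if j = dual i then frame i f \<otimes> pd Yc g else 0)" for j
    proof -
      have "parity (frame (dual j) f) = scal (- sg p) (frame (dual j) f)"
        using hom_parity[OF hom_frame[OF f]] by (cases p) simp_all
      moreover have "frame i (frame j g) = (if j = dual i then pd Yc g else 0) - frame j (frame i g)"
        using frame_frame[OF M(2), of i j] by simp
      ultimately show ?thesis
        unfolding frame_sprod[OF frame_M[OF M(1)] frame_M[OF M(2)]]
        by (auto simp: sprod_scal_left sprod_diff_right sprod_minus_left scal_m1 scal_diff)
    qed
    then have "frame i (\<Sum>j\<in>UNIV. frame (dual j) f \<otimes> frame j g) =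
        ?S1 + scal (sg p) ?S2 - scal (sg p) (frame i f \<otimes> pd Yc g)"
      using M by (simp add: frame_sum sum.distrib sum_subtractf scal_sum[symmetric])
    then show ?thesis
      unfolding contact_op_hom[OF f]
      using M by (cases p) (simp_all add: frame_add frame_scal frame_sprod pf sprod_scal_left sprod_minus_left scal_m1 frame_diff
          fun_on_M_sum algebra_simps)
  qed
  have E: "frame i (lagrange f g) = frame i (contact_op f g) - frame i (pd Yc f) \<otimes> g
      - scal (sg p) (pd Yc f \<otimes> frame i g)"
    using M hom_parity[OF hom_dy[OF f]]
    by (simp add: lagrange_def frame_diff frame_sprod sprod_scal_left algebra_simps)
  have F: "parity (lagrange f g) = scal (sg p * sg q) (lagrange f g)"
    using hom_parity[OF hom_lagrange[OF f g]] unfolding sg_neq .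
  have "scal (sg (p \<and> q)) (contact_op g (frame i f)) = scal (sg q) (scal (sg (\<not> p \<and> q)) (contact_op g (frame i f)))"
    by (cases p; cases q) simp_all
  then have B': "scal (sg (p \<and> q)) (contact_op g (frame i f)) =
      scal (sg q) (frame i (pd Yc f) \<otimes> g) - scal (sg q * sg p) (?S1 - pd Yc f \<otimes> frame i g)"
    unfolding B by (simp add: scal_diff)
  have "contact_op f (frame i (parity g)) - scal (sg (p \<and> q)) (contact_op g (frame i (parity f)))
      = scal (sg q) (contact_op f (frame i g)) - scal (sg p) (scal (sg (p \<and> q)) (contact_op g (frame i f)))"
    using M by (simp add: pf pg frame_scal cf cg mult.commute)
  also have "\<dots> = frame i (parity (lagrange f g))"
    unfolding F A B' frame_scal[OF lagrange_M[OF M]] E C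
    by (cases p; cases q) (simp_all add: scal_add scal_diff scal_m1 algebra_simps)
  finally show ?thesis .
qed

lemma contact_apply_coord:
  assumes f: "fun_on_M f" "hom p f"
  shows "vf_apply (prolong (contact_lift f)) (coord_fun (Oc i)) = frame (dual i) (parity f)"
    and "vf_apply (prolong (contact_lift f)) (coord_fun Yc) = contact_vf f Yc"
    and "vf_apply (prolong (contact_lift f)) hfun = pd Yc f \<otimes> hfun"
  using prolong_coord[OF admissible_contact[OF f]] prolong_h[OF admissible_contact[OF f]]
  by (simp_all add: contact_lift_base contact_vf_Oc contact_lift_h hfun_def)

text \<open>The y-coefficient of a contact field contains products with \<open>nu\<close>.
  Differentiating the cofactors leads back to \<open>frame_lagrange\<close>, differentiating
  \<open>nu\<close> gives the terms collected in \<open>rest\<close>.\<close>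

lemma contact_bracket_Yc:
  assumes f: "fun_on_M f" "hom p f" and g: "fun_on_M g" "hom q g"
  shows "contact_op f (contact_vf g Yc) - scal (sg (p \<and> q)) (contact_op g (contact_vf f Yc)) =
    contact_vf (lagrange f g) Yc"
proof -
  note M = f(1) g(1)
  let ?\<Theta> = "{Theta1, Theta2}"
  have ksum: "contact_vf h Yc = h + (\<Sum>i\<in>?\<Theta>. frame (dual i) (parity h) \<otimes> coord_fun (Oc (dual i)))" for h
    unfolding contact_vf_Yc by (simp add: UNIV_odd_var)
  have op: "contact_op f' (contact_vf g' Yc) = contact_op f' g' +
      (\<Sum>i\<in>?\<Theta>. contact_op f' (frame (dual i) (parity g')) \<otimes> coord_fun (Oc (dual i)))
      + (\<Sum>i\<in>?\<Theta>. tw p' (frame (dual i) (parity g')) \<otimes> frame i (parity f'))"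
    if f': "fun_on_M f'" "hom p' f'" and g': "fun_on_M g'" for f' g' p'
  proof -
    note h = hom_vf_prolong[OF admissible_contact[OF f']]
    have "contact_op f' (contact_vf g' Yc) = vf_apply (prolong (contact_lift f')) (contact_vf g' Yc)"
      using contact_apply_M[OF f'] g' unfolding ksum by simp
    also have "\<dots> = vf_apply (prolong (contact_lift f')) g' + (\<Sum>i\<in>?\<Theta>.
        vf_apply (prolong (contact_lift f')) (frame (dual i) (parity g')) \<otimes> coord_fun (Oc (dual i))
        + tw p' (frame (dual i) (parity g')) \<otimes> vf_apply (prolong (contact_lift f')) (coord_fun (Oc (dual i))))"
      unfolding ksum using g'
      by (simp add: vf_apply_add vf_apply_sprod[OF h] fun_on_M_superfun superfun_sprod superfun_add)
    also have "\<dots> = contact_op f' g' + (\<Sum>i\<in>?\<Theta>. contact_op f' (frame (dual i) (parity g')) \<otimes> coord_fun (Oc (dual i))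
        + tw p' (frame (dual i) (parity g')) \<otimes> frame i (parity f'))"
      unfolding contact_apply_coord[OF f'] dual_dual using g' by (simp add: contact_apply_M[OF f'])
    finally show ?thesis by (simp add: sum.distrib)
  qed
  \<comment> \<open>The first half sum supplies the terms with index \<open>Nu\<close>, the second
    those with index \<open>Theta\<close>; together they form the full sum over the frame.\<close>
  have rest: "(\<Sum>i\<in>?\<Theta>. tw p (frame (dual i) (parity g)) \<otimes> frame i (parity f))
      - scal (sg (p \<and> q)) (\<Sum>i\<in>?\<Theta>. tw q (frame (dual i) (parity f)) \<otimes> frame i (parity g))
      = scal (- sg p) (\<Sum>i\<in>UNIV. frame (dual i) f \<otimes> frame i g)"
  proof -
    have pf: "parity f = scal (sg p) f" and pg: "parity g = scal (sg q) g"
      using f g by (simp_all add: hom_parity)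
    have 1: "frame (dual i) g \<otimes> frame i f = scal (sg (\<not> p \<and> \<not> q)) (frame i f \<otimes> frame (dual i) g)" for i
      using sprod_commute_M[OF _ _ hom_frame[OF g] hom_frame[OF f], of "dual i" i] M
      by (simp add: conj_commute)
    have r1: "tw p (frame (dual i) (parity g)) \<otimes> frame i (parity f) = scal (- sg p) (frame i f \<otimes> frame (dual i) g)" for i
      using tw_hom[OF hom_frame[OF g], of p "dual i"] M unfolding pf pg
      by (simp add: frame_scal tw_scal sprod_scal_left sprod_scal_right 1) (cases p; cases q; simp)
    have r2: "scal (sg (p \<and> q)) (tw q (frame (dual i) (parity f)) \<otimes> frame i (parity g)) =
        scal (sg p) (frame (dual i) f \<otimes> frame i g)" for i
      using tw_hom[OF hom_frame[OF f], of q "dual i"] M unfolding pf pg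
      by (simp add: frame_scal tw_scal sprod_scal_left sprod_scal_right) (cases p; cases q; simp)
    show ?thesis
      by (simp add: r1[of Theta1, simplified] r1[of Theta2, simplified] r2[of Theta1, simplified]
          r2[of Theta2, simplified] UNIV_odd_var scal_sum scal_add scal_diff scal_m1 algebra_simps)
  qed
  have sums: "(\<Sum>i\<in>?\<Theta>. contact_op f (frame (dual i) (parity g)) \<otimes> coord_fun (Oc (dual i)))
      - scal (sg (p \<and> q)) (\<Sum>i\<in>?\<Theta>. contact_op g (frame (dual i) (parity f)) \<otimes> coord_fun (Oc (dual i)))
      = (\<Sum>i\<in>?\<Theta>. frame (dual i) (parity (lagrange f g)) \<otimes> coord_fun (Oc (dual i)))"
    unfolding frame_lagrange[OF f g, symmetric]
    by (simp add: sprod_diff_left sprod_scal_left scal_add algebra_simps)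
  have "contact_op f g - scal (sg (p \<and> q)) (contact_op g f) - scal (sg p) (\<Sum>i\<in>UNIV. frame (dual i) f \<otimes> frame i g)
      = lagrange f g"
    unfolding contact_op_swap[OF f g] lagrange_def contact_op_hom[OF f] by (simp add: algebra_simps)
  then show ?thesis
    unfolding op[OF f g(1)] op[OF g f(1)] ksum[of "lagrange f g"] sums[symmetric] scal_add
    using rest by (simp add: scal_m1 algebra_simps)
qed

text \<open>The y-derivative commutes with the frame, so it differentiates \<open>contact_op\<close>
  factor by factor; \<open>contact_op_swap\<close> then moves the derivative of \<open>f\<close> to
  the other side.\<close>

lemma dy_lagrange:
  assumes f: "fun_on_M f" "hom p f" and g: "fun_on_M g" "hom q g"
  shows "contact_op f (pd Yc g) - scal (sg (p \<and> q)) (contact_op g (pd Yc f)) = pd Yc (lagrange f g)"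
proof -
  note M = f(1) g(1)
  have f': "fun_on_M (pd Yc f)" "hom p (pd Yc f)" using f by (simp_all add: hom_dy)
  have "pd Yc (contact_op f g) = contact_op (pd Yc f) g + contact_op f (pd Yc g)"
    unfolding contact_op_hom[OF f] contact_op_hom[OF f'] using M
    by (simp add: pd_add pd_scal pd_sum pd_sprod fun_on_M_superfun superfun_sprod superfun_scal superfun_sum
        dy_frame sum.distrib scal_add algebra_simps)
  then show ?thesis
    using contact_op_swap[OF f' g] M
    by (simp add: lagrange_def pd_diff pd_sprod fun_on_M_superfun superfun_sprod algebra_simps)
qed

theorem contact_bracket:
  assumes f: "fun_on_M f" "hom p f" and g: "fun_on_M g" "hom q g"
  shows "vf_bracket (prolong (contact_lift f)) (prolong (contact_lift g)) = prolong (contact_lift (lagrange f g))"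
proof (rule vf_bracket_prolong[OF admissible_contact[OF f] admissible_contact[OF g]
    admissible_contact[OF lagrange_M[OF f(1) g(1)] hom_lagrange[OF f g]]])
  note M = f(1) g(1)
  note X = contact_apply_M[OF f] contact_apply_M[OF g] contact_apply_coord[OF f] contact_apply_coord[OF g]
  fix c assume "c \<in> insert (Jet 0 {}) base"
  then consider "c = Yc" | i where "c = Oc i" | "c = Jet 0 {}" by (auto elim: base_cases)
  then show "supercommutator p q (prolong (contact_lift f)) (prolong (contact_lift g)) (coord_fun c) =
      contact_lift (lagrange f g) c"
  proof cases
    case 1
    have "fun_on_M (contact_vf g Yc)" "fun_on_M (contact_vf f Yc)"
      using M by (simp_all add: contact_vf_Yc)
    then show ?thesis
      unfolding 1 supercommutator_def
      using contact_bracket_Yc[OF f g] by (simp add: X contact_lift_base)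
  next
    case (2 i)
    then show ?thesis
      unfolding 2 supercommutator_def
      using frame_lagrange[OF f g, of "dual i"] M by (simp add: X contact_lift_base contact_vf_Oc)
  next
    case 3
    have h: "coord_fun c = hfun" by (simp add: 3 hfun_def)
    have sf: "superfun (pd Yc f)" "superfun (pd Yc g)" "superfun hfun"
      using M by (simp_all add: fun_on_M_superfun hfun_def)
    \<comment> \<open>In the supercommutator the products of the two y-derivatives agree up to order
      and cancel.\<close>
    have 4: "tw p (pd Yc g) \<otimes> pd Yc f = scal (sg (p \<and> q)) (pd Yc g \<otimes> pd Yc f)"
      "scal (sg (p \<and> q)) (tw q (pd Yc f) \<otimes> pd Yc g) = scal (sg (p \<and> q)) (pd Yc g \<otimes> pd Yc f)"
      using tw_hom[OF hom_dy[OF g], of p] tw_hom[OF hom_dy[OF f], of q]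
        sprod_commute_M[OF _ _ hom_dy[OF f] hom_dy[OF g]] M
      by (simp_all add: sprod_scal_left conj_commute)
    have "supercommutator p q (prolong (contact_lift f)) (prolong (contact_lift g)) hfun =
       contact_op f (pd Yc g) \<otimes> hfun + tw p (pd Yc g) \<otimes> pd Yc f \<otimes> hfun
       - scal (sg (p \<and> q)) (contact_op g (pd Yc f) \<otimes> hfun + tw q (pd Yc f) \<otimes> pd Yc g \<otimes> hfun)"
      unfolding supercommutator_def X
      using sf M by (simp add: vf_apply_sprod[OF hom_vf_prolong[OF admissible_contact[OF f]]]
          vf_apply_sprod[OF hom_vf_prolong[OF admissible_contact[OF g]]] X sprod_assoc)
    also have "\<dots> = (contact_op f (pd Yc g) - scal (sg (p \<and> q)) (contact_op g (pd Yc f))) \<otimes> hfun"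
    proof -
      have "tw p (pd Yc g) \<otimes> pd Yc f = scal (sg (p \<and> q)) (tw q (pd Yc f) \<otimes> pd Yc g)"
        using 4 by simp
      then have "tw p (pd Yc g) \<otimes> pd Yc f \<otimes> hfun = scal (sg (p \<and> q)) (tw q (pd Yc f) \<otimes> pd Yc g \<otimes> hfun)"
        by (simp add: sprod_scal_left)
      then show ?thesis by (simp add: scal_add sprod_diff_left sprod_scal_left)
    qed
    finally show ?thesis
      unfolding h dy_lagrange[OF f g] by (simp add: 3 contact_lift_h)
  qed
qed

section \<open>Vertical fields and their supercommutators with contact fields\<close>

definition vertical :: "superfun \<Rightarrow> vfield" where
  "vertical s = (\<lambda>_. 0)(Jet 0 {} := s)"

lemma vertical_simps [simp]: "vertical s (Jet 0 {}) = s" "b \<in> base \<Longrightarrow> vertical s b = 0"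
  by (auto simp: vertical_def base_def)

lemma admissible_vertical: "fun_on_M s \<Longrightarrow> hom p s \<Longrightarrow> admissible p (vertical s)"
  by (simp add: admissible_def jet_affine.base)

lemma vertical_M: "fun_on_M s \<Longrightarrow> hom q s \<Longrightarrow> fun_on_M g \<Longrightarrow> vf_apply (prolong (vertical s)) g = 0"
  by (simp add: prolong_apply_M[OF admissible_vertical])

text \<open>The base components vanish since vertical fields kill functions on M. Along h, the
  contact field differentiates \<open>s\<close>, while the vertical field turns the lift coefficient
  \<open>pd Yc f \<otimes> hfun\<close> into \<open>pd Yc f \<otimes> s\<close> up to sign.\<close>

lemma contact_vertical:
  assumes f: "fun_on_M f" "hom p f" and s: "fun_on_M s" "hom q s" and F: "F \<in> jet_affine"
  shows "supercommutator p q (prolong (contact_lift f)) (prolong (vertical s)) F =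
    vf_apply (prolong (vertical (lagrange f s))) F"
proof (rule supercommutator_affine[OF admissible_contact[OF f] admissible_vertical[OF s]
    admissible_vertical[OF lagrange_M[OF f(1) s(1)] hom_lagrange[OF f s]] _ _ _ F])
  note h = hom_vf_prolong[OF admissible_vertical[OF s]]
  have "vf_apply (prolong (vertical s)) hfun = s"
    using prolong_coord[OF admissible_vertical[OF s]] prolong_h[OF admissible_vertical[OF s]]
    by (simp add: hfun_def)
  moreover have "tw q (pd Yc f) = scal (sg (p \<and> q)) (pd Yc f)"
    using tw_hom[OF hom_dy[OF f], of q] by (simp add: conj_commute)
  moreover have "superfun (pd Yc f)" "superfun hfun"
    using f by (simp_all add: fun_on_M_superfun hfun_def)
  ultimately show "supercommutator p q (prolong (contact_lift f)) (prolong (vertical s)) hfun =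
      vertical (lagrange f s) (Jet 0 {})"
    unfolding supercommutator_def contact_apply_coord[OF f]
    using f s by (simp add: vf_apply_sprod[OF h] vertical_M[OF s] contact_apply_M[OF f] lagrange_def sprod_scal_left)
next
  fix g assume "fun_on_M g"
  then show "supercommutator p q (prolong (contact_lift f)) (prolong (vertical s)) g = 0"
    using f by (simp add: supercommutator_def vertical_M[OF s] contact_apply_M[OF f])
qed simp

section \<open>Coefficients of functions on M\<close>

text \<open>A function on M sees only the value at \<open>Yc\<close> of a point, so constant points
  suffice and coefficients become functions of one complex variable.\<close>

definition cf :: "superfun \<Rightarrow> odd_var set \<Rightarrow> complex \<Rightarrow> complex" where
  "cf f I y = f (Oc ` I) (\<lambda>_. y)"

text \<open>Splits an identity of functions on M into sixteen identities of coefficients, at sorted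
  set literals that match \<open>cf_sprod\<close>.\<close>

lemma odd_var_set_cases:
  assumes "P {}"
    and "P {Theta1}"
    and "P {Theta2}"
    and "P {Nu1}"
    and "P {Nu2}"
    and "P {Theta1, Theta2}"
    and "P {Theta1, Nu1}"
    and "P {Theta1, Nu2}"
    and "P {Theta2, Nu1}"
    and "P {Theta2, Nu2}"
    and "P {Nu1, Nu2}"
    and "P {Theta1, Theta2, Nu1}"
    and "P {Theta1, Theta2, Nu2}"
    and "P {Theta1, Nu1, Nu2}"
    and "P {Theta2, Nu1, Nu2}"
    and "P {Theta1, Theta2, Nu1, Nu2}"
  shows "P I"
proof -
  have "I \<in> Pow UNIV" by simp
  then have "I \<in> Pow {Theta1, Theta2, Nu1, Nu2}" unfolding UNIV_odd_var .
  then show ?thesis using assms by (auto simp: Pow_insert)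
qed

lemma cf_add: "cf (f + g) I y = cf f I y + cf g I y"
  and cf_diff: "cf (f - g) I y = cf f I y - cf g I y"
  and cf_scal: "cf (scal c f) I y = c * cf f I y"
  and cf_zero: "cf 0 I y = 0"
  and cf_one: "cf one_sf I y = (if I = {} then 1 else 0)"
  by (simp_all add: cf_def pointwise scal_def one_sf_def)

lemma inj_Oc: "inj_on Oc I" by (simp add: inj_on_def)

lemma cf_parity: "cf (parity f) I y = (-1) ^ card I * cf f I y"
  by (simp add: cf_def parity_def card_image[OF inj_Oc])

lemma cf_pd_Oc: "cf (pd (Oc i) f) I y = (if i \<in> I then 0 else eps i I * cf f (insert i I) y)"
proof -
  have "{c \<in> Oc ` I. rank c < rank (Oc i)} = Oc ` {j \<in> I. var_rank j < var_rank i}" by auto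
  then have "card {c \<in> Oc ` I. rank c < rank (Oc i)} = card {j \<in> I. var_rank j < var_rank i}"
    by (simp only: card_image[OF inj_Oc])
  then show ?thesis
    unfolding cf_def pd_def eps_def by (auto simp del: rank.simps)
qed

lemma cf_ext:
  assumes f: "fun_on_M f" and g: "fun_on_M g" and eq: "\<And>I y. cf f I y = cf g I y"
  shows "f = g"
proof (intro ext)
  fix K z
  show "f K z = g K z"
  proof (cases "K \<subseteq> range Oc")
    case True
    have dep: "h K z = cf h (Oc -` K) (z Yc)" if "fun_on_M h" for h
    proof -
      have "h K z = h K (\<lambda>_. z Yc)"
        by (rule superfun_inD(2)[OF that[unfolded fun_on_M_def]]) (auto simp: base_def)
      moreover have "Oc ` (Oc -` K) = K" using True by blast
      ultimately show ?thesis by (simp add: cf_def)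
    qed
    show ?thesis unfolding dep[OF f] dep[OF g] by (rule eq)
  next
    case False
    have z: "h K z = 0" if "fun_on_M h" for h
    proof (rule ccontr)
      assume "h K z \<noteq> 0"
      from superfun_inD(1)[OF that[unfolded fun_on_M_def] this]
      show False using False by (auto simp: base_def)
    qed
    show ?thesis unfolding z[OF f] z[OF g] ..
  qed
qed

lemma DERIV_cf:
  assumes "fun_on_M f"
  shows "(cf f I has_field_derivative cf (pd Yc f) I y) (at y)"
proof -
  have "f (Oc ` I) ((\<lambda>_. y)(Yc := t)) = cf f I t" for t
    unfolding cf_def
    by (rule superfun_inD(2)[OF assms[unfolded fun_on_M_def]]) (auto simp: base_def)
  then show ?thesis
    using DERIV_pd[OF fun_on_M_superfun[OF assms], of Yc "Oc ` I" "\<lambda>_. y"] by (simp add: cf_def[of "pd Yc f"])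
qed

definition merge_sign :: "odd_var set \<Rightarrow> odd_var set \<Rightarrow> complex" where
  "merge_sign I J = reorder_sign (Oc ` I) (Oc ` J)"

lemma merge_sign_insert: "i \<notin> I \<Longrightarrow> merge_sign (insert i I) J = eps i J * merge_sign I J"
proof -
  assume "i \<notin> I"
  then have "merge_sign (insert i I) J = reorder_sign {Oc i} (Oc ` J) * merge_sign I J"
    unfolding merge_sign_def image_insert by (intro reorder_sign_insert_left) auto
  moreover have "{c \<in> Oc ` J. rank c < rank (Oc i)} = Oc ` {j \<in> J. var_rank j < var_rank i}" by auto
  then have "reorder_sign {Oc i} (Oc ` J) = eps i J"
    unfolding reorder_sign_single_left eps_def by (simp only: card_image[OF inj_Oc])
  ultimately show ?thesis by simp
qed

lemma merge_sign_empty [simp]: "merge_sign {} J = 1"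
  by (simp add: merge_sign_def)

lemma cf_sprod_sum: "cf (f \<otimes> g) I y = (\<Sum>J\<in>Pow I. merge_sign J (I - J) * cf f J y * cf g (I - J) y)"
proof -
  have "Pow (Oc ` I) = image Oc ` Pow I" by (rule image_Pow_surj[symmetric]) simp
  moreover have "inj_on (image Oc) (Pow I)"
    by (rule inj_on_image_Pow) (rule inj_Oc)
  ultimately have "cf (f \<otimes> g) I y = (\<Sum>J\<in>Pow I. reorder_sign (Oc ` J) (Oc ` I - Oc ` J) *
      f (Oc ` J) (\<lambda>_. y) * g (Oc ` I - Oc ` J) (\<lambda>_. y))"
    unfolding cf_def sprod_def by (simp add: sum.reindex)
  also have "\<dots> = (\<Sum>J\<in>Pow I. merge_sign J (I - J) * cf f J y * cf g (I - J) y)"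
    by (intro sum.cong refl) (simp add: merge_sign_def cf_def image_set_diff inj_def)
  finally show ?thesis .
qed

text \<open>The multiplication table of the exterior algebra on four generators; the signs are those
  of the shuffles.\<close>

lemma cf_sprod:
    "cf (f \<otimes> g) {} y = cf f {} y * cf g {} y"
    "cf (f \<otimes> g) {Theta1} y = cf f {} y * cf g {Theta1} y + cf f {Theta1} y * cf g {} y"
    "cf (f \<otimes> g) {Theta2} y = cf f {} y * cf g {Theta2} y + cf f {Theta2} y * cf g {} y"
    "cf (f \<otimes> g) {Nu1} y = cf f {} y * cf g {Nu1} y + cf f {Nu1} y * cf g {} y"
    "cf (f \<otimes> g) {Nu2} y = cf f {} y * cf g {Nu2} y + cf f {Nu2} y * cf g {} y"
    "cf (f \<otimes> g) {Theta1, Theta2} y = cf f {} y * cf g {Theta1, Theta2} y + cf f {Theta1} y * cf g {Theta2} y - cf f {Theta2} y *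
      cf g {Theta1} y + cf f {Theta1, Theta2} y * cf g {} y"
    "cf (f \<otimes> g) {Theta1, Nu1} y = cf f {} y * cf g {Theta1, Nu1} y + cf f {Theta1} y * cf g {Nu1} y - cf f {Nu1} y * cf g
      {Theta1} y + cf f {Theta1, Nu1} y * cf g {} y"
    "cf (f \<otimes> g) {Theta1, Nu2} y = cf f {} y * cf g {Theta1, Nu2} y + cf f {Theta1} y * cf g {Nu2} y - cf f {Nu2} y * cf g
      {Theta1} y + cf f {Theta1, Nu2} y * cf g {} y"
    "cf (f \<otimes> g) {Theta2, Nu1} y = cf f {} y * cf g {Theta2, Nu1} y + cf f {Theta2} y * cf g {Nu1} y - cf f {Nu1} y * cf g
      {Theta2} y + cf f {Theta2, Nu1} y * cf g {} y"
    "cf (f \<otimes> g) {Theta2, Nu2} y = cf f {} y * cf g {Theta2, Nu2} y + cf f {Theta2} y * cf g {Nu2} y - cf f {Nu2} y * cf g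
      {Theta2} y + cf f {Theta2, Nu2} y * cf g {} y"
    "cf (f \<otimes> g) {Nu1, Nu2} y = cf f {} y * cf g {Nu1, Nu2} y + cf f {Nu1} y * cf g {Nu2} y - cf f {Nu2} y * cf g {Nu1} y +
      cf f {Nu1, Nu2} y * cf g {} y"
    "cf (f \<otimes> g) {Theta1, Theta2, Nu1} y = cf f {} y * cf g {Theta1, Theta2, Nu1} y + cf f {Theta1} y * cf g {Theta2, Nu1} y - cf f
      {Theta2} y * cf g {Theta1, Nu1} y + cf f {Nu1} y * cf g {Theta1, Theta2} y + cf f {Theta1,
      Theta2} y * cf g {Nu1} y - cf f {Theta1, Nu1} y * cf g {Theta2} y + cf f {Theta2, Nu1} y *
      cf g {Theta1} y + cf f {Theta1, Theta2, Nu1} y * cf g {} y"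
    "cf (f \<otimes> g) {Theta1, Theta2, Nu2} y = cf f {} y * cf g {Theta1, Theta2, Nu2} y + cf f {Theta1} y * cf g {Theta2, Nu2} y - cf f
      {Theta2} y * cf g {Theta1, Nu2} y + cf f {Nu2} y * cf g {Theta1, Theta2} y + cf f {Theta1,
      Theta2} y * cf g {Nu2} y - cf f {Theta1, Nu2} y * cf g {Theta2} y + cf f {Theta2, Nu2} y *
      cf g {Theta1} y + cf f {Theta1, Theta2, Nu2} y * cf g {} y"
    "cf (f \<otimes> g) {Theta1, Nu1, Nu2} y = cf f {} y * cf g {Theta1, Nu1, Nu2} y + cf f {Theta1} y * cf g {Nu1, Nu2} y - cf f {Nu1} y *
      cf g {Theta1, Nu2} y + cf f {Nu2} y * cf g {Theta1, Nu1} y + cf f {Theta1, Nu1} y * cf g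
      {Nu2} y - cf f {Theta1, Nu2} y * cf g {Nu1} y + cf f {Nu1, Nu2} y * cf g {Theta1} y + cf f
      {Theta1, Nu1, Nu2} y * cf g {} y"
    "cf (f \<otimes> g) {Theta2, Nu1, Nu2} y = cf f {} y * cf g {Theta2, Nu1, Nu2} y + cf f {Theta2} y * cf g {Nu1, Nu2} y - cf f {Nu1} y *
      cf g {Theta2, Nu2} y + cf f {Nu2} y * cf g {Theta2, Nu1} y + cf f {Theta2, Nu1} y * cf g
      {Nu2} y - cf f {Theta2, Nu2} y * cf g {Nu1} y + cf f {Nu1, Nu2} y * cf g {Theta2} y + cf f
      {Theta2, Nu1, Nu2} y * cf g {} y"
    "cf (f \<otimes> g) {Theta1, Theta2, Nu1, Nu2} y = cf f {} y * cf g {Theta1, Theta2, Nu1, Nu2} y + cf f {Theta1} y * cf g {Theta2, Nu1, Nu2} y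
      - cf f {Theta2} y * cf g {Theta1, Nu1, Nu2} y + cf f {Nu1} y * cf g {Theta1, Theta2, Nu2} y
      - cf f {Nu2} y * cf g {Theta1, Theta2, Nu1} y + cf f {Theta1, Theta2} y * cf g {Nu1, Nu2} y
      - cf f {Theta1, Nu1} y * cf g {Theta2, Nu2} y + cf f {Theta1, Nu2} y * cf g {Theta2, Nu1} y
      + cf f {Theta2, Nu1} y * cf g {Theta1, Nu2} y - cf f {Theta2, Nu2} y * cf g {Theta1, Nu1} y
      + cf f {Nu1, Nu2} y * cf g {Theta1, Theta2} y + cf f {Theta1, Theta2, Nu1} y * cf g {Nu2} y
      - cf f {Theta1, Theta2, Nu2} y * cf g {Nu1} y + cf f {Theta1, Nu1, Nu2} y * cf g {Theta2} y
      - cf f {Theta2, Nu1, Nu2} y * cf g {Theta1} y + cf f {Theta1, Theta2, Nu1, Nu2} y * cf g {}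
      y"
  by (simp_all add: cf_sprod_sum sum_Pow_insert merge_sign_insert eps_eval insert_Diff_if)

lemma cf_coord_sprod:
  "cf (coord_fun (Oc k) \<otimes> h) I y = (if k \<in> I then eps k I * cf h (I - {k}) y else 0)"
proof -
  have c: "cf (coord_fun (Oc k)) J y = (if J = {k} then 1 else 0)" for J
  proof -
    have "Oc ` J = {Oc k} \<longleftrightarrow> J = {k}" by auto
    then show ?thesis by (simp add: cf_def coord_fun_def)
  qed
  have "cf (coord_fun (Oc k) \<otimes> h) I y =
      (\<Sum>J\<in>Pow I. if J = {k} then merge_sign {k} (I - {k}) * cf h (I - {k}) y else 0)"
    unfolding cf_sprod_sum by (intro sum.cong refl) (simp add: c)
  also have "\<dots> = (if k \<in> I then merge_sign {k} (I - {k}) * cf h (I - {k}) y else 0)"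
    by (simp add: sum.delta)
  also have "merge_sign {k} (I - {k}) = eps k I"
  proof -
    have "{j \<in> I - {k}. var_rank j < var_rank k} = {j \<in> I. var_rank j < var_rank k}" by auto
    then show ?thesis using merge_sign_insert[of k "{}"] by (simp add: eps_def)
  qed
  finally show ?thesis .
qed

lemma cf_frame:
  "cf (frame i f) I y = (if i \<in> I then 0 else eps i I * cf f (insert i I) y) +
    (if i \<in> {Theta1, Theta2} \<and> dual i \<in> I then eps (dual i) I * cf (pd Yc f) (I - {dual i}) y else 0)"
  unfolding frame_def cf_add cf_pd_Oc by (cases i) (simp_all add: cf_coord_sprod cf_zero)


section \<open>Generating functions of \<open>D(2,1;a)\<close>\<close>

text \<open>The second factor \<open>sl\<^sub>2\<close> consists of the translations, the grading element and the elements
  of degree 2; the other two factors act by quadratic functions of the odd coordinates.\<close>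

fun gen_coeff :: "complex \<Rightarrow> gamma \<Rightarrow> odd_var set \<Rightarrow> complex \<Rightarrow> complex" where
  "gen_coeff a (((x1, h1, y1), (x2, h2, y2), (x3, h3, y3)), w) I y =
    (if Theta1 \<in> I
      then (if Theta2 \<in> I
        then (if Nu1 \<in> I
          then (if Nu2 \<in> I
            then (a + 1) * y2
            else a * w Vx Vy Vy)
          else (if Nu2 \<in> I
            then a * w Vx Vy Vx
            else x1))
        else (if Nu1 \<in> I
          then (if Nu2 \<in> I
            then (a + 1) * w Vy Vy Vx
            else h2 - h1 - h3 + y2 * y)
          else (if Nu2 \<in> I
            then x3
            else w Vx Vx Vx + w Vx Vy Vx * y)))
      else (if Theta2 \<in> I
        then (if Nu1 \<in> I
          then (if Nu2 \<in> I
            then - (a + 1) * w Vy Vy Vy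
            else y3)
          else (if Nu2 \<in> I
            then h2 - h1 + h3 + y2 * y
            else - w Vx Vx Vy - w Vx Vy Vy * y))
        else (if Nu1 \<in> I
          then (if Nu2 \<in> I
            then - y1
            else - w Vy Vx Vy - w Vy Vy Vy * y)
          else (if Nu2 \<in> I
            then - w Vy Vx Vx - w Vy Vy Vx * y
            else x2 - 2 * h2 * y - y2 * y\<^sup>2))))"

definition gen :: "complex \<Rightarrow> gamma \<Rightarrow> superfun" where
  "gen a u = (\<lambda>K z. if K \<subseteq> range Oc then gen_coeff a u (Oc -` K) (z Yc) else 0)"

lemma cf_gen: "cf (gen a u) I y = gen_coeff a u I y"
proof -
  have "Oc -` Oc ` I = I" by auto
  then show ?thesis by (auto simp: cf_def gen_def)
qed

lemma holomorphic_gen_coeff: "gen_coeff a u I holomorphic_on UNIV"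
proof -
  obtain x1 h1 y1 x2 h2 y2 x3 h3 y3 w where u: "u = (((x1, h1, y1), (x2, h2, y2), (x3, h3, y3)), w)"
    by (metis prod.exhaust)
  have "(\<lambda>y. gen_coeff a u I y) holomorphic_on UNIV"
    unfolding u gen_coeff.simps
    by (cases "Theta1 \<in> I"; cases "Theta2 \<in> I"; cases "Nu1 \<in> I"; cases "Nu2 \<in> I";
        simp only: if_True if_False; intro holomorphic_intros)
  then show ?thesis by simp
qed

lemma gen_M [simp]: "fun_on_M (gen a u)"
  unfolding fun_on_M_def
proof (rule superfun_inI)
  fix K z assume "gen a u K z \<noteq> 0"
  then show "K \<subseteq> base \<inter> {c. is_odd c}" by (auto simp: gen_def split: if_splits)
next
  fix K z z' assume "\<And>c. c \<in> base \<Longrightarrow> \<not> is_odd c \<Longrightarrow> z c = (z' c :: complex)"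
  then have "z Yc = z' Yc" by simp
  then show "gen a u K z = gen a u K z'" by (simp add: gen_def)
next
  fix K
  have "continuous_on UNIV (\<lambda>z :: coord \<Rightarrow> complex. z Yc)"
    by (rule continuous_on_product_then_coordinatewise[OF continuous_on_id])
  from continuous_on_compose2[OF holomorphic_on_imp_continuous_on[OF holomorphic_gen_coeff] this]
  show "continuous_on UNIV (gen a u K)"
    by (cases "K \<subseteq> range Oc") (simp_all add: gen_def)
next
  fix K z c
  show "(\<lambda>t. gen a u K (z(c := t))) holomorphic_on UNIV"
    by (cases "K \<subseteq> range Oc"; cases "c = Yc") (simp_all add: gen_def holomorphic_gen_coeff)
qed

lemma gen_add: "gen a (u + v) = gen a u + gen a v"
  by (cases u rule: gen_coeff.cases[of "(a, u, {}, 0)" for u, simplified]; cases v)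
    (auto simp: gen_def fun_eq_iff pointwise algebra_simps)

lemma gen_scal: "gen a (gamma_scal k u) = scal k (gen a u)"
proof -
  obtain x1 h1 y1 x2 h2 y2 x3 h3 y3 w where u: "u = (((x1, h1, y1), (x2, h2, y2), (x3, h3, y3)), w)"
    by (metis prod.exhaust)
  show ?thesis unfolding u by (simp add: gen_def fun_eq_iff scal_def algebra_simps)
qed

text \<open>The bracket with the element X of the second \<open>sl2\<close>: its generating function
  is the constant 1, and the Lagrange bracket with 1 is the y-derivative.\<close>

fun gen_dy :: "gamma \<Rightarrow> gamma" where
  "gen_dy (((x1, h1, y1), (x2, h2, y2), (x3, h3, y3)), w) =
    (((0, 0, 0), (- 2 * h2, y2, 0), (0, 0, 0)), \<lambda>p q r. if q = Vx then w p Vy r else 0)"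

lemma dy_gen: "pd Yc (gen a u) = gen a (gen_dy u)"
proof (rule cf_ext)
  fix I y
  obtain x1 h1 y1 x2 h2 y2 x3 h3 y3 w where u: "u = (((x1, h1, y1), (x2, h2, y2), (x3, h3, y3)), w)"
    by (metis prod.exhaust)
  have "((\<lambda>y. gen_coeff a u I y) has_field_derivative gen_coeff a (gen_dy u) I y) (at y)"
    unfolding u gen_coeff.simps gen_dy.simps
    by (cases "Theta1 \<in> I"; cases "Theta2 \<in> I"; cases "Nu1 \<in> I"; cases "Nu2 \<in> I";
        simp; auto intro!: derivative_eq_intros)
  moreover have "cf (gen a u) I = gen_coeff a u I" by (simp add: fun_eq_iff cf_gen)
  ultimately show "cf (pd Yc (gen a u)) I y = cf (gen a (gen_dy u)) I y"
    using DERIV_cf[OF gen_M, of a u I y] DERIV_unique by (auto simp: cf_gen)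
qed simp_all

lemma hom_gen: "hom False (gen a (A, 0))" "hom True (gen a (0, w))"
proof -
  obtain x1 h1 y1 x2 h2 y2 x3 h3 y3 where A: "A = ((x1, h1, y1), (x2, h2, y2), (x3, h3, y3))"
    by (metis prod.exhaust)
  have even: "gen_coeff a (A, 0) I y \<noteq> 0 \<Longrightarrow> even (card I)" for I y
    by (rule odd_var_set_cases[of "\<lambda>I. gen_coeff a (A, 0) I y \<noteq> 0 \<longrightarrow> even (card I)", rule_format, of I])
      (simp_all add: A zero_fun_apply)
  have odd: "gen_coeff a (0, w) I y \<noteq> 0 \<Longrightarrow> odd (card I)" for I y
    by (rule odd_var_set_cases[of "\<lambda>I. gen_coeff a (0, w) I y \<noteq> 0 \<longrightarrow> odd (card I)", rule_format, of I])
      (simp_all add: zero_prod_def)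
  have card: "card K = card (Oc -` K)" if "K \<subseteq> range Oc" for K
    using that by (simp add: card_vimage_inj inj_Oc)
  show "hom False (gen a (A, 0))" "hom True (gen a (0, w))"
    unfolding hom_def gen_def using even odd card by (auto split: if_splits)
qed

text \<open>Collapses the 64 terms: \<open>q\<close> pairs two tensor slots by \<open>eta\<close> in
  each, and the remaining slot is symmetrised by \<open>phi\<close>.\<close>

lemma odd_bracket_eval:
  "odd_bracket s1 s2 s3 u w =
    (let q = (\<lambda>f g. f Vx Vx * g Vy Vy - f Vx Vy * g Vy Vx - f Vy Vx * g Vx Vy + f Vy Vy * g Vx Vx);
         t1 = (\<lambda>p p'. s1 * q (u p) (w p'));
         t2 = (\<lambda>p p'. s2 * q (\<lambda>i. u i p) (\<lambda>i. w i p'));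
         t3 = (\<lambda>p p'. s3 * q (\<lambda>i j. u i j p) (\<lambda>i j. w i j p'))
     in ((t1 Vx Vx, - (t1 Vx Vy + t1 Vy Vx) / 2, - t1 Vy Vy),
         (t2 Vx Vx, - (t2 Vx Vy + t2 Vy Vx) / 2, - t2 Vy Vy),
         (t3 Vx Vx, - (t3 Vx Vy + t3 Vy Vx) / 2, - t3 Vy Vy)))"
proof -
  have split: "(\<Sum>(p, q, r)\<in>{Vx, Vy} \<times> {Vx, Vy} \<times> {Vx, Vy}. h p q r) =
     h Vx Vx Vx + h Vx Vx Vy + h Vx Vy Vx + h Vx Vy Vy + h Vy Vx Vx + h Vy Vx Vy + h Vy Vy Vx + h Vy Vy Vy"
    for h :: "xy \<Rightarrow> xy \<Rightarrow> xy \<Rightarrow> sl2 \<times> sl2 \<times> sl2"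
    by (simp flip: sum.cartesian_product add: add.assoc)
  show ?thesis
    unfolding odd_bracket_def split by (simp add: Let_def zero_prod_def field_simps)
qed

lemma dy_parity: "fun_on_M f \<Longrightarrow> pd Yc (parity f) = parity (pd Yc f)"
  by (simp add: pd_parity fun_on_M_superfun)

text \<open>By \<open>dy_gen\<close> all derivatives stay within the family, so both sides have
  explicit polynomial coefficients and the claim is a finite computation. It is here that the
  parameters \<open>(-1 - a, 1, a)\<close> are matched with the constants of
  \<open>gen_coeff\<close>.\<close>

lemma lagrange_gen: "lagrange (gen a u) (gen a v) = gen a (D21_bracket a u v)"
proof (rule cf_ext)
  fix I y
  obtain x1 h1 y1 x2 h2 y2 x3 h3 y3 w where u: "u = (((x1, h1, y1), (x2, h2, y2), (x3, h3, y3)), w)"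
    by (metis prod.exhaust)
  obtain x1' h1' y1' x2' h2' y2' x3' h3' y3' w' where
    v: "v = (((x1', h1', y1'), (x2', h2', y2'), (x3', h3', y3')), w')"
    by (metis prod.exhaust)
  show "cf (lagrange (gen a u) (gen a v)) I y = cf (gen a (D21_bracket a u v)) I y"
    unfolding u v
    by (rule odd_var_set_cases[of "\<lambda>I. cf (lagrange (gen a (((x1, h1, y1), (x2, h2, y2), (x3, h3, y3)), w))
          (gen a (((x1', h1', y1'), (x2', h2', y2'), (x3', h3', y3')), w'))) I y =
        cf (gen a (D21_bracket a (((x1, h1, y1), (x2, h2, y2), (x3, h3, y3)), w)
          (((x1', h1', y1'), (x2', h2', y2'), (x3', h3', y3')), w'))) I y"])
      (simp add: lagrange_def contact_op_def UNIV_odd_var cf_add cf_diff cf_sprod cf_frame cf_parity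
        dy_parity dy_gen cf_gen eps_eval D21_bracket_def odd_bracket_eval Let_def pointwise insert_Diff_if,
        simp add: field_simps power2_eq_square)+
qed simp_all

section \<open>The ideal of the system\<close>

abbreviation J :: "nat \<Rightarrow> odd_var set \<Rightarrow> superfun" where
  "J m I \<equiv> coord_fun (Jet m I)"

lemma system_eq:
  "system a = {scal (a + 1) (J 2 {}) + scal 2 (J 0 {Theta1, Theta2, Nu1, Nu2}),
     J 1 {Theta1, Nu2}, J 1 {Theta2, Nu1}, J 1 {Theta1, Theta2}, J 1 {Nu1, Nu2},
     J 1 {Theta1, Nu1} - J 1 {Theta2, Nu2},
     scal (a + 1) (J 1 {Nu1}) + J 0 {Theta2, Nu1, Nu2},
     scal (a + 1) (J 1 {Nu2}) - J 0 {Theta1, Nu1, Nu2},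
     coord_fun (Oc Nu1) \<otimes> (scal a (J 1 {Theta1}) + J 0 {Theta1, Theta2, Nu2}),
     coord_fun (Oc Nu2) \<otimes> (scal a (J 1 {Theta2}) - J 0 {Theta1, Theta2, Nu1})}"
proof -
  have two: "{h k |k. k \<in> {1, 2 :: nat}} = {h 1, h 2}" for h :: "nat \<Rightarrow> superfun" by auto
  show ?thesis
    unfolding system_def two
    by (simp add: theta_def nu_def hfun_def eps_eval numeral_2_eq_2 scal_m1 insert_commute)
qed

lemma system_linear:
  assumes "E \<in> system a"
  shows "E \<in> jet_linear"
  using assms unfolding system_eq
  by (elim insertE emptyE)
    (simp_all add: jet_linear.add jet_linear_diff jet_linear_scal jet_linear_coord jet_linear_sprod)

lemma system_hom:
  assumes "E \<in> system a"
  obtains e where "hom e E"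
proof -
  have h: "hom (odd (card I)) (J m I)" for m I using hom_coord[of "Jet m I"] by simp
  have n: "hom True (coord_fun (Oc i))" for i using hom_coord[of "Oc i"] by simp
  have even: "hom False (J m I)" if "even (card I)" for m I using h[of I m] that by simp
  have odd: "hom True (J m I)" if "odd (card I)" for m I using h[of I m] that by simp
  have sp: "hom False (coord_fun (Oc i) \<otimes> F)" if "hom True F" for i F
    using hom_sprod[OF n that, of i] by simp
  have "hom False E \<or> hom True E"
    using assms unfolding system_eq
    by (elim insertE emptyE)
      (simp_all add: even odd sp hom_add hom_diff hom_scal)
  then show ?thesis using that by blast
qed

text \<open>The system closed under total derivatives but without multipliers. It stays within
  \<open>jet_linear\<close>, which the whole ideal does not.\<close>

inductive_set equations :: "complex \<Rightarrow> superfun set" for a where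
  base: "E \<in> system a \<Longrightarrow> E \<in> equations a"
| total: "L \<in> equations a \<Longrightarrow> b \<in> base \<Longrightarrow> D b L \<in> equations a"

lemma equations_linear: "L \<in> equations a \<Longrightarrow> L \<in> jet_linear"
  by (induction rule: equations.induct) (simp_all add: system_linear D_linear)

lemma equations_ideal: "L \<in> equations a \<Longrightarrow> L \<in> system_ideal a"
  by (induction rule: equations.induct) (simp_all add: system_ideal.equation system_ideal.total)

lemma equations_superfun: "L \<in> equations a \<Longrightarrow> superfun L"
  by (rule jet_linear_superfun[OF equations_linear])

text \<open>By the Leibniz rule multipliers can be pulled out of total derivatives. This gives an
  induction over the ideal in which they occur only outermost.\<close>

inductive_set left_span :: "complex \<Rightarrow> superfun set" for a where
  mult: "superfun G \<Longrightarrow> L \<in> equations a \<Longrightarrow> G \<otimes> L \<in> left_span a"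
| add: "F \<in> left_span a \<Longrightarrow> G \<in> left_span a \<Longrightarrow> F + G \<in> left_span a"

lemma left_span_superfun: "F \<in> left_span a \<Longrightarrow> superfun F"
  by (induction rule: left_span.induct) (simp_all add: superfun_sprod superfun_add equations_superfun)

lemma left_span_mult: "F \<in> left_span a \<Longrightarrow> superfun H \<Longrightarrow> H \<otimes> F \<in> left_span a"
proof (induction rule: left_span.induct)
  case (mult G L)
  then show ?case using left_span.mult[of "H \<otimes> G" L a] by (simp add: superfun_sprod sprod_assoc)
qed (simp add: sprod_add_right left_span.add)

lemma left_span_D: "F \<in> left_span a \<Longrightarrow> b \<in> base \<Longrightarrow> D b F \<in> left_span a"
proof (induction rule: left_span.induct)
  case (mult G L)
  then show ?case
    by (simp add: D_sprod equations_superfun left_span.add left_span.mult superfun_D superfun_tw equations.total)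
next
  case (add F G)
  then show ?case by (simp add: D_add left_span_superfun left_span.add)
qed

lemma system_ideal_left_span: "F \<in> system_ideal a \<Longrightarrow> F \<in> left_span a"
proof (induction rule: system_ideal.induct)
  case (equation E)
  then have "E \<in> equations a" by (rule equations.base)
  then show ?case using left_span.mult[of one_sf E a] by (simp add: one_sprod_superfun equations_superfun)
qed (auto intro: left_span_D left_span_mult left_span.add)

lemma system_ideal_superfun: "F \<in> system_ideal a \<Longrightarrow> superfun F"
  using system_ideal_left_span left_span_superfun by blast

lemma ideal_scal: "F \<in> system_ideal a \<Longrightarrow> scal c F \<in> system_ideal a"
  using system_ideal.mult[of "scal c one_sf" F a] scal_one_sprod[OF system_ideal_superfun]
  by (simp add: superfun_scal)

lemma ideal_diff: "F \<in> system_ideal a \<Longrightarrow> G \<in> system_ideal a \<Longrightarrow> F - G \<in> system_ideal a"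
  using system_ideal.add[of F a "scal (-1) G"] ideal_scal[of G a "-1"] by (simp add: scal_m1)

lemma ideal_zero [simp]: "0 \<in> system_ideal a"
proof -
  have "J 1 {Theta1, Nu2} \<in> system a" by (simp add: system_eq)
  from ideal_diff[OF system_ideal.equation[OF this] system_ideal.equation[OF this]] show ?thesis by simp
qed

lemma ideal_sum: "(\<And>i. i \<in> A \<Longrightarrow> F i \<in> system_ideal a) \<Longrightarrow> (\<Sum>i\<in>A. F i) \<in> system_ideal a"
  by (induction A rule: infinite_finite_induct) (simp_all add: system_ideal.add)

lemma ideal_mult_M: "fun_on_M g \<Longrightarrow> F \<in> system_ideal a \<Longrightarrow> g \<otimes> F \<in> system_ideal a"
  by (simp add: system_ideal.mult fun_on_M_superfun)

text \<open>By \<open>left_span\<close> and the Leibniz rule, a field is tested on the equations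
  alone: where it hits the multiplier, the equation remains as a factor.\<close>

lemma ideal_vf_apply:
  assumes V: "hom_vf p V" and L: "\<And>L. L \<in> equations a \<Longrightarrow> vf_apply V L \<in> system_ideal a"
    and F: "F \<in> system_ideal a"
  shows "vf_apply V F \<in> system_ideal a"
  using system_ideal_left_span[OF F]
proof (induction rule: left_span.induct)
  case (mult G L)
  have "superfun (vf_apply V G)"
    using hom_vfD(2)[OF V] mult(1) by (rule superfun_vf_apply)
  then show ?case
    using mult by (simp add: vf_apply_sprod[OF V] equations_superfun system_ideal.add
        system_ideal.mult equations_ideal L superfun_tw)
next
  case (add F G)
  then show ?case by (simp add: vf_apply_add left_span_superfun system_ideal.add)
qed

text \<open>Restriction to h = 0: the values of even jets are zero at the point, and the condition
  on \<open>K\<close> excludes monomials with odd jets.\<close>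

lemma jet_linear_zero_section:
  assumes "L \<in> jet_linear" "K \<subseteq> range Oc" "\<And>m I. z (Jet m I) = 0"
  shows "L K z = 0"
  using assms(1,2)
proof (induction arbitrary: K rule: jet_linear.induct)
  case (jet g m I)
  have "J m I M z = 0" if "M \<subseteq> range Oc" for M
    using that assms(3) by (auto simp: coord_fun_def)
  moreover have "K - M \<subseteq> range Oc" for M using jet by blast
  ultimately show ?case by (simp add: sprod_def)
qed (simp_all add: pointwise)

lemma left_span_zero_section:
  assumes "F \<in> left_span a" "K \<subseteq> range Oc" "\<And>m I. z (Jet m I) = 0"
  shows "F K z = 0"
  using assms(1,2)
proof (induction arbitrary: K rule: left_span.induct)
  case (mult G L)
  have "L M z = 0" if "M \<subseteq> range Oc" for M
    by (rule jet_linear_zero_section) (use equations_linear[OF mult(2)] that assms(3) in simp_all)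
  moreover have "K - M \<subseteq> range Oc" for M using mult by blast
  ultimately show ?case by (simp add: sprod_def)
qed (simp add: pointwise)

lemma ideal_M_zero:
  assumes F: "F \<in> system_ideal a" and M: "fun_on_M F"
  shows "F = 0"
proof (rule cf_ext[OF M])
  fix I y
  \<comment> \<open>A function on M does not notice the change to a point whose jet values are zero,
    and there every element of the ideal vanishes.\<close>
  have "F (Oc ` I) (\<lambda>_. y) = F (Oc ` I) (\<lambda>c. if c = Yc then y else 0)"
    by (rule superfun_inD(2)[OF M[unfolded fun_on_M_def]]) (auto simp: base_def)
  also have "\<dots> = 0"
    by (rule left_span_zero_section[OF system_ideal_left_span[OF F]]) auto
  finally show "cf F I y = cf 0 I y" by (simp add: cf_def pointwise)
qed simp


section \<open>Linearised solutions\<close>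

lemma prolong_vertical_jet:
  assumes s: "fun_on_M s" "hom q s"
  shows "vf_apply (prolong (vertical s)) (J m I) = scal (sg (q \<and> odd (card I))) (D_multi m I s)"
  unfolding prolong_coord[OF admissible_vertical[OF s]] prolong_jet[OF admissible_vertical[OF s]]
  by (simp add: characteristic_def)

lemma D_multi_M: "fun_on_M s \<Longrightarrow> fun_on_M (D_multi m I s)"
proof -
  assume s: "fun_on_M s"
  have 1: "fun_on_M (D b f)" if "fun_on_M f" "b \<in> base" for b f using that by (simp add: D_M)
  then have "fun_on_M ((D Yc ^^ m) f)" if "fun_on_M f" for f
    using that by (induction m) auto
  then show ?thesis using s 1 by (simp add: D_multi_def)
qed

lemma vertical_linear_M:
  assumes s: "fun_on_M s" "hom q s"
  shows "L \<in> jet_linear \<Longrightarrow> fun_on_M (vf_apply (prolong (vertical s)) L)"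
proof (induction rule: jet_linear.induct)
  case (jet g m I)
  then show ?case
    using s by (simp add: vf_apply_sprod[OF hom_vf_prolong[OF admissible_vertical[OF s]]] fun_on_M_superfun
        prolong_vertical_jet[OF s] vertical_M[OF s] D_multi_M)
qed (simp_all add: vf_apply_add jet_linear_superfun)

lemma vertical_D:
  assumes s: "fun_on_M s" "hom q s" and b: "b \<in> base" and F: "F \<in> jet_affine"
  shows "vf_apply (prolong (vertical s)) (D b F) = scal (sg (q \<and> is_odd b)) (D b (vf_apply (prolong (vertical s)) F))"
  unfolding prolong_D[OF admissible_vertical[OF s] b F] by simp

definition solution :: "complex \<Rightarrow> bool \<Rightarrow> superfun \<Rightarrow> bool" where
  "solution a q s \<longleftrightarrow> fun_on_M s \<and> hom q s \<and> (\<forall>E\<in>system a. vf_apply (prolong (vertical s)) E = 0)"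

lemma solution_equations:
  assumes s: "solution a q s" and L: "L \<in> equations a"
  shows "vf_apply (prolong (vertical s)) L = 0"
  using L
proof (induction rule: equations.induct)
  case (base E)
  then show ?case using s by (simp add: solution_def)
next
  case (total L b)
  have "fun_on_M s" "hom q s" using s by (simp_all add: solution_def)
  from vertical_D[OF this total(2) jet_linear_affine[OF equations_linear[OF total(1)]]] total
  show ?case by simp
qed

lemma solution_ideal:
  assumes s: "solution a q s" and F: "F \<in> system_ideal a"
  shows "vf_apply (prolong (vertical s)) F \<in> system_ideal a"
proof -
  have "admissible q (vertical s)" using s by (simp add: solution_def admissible_vertical)
  from ideal_vf_apply[OF hom_vf_prolong[OF this] _ F] show ?thesis
    by (simp add: solution_equations[OF s])
qed

text \<open>The system applied to s, up to a common sign and to the reordering of its factors.\<close>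

lemma vertical_system:
  assumes s: "fun_on_M s" "hom q s"
  shows "(\<forall>E\<in>system a. vf_apply (prolong (vertical s)) E = 0) \<longleftrightarrow>
    scal (a + 1) (D_multi 2 {} s) + scal 2 (D_multi 0 {Theta1, Theta2, Nu1, Nu2} s) = 0 \<and>
    D_multi 1 {Theta1, Nu2} s = 0 \<and> D_multi 1 {Theta2, Nu1} s = 0 \<and>
    D_multi 1 {Theta1, Theta2} s = 0 \<and> D_multi 1 {Nu1, Nu2} s = 0 \<and>
    D_multi 1 {Theta1, Nu1} s - D_multi 1 {Theta2, Nu2} s = 0 \<and>
    scal (a + 1) (D_multi 1 {Nu1} s) + D_multi 0 {Theta2, Nu1, Nu2} s = 0 \<and>
    scal (a + 1) (D_multi 1 {Nu2} s) - D_multi 0 {Theta1, Nu1, Nu2} s = 0 \<and>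
    coord_fun (Oc Nu1) \<otimes> (scal a (D_multi 1 {Theta1} s) + D_multi 0 {Theta1, Theta2, Nu2} s) = 0 \<and>
    coord_fun (Oc Nu2) \<otimes> (scal a (D_multi 1 {Theta2} s) - D_multi 0 {Theta1, Theta2, Nu1} s) = 0"
proof -
  have nz: "scal (sg q) F = 0 \<longleftrightarrow> F = 0" for F
    by (metis scal_one scal_scal scal_zero(1) sg_simps(3))
  have pull: "scal c (scal (sg q) F) + scal (sg q) G = scal (sg q) (scal c F + G)"
    "scal c (scal (sg q) F) - scal (sg q) G = scal (sg q) (scal c F - G)" for c F G
    by (simp_all add: scal_add scal_diff mult.commute)
  note W = vf_apply_sprod[OF hom_vf_prolong[OF admissible_vertical[OF s]]]
  have nu: "vf_apply (prolong (vertical s)) (coord_fun (Oc i) \<otimes> F) =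
      scal (sg q) (coord_fun (Oc i) \<otimes> vf_apply (prolong (vertical s)) F)" if "superfun F" for i F
    using that vertical_M[OF s, of "coord_fun (Oc i)"] tw_hom[OF hom_coord[of "Oc i"], of q]
    by (simp add: W sprod_scal_left)
  show ?thesis
    unfolding system_eq ball_simps
    by (simp add: vf_apply_add vf_apply_diff vf_apply_scal superfun_scal superfun_add superfun_diff
        prolong_vertical_jet[OF s] nu pull nz sprod_scal_right del: scal_scal)
qed

text \<open>Only whether the factor \<open>e\<close> vanishes is recorded: it is zero exactly when
  an odd derivative meets a coefficient position containing the same variable.\<close>

lemma cf_D_multi:
  assumes f: "fun_on_M f"
  shows "\<exists>e. (e \<noteq> 0 \<longleftrightarrow> I \<inter> K = {}) \<and> (\<forall>y. cf (D_multi m I f) K y = e * cf ((pd Yc ^^ m) f) (I \<union> K) y)"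
proof -
  have M: "fun_on_M ((pd Yc ^^ m) f)" for m by (induction m) (simp_all add: f)
  have pow: "(D Yc ^^ m) f = (pd Yc ^^ m) f" for m
    by (induction m) (simp_all add: D_M M)
  have "finite I" by simp
  then show ?thesis
  proof (induction I arbitrary: K rule: finite_induct)
    case empty
    have "cf (D_multi m {} f) K y = 1 * cf ((pd Yc ^^ m) f) ({} \<union> K) y" for y
      by (simp add: D_multi_odd D_odd_def pow)
    then show ?case by (intro exI[of _ 1]) auto
  next
    case (insert i I)
    have "scal (eps i I) (D_multi m (insert i I) f) = pd (Oc i) (D_multi m I f)"
      using D_multi_insert[OF jet_affine.base[OF f], of i m I] insert(2) D_M[OF Oc_base D_multi_M[OF f]]
      by simp
    then have "scal (eps i I) (scal (eps i I) (D_multi m (insert i I) f)) = scal (eps i I) (pd (Oc i) (D_multi m I f))"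
      by simp
    then have d: "D_multi m (insert i I) f = scal (eps i I) (pd (Oc i) (D_multi m I f))" by simp
    show ?case
    proof (cases "i \<in> K")
      case True
      then show ?thesis by (intro exI[of _ 0]) (simp add: d cf_scal cf_pd_Oc)
    next
      case False
      from insert(3)[of "insert i K"] obtain e where
        e: "(e \<noteq> 0) = (I \<inter> insert i K = {})"
          "\<And>y. cf (D_multi m I f) (insert i K) y = e * cf ((pd Yc ^^ m) f) (I \<union> insert i K) y" by blast
      have "eps i I \<noteq> 0" "eps i K \<noteq> 0" by (metis eps_sq mult_zero_left zero_neq_one)+
      then show ?thesis
        using False e insert(2)
        by (intro exI[of _ "eps i I * eps i K * e"]) (auto simp: d cf_scal cf_pd_Oc)
    qed
  qed
qed

lemma pow_dy_gen: "(pd Yc ^^ m) (gen a u) = gen a ((gen_dy ^^ m) u)"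
  by (induction m) (simp_all add: dy_gen)

lemma D_multi_gen_zero:
  assumes "\<And>L y. I \<subseteq> L \<Longrightarrow> gen_coeff a ((gen_dy ^^ m) u) L y = 0"
  shows "D_multi m I (gen a u) = 0"
proof (rule cf_ext[OF D_multi_M[OF gen_M]])
  fix K y
  from cf_D_multi[OF gen_M, of I K m a u] assms[of "I \<union> K" y]
  show "cf (D_multi m I (gen a u)) K y = cf 0 K y"
    by (auto simp: cf_zero cf_gen pow_dy_gen)
qed simp

lemma D_multi_gen_const:
  assumes "\<And>L y. I \<subseteq> L \<Longrightarrow> gen_coeff a ((gen_dy ^^ m) u) L y = (if L = I then k else 0)" "k \<noteq> 0"
  shows "\<exists>c. c \<noteq> 0 \<and> D_multi m I (gen a u) = scal c one_sf"
proof -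
  obtain e where e: "e \<noteq> 0" "\<And>y. cf (D_multi m I (gen a u)) {} y = e * gen_coeff a ((gen_dy ^^ m) u) I y"
    using cf_D_multi[OF gen_M, of I "{}" m a u] by (auto simp: cf_gen pow_dy_gen)
  have "D_multi m I (gen a u) = scal (e * k) one_sf"
  proof (rule cf_ext[OF D_multi_M[OF gen_M]])
    fix K y
    show "cf (D_multi m I (gen a u)) K y = cf (scal (e * k) one_sf) K y"
    proof (cases "K = {}")
      case True
      then show ?thesis using e(2) assms(1)[of I] by (simp add: cf_scal cf_one)
    next
      case False
      obtain e where e: "(e \<noteq> 0) = (I \<inter> K = {})"
        "cf (D_multi m I (gen a u)) K y = e * gen_coeff a ((gen_dy ^^ m) u) (I \<union> K) y"
        using cf_D_multi[OF gen_M, of I K m a u] by (auto simp: cf_gen pow_dy_gen)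
      have "I \<union> K \<noteq> I" if "I \<inter> K = {}" using False that by auto
      then have "cf (D_multi m I (gen a u)) K y = 0"
        using e assms(1)[of "I \<union> K" y] by (cases "I \<inter> K = {}") simp_all
      then show ?thesis using False by (simp add: cf_scal cf_one)
    qed
  qed simp
  then show ?thesis using e(1) assms(2) by (intro exI[of _ "e * k"]) simp
qed

text \<open>On M total derivatives are partial ones, and with the y-derivatives innermost the
  coefficients evaluate by \<open>dy_gen\<close> followed by \<open>cf_pd_Oc\<close>.\<close>

lemma D_multi_expand:
  assumes "fun_on_M f"
  shows "D_multi m I f = (let d = (\<lambda>i g. if i \<in> I then pd (Oc i) g else g)
    in d Theta1 (d Theta2 (d Nu1 (d Nu2 ((pd Yc ^^ m) f)))))"
proof -
  have M: "fun_on_M ((pd Yc ^^ m) f)" for m by (induction m) (simp_all add: assms)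
  have pow: "(D Yc ^^ m) f = (pd Yc ^^ m) f" for m
    by (induction m) (simp_all add: D_M M)
  have "D_multi m I f = D_odd I ((D Yc ^^ m) f)"
  proof -
    have fa: "f \<in> jet_affine" using assms by (rule jet_affine.base)
    show ?thesis
      unfolding D_multi_odd D_odd_def by (simp add: D_Oc_Yc_pow D_affine fa)
  qed
  then show ?thesis
    unfolding pow D_odd_def Let_def by (simp add: D_M M)
qed

lemma gen_solution:
  assumes h: "hom q (gen a u)"
  shows "solution a q (gen a u)"
  unfolding solution_def
proof (intro conjI)
  obtain x1 h1 y1 x2 h2 y2 x3 h3 y3 w where u: "u = (((x1, h1, y1), (x2, h2, y2), (x3, h3, y3)), w)"
    by (metis prod.exhaust)
  have z: "f = 0" if "fun_on_M f" "\<And>I y. cf f I y = 0" for f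
    using cf_ext[OF that(1), of 0] that(2) by (simp add: cf_zero)
  show "\<forall>E\<in>system a. vf_apply (prolong (vertical (gen a u))) E = 0"
    unfolding vertical_system[OF gen_M h]
    by (intro conjI; rule z, simp add: D_multi_M,
        rule_tac P = "\<lambda>I. cf _ I _ = 0" in odd_var_set_cases;
        simp add: D_multi_expand Let_def numeral_2_eq_2 dy_gen u cf_add cf_diff cf_scal cf_coord_sprod
          cf_pd_Oc cf_gen eps_eval insert_Diff_if algebra_simps)
qed (simp_all add: h)

section \<open>Normal forms modulo the ideal\<close>

text \<open>The jets that are free coordinates on the infinitely prolonged system.\<close>

definition free :: "(nat \<times> odd_var set) set" where
  "free = {(0, {}), (1, {}), (2, {}), (0, {Theta1}), (0, {Theta2}), (0, {Nu1}), (0, {Nu2}), (1,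
     {Theta1}), (1, {Theta2}), (1, {Nu1}), (1, {Nu2}), (0, {Theta1, Theta2}), (0, {Theta1,
     Nu1}), (0, {Theta1, Nu2}), (0, {Theta2, Nu1}), (0, {Theta2, Nu2}), (0, {Nu1, Nu2})}"

lemma finite_free: "finite free" by (simp add: free_def)

definition reducible :: "complex \<Rightarrow> superfun \<Rightarrow> bool" where
  "reducible a L \<longleftrightarrow> (\<exists>g. (\<forall>\<alpha>. fun_on_M (g \<alpha>)) \<and>
     L - (\<Sum>\<alpha>\<in>free. g \<alpha> \<otimes> J (fst \<alpha>) (snd \<alpha>)) \<in> system_ideal a)"

lemma reducible_ideal: "L \<in> system_ideal a \<Longrightarrow> reducible a L"
  unfolding reducible_def by (intro exI[of _ "\<lambda>_. 0"]) simp

lemma reducible_free: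
  assumes "(m, I) \<in> free"
  shows "reducible a (J m I)"
proof -
  have "(\<Sum>\<alpha>\<in>free. (if \<alpha> = (m, I) then one_sf else 0) \<otimes> J (fst \<alpha>) (snd \<alpha>)) =
      (\<Sum>\<alpha>\<in>free. if \<alpha> = (m, I) then J m I else 0)"
    by (intro sum.cong refl) (auto simp: one_sprod_superfun)
  also have "\<dots> = J m I" using assms finite_free by simp
  finally show ?thesis
    unfolding reducible_def by (intro exI[of _ "\<lambda>\<alpha>. if \<alpha> = (m, I) then one_sf else 0"]) simp
qed

lemma reducible_add:
  assumes "reducible a F" "reducible a G"
  shows "reducible a (F + G)"
proof -
  from assms obtain f g where f: "\<forall>\<alpha>. fun_on_M (f \<alpha>)" "F - (\<Sum>\<alpha>\<in>free. f \<alpha> \<otimes> J (fst \<alpha>) (snd \<alpha>)) \<in> system_ideal a"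
    and g: "\<forall>\<alpha>. fun_on_M (g \<alpha>)" "G - (\<Sum>\<alpha>\<in>free. g \<alpha> \<otimes> J (fst \<alpha>) (snd \<alpha>)) \<in> system_ideal a"
    unfolding reducible_def by blast
  have "F + G - (\<Sum>\<alpha>\<in>free. (f \<alpha> + g \<alpha>) \<otimes> J (fst \<alpha>) (snd \<alpha>)) =
      (F - (\<Sum>\<alpha>\<in>free. f \<alpha> \<otimes> J (fst \<alpha>) (snd \<alpha>))) + (G - (\<Sum>\<alpha>\<in>free. g \<alpha> \<otimes> J (fst \<alpha>) (snd \<alpha>)))"
    by (simp add: sprod_add_left sum.distrib algebra_simps)
  with system_ideal.add[OF f(2) g(2)]
  have "F + G - (\<Sum>\<alpha>\<in>free. (f \<alpha> + g \<alpha>) \<otimes> J (fst \<alpha>) (snd \<alpha>)) \<in> system_ideal a"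
    by (simp only:)
  moreover have "\<forall>\<alpha>. fun_on_M (f \<alpha> + g \<alpha>)" using f(1) g(1) by blast
  ultimately show ?thesis
    unfolding reducible_def by (intro exI[of _ "\<lambda>\<alpha>. f \<alpha> + g \<alpha>"] conjI)
qed

lemma reducible_mult:
  assumes "reducible a F" "fun_on_M h"
  shows "reducible a (h \<otimes> F)"
proof -
  from assms obtain f where f: "\<forall>\<alpha>. fun_on_M (f \<alpha>)" "F - (\<Sum>\<alpha>\<in>free. f \<alpha> \<otimes> J (fst \<alpha>) (snd \<alpha>)) \<in> system_ideal a"
    unfolding reducible_def by blast
  have "h \<otimes> F - (\<Sum>\<alpha>\<in>free. (h \<otimes> f \<alpha>) \<otimes> J (fst \<alpha>) (snd \<alpha>)) =
      h \<otimes> (F - (\<Sum>\<alpha>\<in>free. f \<alpha> \<otimes> J (fst \<alpha>) (snd \<alpha>)))"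
    by (simp add: sprod_diff_right sprod_sum_right sprod_assoc)
  then show ?thesis
    unfolding reducible_def using f ideal_mult_M[OF assms(2) f(2)] assms(2)
    by (intro exI[of _ "\<lambda>\<alpha>. h \<otimes> f \<alpha>"]) simp
qed

lemma reducible_scal: "reducible a F \<Longrightarrow> superfun F \<Longrightarrow> reducible a (scal c F)"
  using reducible_mult[of a F "scal c one_sf"] by (simp add: sprod_scal_left one_sprod_superfun)

lemma reducible_cong:
  assumes "L - R \<in> system_ideal a" "reducible a R"
  shows "reducible a L"
  using reducible_add[OF reducible_ideal[OF assms(1)] assms(2)] by simp

lemma scal_eq_zero: "scal k F = 0 \<Longrightarrow> k \<noteq> 0 \<Longrightarrow> F = 0"
  by (simp add: scal_def fun_eq_iff pointwise)

lemma ideal_unscal: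
  assumes "scal c F \<in> system_ideal a" "c \<noteq> 0"
  shows "F \<in> system_ideal a"
  using ideal_scal[OF assms(1), of "inverse c"] assms(2) by simp

lemma ideal_jet_insert:
  assumes "J m I \<in> system_ideal a"
  shows "J m (insert i I) \<in> system_ideal a"
proof (cases "i \<in> I")
  case False
  then have "scal (eps i I) (J m (insert i I)) \<in> system_ideal a"
    using system_ideal.total[OF assms, of "Oc i"] by simp
  from ideal_scal[OF this, of "eps i I"] show ?thesis by simp
qed (use assms in \<open>simp add: insert_absorb\<close>)

lemma ideal_jet_mono:
  assumes "J m I \<in> system_ideal a" "m \<le> m'" "I \<subseteq> I'"
  shows "J m' I' \<in> system_ideal a"
proof -
  have "finite K \<Longrightarrow> J m (I \<union> K) \<in> system_ideal a" for K
    by (induction K rule: finite_induct) (simp_all add: assms(1) ideal_jet_insert)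
  from this[of I'] have "J m I' \<in> system_ideal a" using assms(3) by (simp add: Un_absorb1)
  with assms(2) show ?thesis
  proof (induction rule: dec_induct)
    case (step n)
    then show ?case using system_ideal.total[of "J n I'" a Yc] by simp
  qed
qed

text \<open>The jets of order 1 in y with a mixed pair other than \<open>Theta1, Nu1\<close> or
  \<open>Theta2, Nu2\<close> lie in the ideal. This bounds the order in y, and the rest is solved
  for by the equations and their first odd derivatives, dividing by \<open>a + 1\<close>.\<close>

lemma reducible_jet:
  assumes a: "a \<noteq> -1"
  shows "reducible a (J m I)"
proof -
  let ?A = "{Theta1, Theta2, Nu1, Nu2}"
  have a1: "a + 1 \<noteq> 0" using a by (metis add_eq_0_iff add.commute)
  note eq = system_ideal.equation[where a = a, unfolded system_eq]
  have bad: "J 1 {Theta1, Nu2} \<in> system_ideal a" "J 1 {Theta2, Nu1} \<in> system_ideal a"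
    "J 1 {Theta1, Theta2} \<in> system_ideal a" "J 1 {Nu1, Nu2} \<in> system_ideal a"
    by (rule eq; simp)+
  define e1 where "e1 = scal (a + 1) (J 2 {}) + scal 2 (J 0 ?A)"
  have e1: "e1 \<in> system_ideal a" unfolding e1_def by (rule eq) simp
  \<comment> \<open>The y-derivative of \<open>e1\<close> contains the quartic jet of order 1 in y,
    which is a derivative of one of the jets in \<open>bad\<close>.\<close>
  have J3: "J 3 {} \<in> system_ideal a"
  proof -
    have "D Yc e1 = scal (a + 1) (J 3 {}) + scal 2 (J 1 ?A)"
      by (simp add: e1_def D_add D_scal superfun_scal eval_nat_numeral)
    moreover have "J 1 ?A \<in> system_ideal a" by (rule ideal_jet_mono[OF bad(1)]) simp_all
    ultimately have "scal (a + 1) (J 3 {}) \<in> system_ideal a"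
      using ideal_diff[OF system_ideal.total[OF e1 Yc_base] ideal_scal[of "J 1 ?A" a 2]] by simp
    then show ?thesis using ideal_unscal a1 by blast
  qed
  \<comment> \<open>Any odd derivative kills the quartic jet and leaves a non-zero multiple of
    \<open>J 2 {i}\<close>.\<close>
  have J2: "J 2 {i} \<in> system_ideal a" for i
  proof -
    have "i \<in> ?A" by (cases i) simp_all
    then have "D (Oc i) e1 = scal ((a + 1) * eps i {}) (J 2 {i})"
      by (simp add: e1_def D_add D_scal superfun_scal del: insert_iff)
    moreover have "(a + 1) * eps i {} \<noteq> 0" using a1 by (simp add: eps_def)
    ultimately show ?thesis using system_ideal.total[OF e1 Oc_base[of i]] ideal_unscal by metis
  qed
  have JA: "reducible a (J 0 ?A)"
  proof (rule reducible_cong)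
    have "J 0 ?A - scal (- (a + 1) / 2) (J 2 {}) = scal (1 / 2) e1"
      by (simp add: e1_def scal_add scal_def fun_eq_iff pointwise field_simps)
    then show "J 0 ?A - scal (- (a + 1) / 2) (J 2 {}) \<in> system_ideal a"
      using ideal_scal[OF e1] by simp
    show "reducible a (scal (- (a + 1) / 2) (J 2 {}))"
      by (intro reducible_scal reducible_free) (simp_all add: free_def)
  qed
  have J1free: "reducible a (J 1 {i})" "reducible a (J 0 {i})" for i
    by (intro reducible_free; cases i; simp add: free_def)+
  define e7 where "e7 = scal (a + 1) (J 1 {Nu1}) + J 0 {Theta2, Nu1, Nu2}"
  have e7: "e7 \<in> system_ideal a" unfolding e7_def by (rule eq) simp
  \<comment> \<open>The derivative of \<open>e7\<close> along \<open>Theta1\<close> completes its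
    cubic jet to the quartic one, already reduced in \<open>JA\<close>.\<close>
  have T1N1: "reducible a (J 1 {Theta1, Nu1})"
  proof (rule reducible_cong)
    have "D (Oc Theta1) e7 = scal (a + 1) (J 1 {Theta1, Nu1}) + J 0 ?A"
      by (simp add: e7_def D_add D_scal superfun_scal eps_eval)
    then have "J 1 {Theta1, Nu1} - scal (- 1 / (a + 1)) (J 0 ?A) = scal (1 / (a + 1)) (D (Oc Theta1) e7)"
      using a1 by (simp add: scal_add scal_def fun_eq_iff pointwise field_simps)
    then show "J 1 {Theta1, Nu1} - scal (- 1 / (a + 1)) (J 0 ?A) \<in> system_ideal a"
      using ideal_scal[OF system_ideal.total[OF e7 Oc_base]] by simp
    show "reducible a (scal (- 1 / (a + 1)) (J 0 ?A))" by (rule reducible_scal[OF JA]) simp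
  qed
  have T2N2: "reducible a (J 1 {Theta2, Nu2})"
  proof (rule reducible_cong[OF _ T1N1])
    have "J 1 {Theta1, Nu1} - J 1 {Theta2, Nu2} \<in> system_ideal a" by (rule eq) simp
    from ideal_scal[OF this, of "-1"] show "J 1 {Theta2, Nu2} - J 1 {Theta1, Nu1} \<in> system_ideal a"
      by (simp add: scal_m1)
  qed
  have T2N1N2: "reducible a (J 0 {Theta2, Nu1, Nu2})"
  proof (rule reducible_cong)
    show "J 0 {Theta2, Nu1, Nu2} - scal (- (a + 1)) (J 1 {Nu1}) \<in> system_ideal a"
      using e7 unfolding e7_def scal_m1 by (simp add: add.commute)
    show "reducible a (scal (- (a + 1)) (J 1 {Nu1}))" by (rule reducible_scal[OF J1free(1)]) simp
  qed
  have T1N1N2: "reducible a (J 0 {Theta1, Nu1, Nu2})"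
  proof (rule reducible_cong)
    have "scal (a + 1) (J 1 {Nu2}) - J 0 {Theta1, Nu1, Nu2} \<in> system_ideal a" by (rule eq) simp
    from ideal_scal[OF this, of "-1"]
    show "J 0 {Theta1, Nu1, Nu2} - scal (a + 1) (J 1 {Nu2}) \<in> system_ideal a"
      unfolding scal_m1 by simp
    show "reducible a (scal (a + 1) (J 1 {Nu2}))" by (rule reducible_scal[OF J1free(1)]) simp
  qed
  \<comment> \<open>Differentiating \<open>\<nu> P\<close> along \<open>\<nu>\<close> expresses P through its \<open>\<nu>\<close>-derivative.\<close>
  have factor: "reducible a P"
    if "coord_fun (Oc i) \<otimes> P \<in> system_ideal a" "superfun P" "reducible a (D (Oc i) P)" for i P
  proof (rule reducible_cong)
    have "D (Oc i) (coord_fun (Oc i) \<otimes> P) = P - coord_fun (Oc i) \<otimes> D (Oc i) P"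
      using that(2) hom_parity[OF hom_coord[of "Oc i"]]
      by (simp add: D_sprod D_coord one_sprod_superfun scal_m1 sprod_minus_left)
    then show "P - coord_fun (Oc i) \<otimes> D (Oc i) P \<in> system_ideal a"
      using system_ideal.total[OF that(1) Oc_base[of i]] by simp
    show "reducible a (coord_fun (Oc i) \<otimes> D (Oc i) P)" by (rule reducible_mult[OF that(3)]) simp
  qed
  have T1T2N2: "reducible a (J 0 {Theta1, Theta2, Nu2})"
  proof -
    let ?P = "scal a (J 1 {Theta1}) + J 0 {Theta1, Theta2, Nu2}"
    have "reducible a ?P"
    proof (rule factor[of Nu1])
      show "coord_fun (Oc Nu1) \<otimes> ?P \<in> system_ideal a" by (rule eq) simp
      have "D (Oc Nu1) ?P = scal (- a) (J 1 {Theta1, Nu1}) + J 0 ?A"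
        by (simp add: D_add D_scal superfun_scal eps_eval insert_commute)
      then show "reducible a (D (Oc Nu1) ?P)"
        by (simp add: reducible_add reducible_scal T1N1[simplified] JA)
    qed (simp add: superfun_add superfun_scal)
    moreover have "reducible a (scal (- a) (J 1 {Theta1}))" by (rule reducible_scal[OF J1free(1)]) simp
    ultimately have "reducible a (?P + scal (- a) (J 1 {Theta1}))" by (rule reducible_add)
    then show ?thesis by (simp add: scal_m1)
  qed
  have T1T2N1: "reducible a (J 0 {Theta1, Theta2, Nu1})"
  proof -
    let ?P = "scal a (J 1 {Theta2}) - J 0 {Theta1, Theta2, Nu1}"
    have "reducible a ?P"
    proof (rule factor[of Nu2])
      show "coord_fun (Oc Nu2) \<otimes> ?P \<in> system_ideal a" by (rule eq) simp
      have "D (Oc Nu2) ?P = scal (- a) (J 1 {Theta2, Nu2}) + J 0 ?A"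
        by (simp add: D_diff D_scal superfun_scal eps_eval insert_commute scal_m1 scal_minus)
      then show "reducible a (D (Oc Nu2) ?P)"
        by (simp add: reducible_add reducible_scal T2N2[simplified] JA)
    qed (simp add: superfun_diff superfun_scal)
    then have "reducible a (scal (-1) ?P)" by (rule reducible_scal) (simp add: superfun_diff superfun_scal)
    moreover have "reducible a (scal a (J 1 {Theta2}))" by (rule reducible_scal[OF J1free(1)]) simp
    ultimately have "reducible a (scal (-1) ?P + scal a (J 1 {Theta2}))" by (rule reducible_add)
    then show ?thesis by (simp add: scal_m1)
  qed
  have f: "reducible a (J m I)" if "(m, I) \<in> free" for m I using that by (rule reducible_free)
  consider "m = 0" | "m = 1" | "m = 2" "I = {}" | i where "m \<ge> 2" "i \<in> I" | "m \<ge> 3" by fastforce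
  then show ?thesis
  proof cases
    case 1
    show ?thesis
      unfolding 1 by (rule odd_var_set_cases[where P = "\<lambda>I. reducible a (J 0 I)"])
        (rule JA T2N1N2 T1N1N2 T1T2N2 T1T2N1 | (rule f, simp add: free_def))+
  next
    case 2
    \<comment> \<open>The four listed pairs are all pairs except \<open>Theta1, Nu1\<close> and
      \<open>Theta2, Nu2\<close>, so every set of three or four variables contains one of
      them.\<close>
    have b: "reducible a (J 1 I)"
      if "{Theta1, Nu2} \<subseteq> I \<or> {Theta2, Nu1} \<subseteq> I \<or> {Theta1, Theta2} \<subseteq> I \<or> {Nu1, Nu2} \<subseteq> I" for I
      using that ideal_jet_mono[OF _ le_refl] bad reducible_ideal by metis
    show ?thesis
      unfolding 2 by (rule odd_var_set_cases[where P = "\<lambda>I. reducible a (J 1 I)"])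
        (rule T1N1 T2N2 | (rule f, force simp: free_def) | (rule b, force))+
  next
    case 3
    then show ?thesis by (intro f) (simp add: free_def)
  next
    case (4 i)
    then show ?thesis using ideal_jet_mono[OF J2[of i], of m I] reducible_ideal by simp
  next
    case 5
    then show ?thesis using ideal_jet_mono[OF J3, of m I] reducible_ideal by simp
  qed
qed

lemma reducible_linear:
  assumes "a \<noteq> -1"
  shows "L \<in> jet_linear \<Longrightarrow> reducible a L"
  by (induction rule: jet_linear.induct)
    (simp_all add: reducible_ideal reducible_add reducible_mult reducible_jet[OF assms])

lemma all_sets:
  "(\<forall>I. P I) \<longleftrightarrow> P {} \<and> P {Theta1} \<and> P {Theta2} \<and> P {Nu1} \<and> P {Nu2} \<and>
    P {Theta1, Theta2} \<and> P {Theta1, Nu1} \<and> P {Theta1, Nu2} \<and> P {Theta2, Nu1} \<and> P {Theta2, Nu2} \<and>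
    P {Nu1, Nu2} \<and> P {Theta1, Theta2, Nu1} \<and> P {Theta1, Theta2, Nu2} \<and> P {Theta1, Nu1, Nu2} \<and>
    P {Theta2, Nu1, Nu2} \<and> P {Theta1, Theta2, Nu1, Nu2}"
  by (rule iffI, blast, rule allI, rule odd_var_set_cases) blast+

text \<open>Solutions are homogeneous for the grading with y of degree 2 and the odd coordinates of degree
  1, so the matrix of free jets of solutions is triangular with constant diagonal.\<close>

definition witness :: "complex \<Rightarrow> nat \<times> odd_var set \<Rightarrow> bool" where
  "witness a \<alpha> \<longleftrightarrow> (\<exists>q u. hom q (gen a u) \<and>
    (\<exists>c. c \<noteq> 0 \<and> D_multi (fst \<alpha>) (snd \<alpha>) (gen a u) = scal c one_sf) \<and>
    (\<forall>\<beta>\<in>free. \<beta> \<noteq> \<alpha> \<and> 2 * fst \<alpha> + card (snd \<alpha>) \<le> 2 * fst \<beta> + card (snd \<beta>) \<longrightarrow>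
      D_multi (fst \<beta>) (snd \<beta>) (gen a u) = 0))"

text \<open>Reduces the witness conditions to vanishing or constancy of polynomial coefficients at
  finitely many sets.\<close>

lemma witnessI:
  assumes "hom q (gen a u)" "k \<noteq> 0"
    and "\<forall>L. I \<subseteq> L \<longrightarrow> (\<forall>y. gen_coeff a ((gen_dy ^^ m) u) L y = (if L = I then k else 0))"
    and "\<forall>(n, K)\<in>free. (n, K) \<noteq> (m, I) \<and> 2 * m + card I \<le> 2 * n + card K \<longrightarrow>
      (\<forall>L. K \<subseteq> L \<longrightarrow> (\<forall>y. gen_coeff a ((gen_dy ^^ n) u) L y = 0))"
  shows "witness a (m, I)"
  unfolding witness_def
proof (intro exI[of _ q] exI[of _ u] conjI ballI impI)
  show "\<exists>c. c \<noteq> 0 \<and> D_multi (fst (m, I)) (snd (m, I)) (gen a u) = scal c one_sf"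
    using D_multi_gen_const[of I a m u k] assms(2,3) by simp
next
  fix \<beta> assume "\<beta> \<in> free" "\<beta> \<noteq> (m, I) \<and> 2 * fst (m, I) + card (snd (m, I)) \<le> 2 * fst \<beta> + card (snd \<beta>)"
  then show "D_multi (fst \<beta>) (snd \<beta>) (gen a u) = 0"
    using assms(4) by (intro D_multi_gen_zero) (cases \<beta>; fastforce)
qed (rule assms(1))

lemma free_witness:
  assumes "\<alpha> \<in> free"
  shows "witness a \<alpha>"
proof -
  note gen_eval = gen_coeff.simps gen_dy.simps zero_prod_def zero_fun_apply numeral_2_eq_2
  have "witness a (0, {})"
    by (rule witnessI[where u = "(((0, 0, 0), (1, 0, 0), (0, 0, 0)), 0)" and k = "1"])
      (rule hom_gen, simp, (simp add: free_def all_sets odd_var_set_eq gen_eval)+)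
  \<comment> \<open>The choice \<open>h1 = h2\<close> with \<open>h3 = 0\<close> removes the
    quadratic terms of the same weight and leaves \<open>-2 * y\<close>.\<close>
  moreover have "witness a (1, {})"
    by (rule witnessI[where u = "(((0, 1, 0), (0, 1, 0), (0, 0, 0)), 0)" and k = "-2"])
      (rule hom_gen, simp, (simp add: free_def all_sets odd_var_set_eq gen_eval)+)
  moreover have "witness a (2, {})"
    by (rule witnessI[where u = "(((0, 0, 0), (0, 0, 1), (0, 0, 0)), 0)" and k = "-2"])
      (rule hom_gen, simp, (simp add: free_def all_sets odd_var_set_eq gen_eval)+)
  moreover have "witness a (0, {Theta1})"
    by (rule witnessI[where u = "(0, \<lambda>p q r. if p = Vx \<and> q = Vx \<and> r = Vx then 1 else 0)" and k = "1"])
      (rule hom_gen, simp, (simp add: free_def all_sets odd_var_set_eq gen_eval)+)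
  moreover have "witness a (0, {Theta2})"
    by (rule witnessI[where u = "(0, \<lambda>p q r. if p = Vx \<and> q = Vx \<and> r = Vy then 1 else 0)" and k = "-1"])
      (rule hom_gen, simp, (simp add: free_def all_sets odd_var_set_eq gen_eval)+)
  moreover have "witness a (0, {Nu1})"
    by (rule witnessI[where u = "(0, \<lambda>p q r. if p = Vy \<and> q = Vx \<and> r = Vy then 1 else 0)" and k = "-1"])
      (rule hom_gen, simp, (simp add: free_def all_sets odd_var_set_eq gen_eval)+)
  moreover have "witness a (0, {Nu2})"
    by (rule witnessI[where u = "(0, \<lambda>p q r. if p = Vy \<and> q = Vx \<and> r = Vx then 1 else 0)" and k = "-1"])
      (rule hom_gen, simp, (simp add: free_def all_sets odd_var_set_eq gen_eval)+)
  moreover have "witness a (1, {Theta1})"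
    by (rule witnessI[where u = "(0, \<lambda>p q r. if p = Vx \<and> q = Vy \<and> r = Vx then 1 else 0)" and k = "1"])
      (rule hom_gen, simp, (simp add: free_def all_sets odd_var_set_eq gen_eval)+)
  moreover have "witness a (1, {Theta2})"
    by (rule witnessI[where u = "(0, \<lambda>p q r. if p = Vx \<and> q = Vy \<and> r = Vy then 1 else 0)" and k = "-1"])
      (rule hom_gen, simp, (simp add: free_def all_sets odd_var_set_eq gen_eval)+)
  moreover have "witness a (1, {Nu1})"
    by (rule witnessI[where u = "(0, \<lambda>p q r. if p = Vy \<and> q = Vy \<and> r = Vy then 1 else 0)" and k = "-1"])
      (rule hom_gen, simp, (simp add: free_def all_sets odd_var_set_eq gen_eval)+)
  moreover have "witness a (1, {Nu2})"
    by (rule witnessI[where u = "(0, \<lambda>p q r. if p = Vy \<and> q = Vy \<and> r = Vx then 1 else 0)" and k = "-1"])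
      (rule hom_gen, simp, (simp add: free_def all_sets odd_var_set_eq gen_eval)+)
  moreover have "witness a (0, {Theta1, Theta2})"
    by (rule witnessI[where u = "(((1, 0, 0), (0, 0, 0), (0, 0, 0)), 0)" and k = "1"])
      (rule hom_gen, simp, (simp add: free_def all_sets odd_var_set_eq gen_eval)+)
  \<comment> \<open>With \<open>h2 = 0\<close> the two diagonal quadratic coefficients are
    \<open>- h1 - h3\<close> and \<open>- h1 + h3\<close>; the signs of \<open>h3\<close> here and
    for \<open>{Theta2, Nu2}\<close> isolate one of them at a time.\<close>
  moreover have "witness a (0, {Theta1, Nu1})"
    by (rule witnessI[where u = "(((0, 1, 0), (0, 0, 0), (0, 1, 0)), 0)" and k = "-2"])
      (rule hom_gen, simp, (simp add: free_def all_sets odd_var_set_eq gen_eval)+)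
  moreover have "witness a (0, {Theta1, Nu2})"
    by (rule witnessI[where u = "(((0, 0, 0), (0, 0, 0), (1, 0, 0)), 0)" and k = "1"])
      (rule hom_gen, simp, (simp add: free_def all_sets odd_var_set_eq gen_eval)+)
  moreover have "witness a (0, {Theta2, Nu1})"
    by (rule witnessI[where u = "(((0, 0, 0), (0, 0, 0), (0, 0, 1)), 0)" and k = "1"])
      (rule hom_gen, simp, (simp add: free_def all_sets odd_var_set_eq gen_eval)+)
  moreover have "witness a (0, {Theta2, Nu2})"
    by (rule witnessI[where u = "(((0, 1, 0), (0, 0, 0), (0, - 1, 0)), 0)" and k = "-2"])
      (rule hom_gen, simp, (simp add: free_def all_sets odd_var_set_eq gen_eval)+)
  moreover have "witness a (0, {Nu1, Nu2})"
    by (rule witnessI[where u = "(((0, 0, 1), (0, 0, 0), (0, 0, 0)), 0)" and k = "-1"])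
      (rule hom_gen, simp, (simp add: free_def all_sets odd_var_set_eq gen_eval)+)
  ultimately show ?thesis using assms unfolding free_def by blast
qed

text \<open>Induction on the weight \<open>2 * fst \<alpha> + card (snd \<alpha>)\<close>: tested on
  the witness of \<open>\<alpha>\<close>, terms of smaller weight vanish by induction and all other
  terms by choice of the witness, so a non-zero multiple of \<open>g \<alpha>\<close>
  remains.\<close>

lemma free_independent:
  assumes g: "\<And>\<alpha>. fun_on_M (g \<alpha>)"
    and zero: "\<And>q u. hom q (gen a u) \<Longrightarrow>
      vf_apply (prolong (vertical (gen a u))) (\<Sum>\<alpha>\<in>free. g \<alpha> \<otimes> J (fst \<alpha>) (snd \<alpha>)) = 0"
  shows "\<alpha> \<in> free \<Longrightarrow> g \<alpha> = 0"
proof (induction "2 * fst \<alpha> + card (snd \<alpha>)" arbitrary: \<alpha> rule: less_induct)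
  case less
  obtain q u c where u: "hom q (gen a u)" "c \<noteq> 0"
      "D_multi (fst \<alpha>) (snd \<alpha>) (gen a u) = scal c one_sf"
    and later: "\<And>\<beta>. \<beta> \<in> free \<Longrightarrow> \<beta> \<noteq> \<alpha> \<Longrightarrow> 2 * fst \<alpha> + card (snd \<alpha>) \<le> 2 * fst \<beta> + card (snd \<beta>) \<Longrightarrow>
      D_multi (fst \<beta>) (snd \<beta>) (gen a u) = 0"
    using free_witness[OF less.prems, of a] unfolding witness_def by blast
  let ?W = "vf_apply (prolong (vertical (gen a u)))"
  let ?k = "sg (q \<and> odd (card (snd \<alpha>))) * c"
  have W: "?W (g \<beta> \<otimes> J (fst \<beta>) (snd \<beta>)) =
      tw q (g \<beta>) \<otimes> scal (sg (q \<and> odd (card (snd \<beta>)))) (D_multi (fst \<beta>) (snd \<beta>) (gen a u))" for \<beta>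
    using g by (simp add: vf_apply_sprod[OF hom_vf_prolong[OF admissible_vertical[OF gen_M u(1)]]]
        fun_on_M_superfun vertical_M[OF gen_M u(1)] prolong_vertical_jet[OF gen_M u(1)])
  have "0 = (\<Sum>\<beta>\<in>free. ?W (g \<beta> \<otimes> J (fst \<beta>) (snd \<beta>)))"
    using zero[OF u(1)] g by (simp add: vf_apply_sum superfun_sprod fun_on_M_superfun)
  also have "\<dots> = (\<Sum>\<beta>\<in>free. if \<beta> = \<alpha> then scal ?k (tw q (g \<alpha>)) else 0)"
  proof (rule sum.cong[OF refl])
    fix \<beta> assume \<beta>: "\<beta> \<in> free"
    show "?W (g \<beta> \<otimes> J (fst \<beta>) (snd \<beta>)) = (if \<beta> = \<alpha> then scal ?k (tw q (g \<alpha>)) else 0)"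
    proof (cases "\<beta> = \<alpha>")
      case True
      then show ?thesis
        using g by (simp add: W u(3) sprod_scal_right sprod_one_superfun fun_on_M_superfun)
    next
      case False
      then have "g \<beta> = 0 \<or> D_multi (fst \<beta>) (snd \<beta>) (gen a u) = 0"
        using less.hyps[of \<beta>] later[of \<beta>] \<beta> by fastforce
      then show ?thesis using False by (auto simp: W tw_def)
    qed
  qed
  also have "\<dots> = scal ?k (tw q (g \<alpha>))" using less.prems finite_free by simp
  finally have "scal ?k (tw q (g \<alpha>)) = 0" by simp
  moreover have "?k \<noteq> 0" using u(2) by (simp add: sg_def)
  ultimately have "tw q (g \<alpha>) = 0" by (rule scal_eq_zero)
  then have "tw q (tw q (g \<alpha>)) = 0" by (simp add: tw_def)
  then show ?case by (simp add: tw_tw)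
qed

text \<open>\<open>L\<close> and its normal form differ by an element of the ideal, which each
  solution sends to a function on M in the ideal, that is, to zero. So the normal form is
  annihilated as well and vanishes by independence.\<close>

lemma linear_in_ideal:
  assumes a: "a \<noteq> -1" and L: "L \<in> jet_linear"
    and zero: "\<And>q u. hom q (gen a u) \<Longrightarrow> vf_apply (prolong (vertical (gen a u))) L = 0"
  shows "L \<in> system_ideal a"
proof -
  from reducible_linear[OF a L] obtain g where g: "\<And>\<alpha>. fun_on_M (g \<alpha>)"
    and I: "L - (\<Sum>\<alpha>\<in>free. g \<alpha> \<otimes> J (fst \<alpha>) (snd \<alpha>)) \<in> system_ideal a"
    unfolding reducible_def by blast
  let ?R = "\<Sum>\<alpha>\<in>free. g \<alpha> \<otimes> J (fst \<alpha>) (snd \<alpha>)"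
  have R: "?R \<in> jet_linear" using g by (intro jet_linear_sum jet_linear.jet)
  have "vf_apply (prolong (vertical (gen a u))) ?R = 0" if h: "hom q (gen a u)" for q u
  proof -
    let ?W = "vf_apply (prolong (vertical (gen a u)))"
    have "?W (L - ?R) \<in> system_ideal a" by (rule solution_ideal[OF gen_solution[OF h] I])
    moreover have "fun_on_M (?W (L - ?R))"
      by (rule vertical_linear_M[OF gen_M h jet_linear_diff[OF L R]])
    ultimately have "?W (L - ?R) = 0" by (rule ideal_M_zero)
    then show ?thesis
      using zero[OF h] L R by (simp add: vf_apply_diff jet_linear_superfun)
  qed
  from free_independent[OF g this] have "?R = 0" by (intro sum.neutral) simp
  then show ?thesis using I by simp
qed

section \<open>Generating functions give symmetries\<close>

text \<open>The lift has the coefficient \<open>pd Yc f \<otimes> hfun\<close> along h, so its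
  characteristic is linear in the jets without a term on M.\<close>

lemma prolong_contact_linear:
  assumes f: "fun_on_M f" "hom p f"
  shows "L \<in> jet_linear \<Longrightarrow> vf_apply (prolong (contact_lift f)) L \<in> jet_linear"
proof (rule jet_linear_vf_apply[OF hom_vf_prolong[OF admissible_contact[OF f]]])
  note V = admissible_contact[OF f]
  have h: "hfun \<in> jet_linear" by (simp add: hfun_def jet_linear_coord)
  have Q: "characteristic (contact_lift f) \<in> jet_linear"
    unfolding characteristic_def contact_lift_h
    by (intro jet_linear_diff jet_linear_sum jet_linear_sprod D_linear h) (simp_all add: f admissibleD[OF V])
  have D_pow: "(D Yc ^^ m) F \<in> jet_linear" if "F \<in> jet_linear" for m F
    using that by (induction m) (simp_all add: D_linear)
  show "prolong (contact_lift f) (Jet m I) \<in> jet_linear" for m I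
    unfolding prolong_jet[OF V] D_multi_odd D_odd_def
    by (intro jet_linear.add jet_linear_sum jet_linear_sprod D_linear jet_linear_coord jet_linear_scal D_pow)
      (simp_all add: admissibleD[OF V] D_linear Q)
qed (rule prolong_M[OF admissible_contact[OF f]])

text \<open>For the original equations membership is tested on solutions. \<open>prolong_D\<close>
  passes it on to total derivatives, its correction terms being multiples of derivatives of the same
  equation.\<close>

lemma contact_symmetry_hom:
  assumes a: "a \<noteq> -1" and h: "hom p (gen a u)"
  shows "F \<in> system_ideal a \<Longrightarrow> vf_apply (prolong (contact_lift (gen a u))) F \<in> system_ideal a"
proof (rule ideal_vf_apply[OF hom_vf_prolong[OF admissible_contact[OF gen_M h]]])
  note V = admissible_contact[OF gen_M h]
  let ?V = "vf_apply (prolong (contact_lift (gen a u)))"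
  fix L assume "L \<in> equations a"
  then show "?V L \<in> system_ideal a"
  proof (induction rule: equations.induct)
    case (base E)
    show ?case
    proof (rule linear_in_ideal[OF a prolong_contact_linear[OF gen_M h system_linear[OF base]]])
      fix q v assume hv: "hom q (gen a v)"
      let ?W = "\<lambda>s. vf_apply (prolong (vertical s))"
      have W: "?W (gen a v) E = 0" if "hom q (gen a v)" for q v
        using gen_solution[OF that] base by (simp add: solution_def)
      have hl: "hom (p \<noteq> q) (gen a (D21_bracket a u v))"
        using hom_lagrange[OF gen_M h gen_M hv] by (simp add: lagrange_gen)
      \<comment> \<open>\<open>gen a v\<close> solves \<open>E\<close>, so one of the two terms of
        the supercommutator is absent; the right side vanishes because the bracket is again a
        generating function of the family.\<close>
      have "- scal (sg (p \<and> q)) (?W (gen a v) (?V E)) = ?W (gen a (D21_bracket a u v)) E"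
        using contact_vertical[OF gen_M h gen_M hv jet_linear_affine[OF system_linear[OF base]]] W[OF hv]
        by (simp add: supercommutator_def lagrange_gen)
      then have "scal (sg (p \<and> q)) (?W (gen a v) (?V E)) = - ?W (gen a (D21_bracket a u v)) E"
        by (metis minus_minus)
      also have "\<dots> = 0" by (simp add: W[OF hl])
      finally have "scal (sg (p \<and> q)) (scal (sg (p \<and> q)) (?W (gen a v) (?V E))) = 0" by simp
      then show "?W (gen a v) (?V E) = 0" by simp
    qed
  next
    case (total L b)
    have L: "L \<in> jet_affine" using total by (simp add: equations_linear jet_linear_affine)
    have "D b (contact_lift (gen a u) c) \<otimes> D c L \<in> system_ideal a" if c: "c \<in> base" for c
      using c total admissibleD(1)[OF V c]
      by (intro system_ideal.mult system_ideal.total superfun_D fun_on_M_superfun equations_ideal)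
    then show ?case
      unfolding prolong_D[OF V total(2) L]
      by (intro ideal_scal ideal_diff ideal_sum system_ideal.total total)
  qed
qed

section \<open>Symmetries are generated by solutions\<close>

text \<open>\<open>y ^ n * (u y)^2\<close> is a first integral that vanishes at 0. Squaring avoids
  the square root of \<open>y ^ n\<close> for odd \<open>n\<close>.\<close>

lemma euler_ode:
  fixes u :: "complex \<Rightarrow> complex"
  assumes der: "\<And>y. (u has_field_derivative u' y) (at y)"
    and eq: "\<And>y. of_nat n * u y + 2 * y * u' y = 0" and n: "n > 0"
  shows "u y = 0"
proof (cases "y = 0")
  case True
  then show ?thesis using eq[of 0] n by simp
next
  case False
  have "((\<lambda>y. y ^ n * (u y)\<^sup>2) has_field_derivative 0) (at y)" for y
  proof -
    have "((\<lambda>y. y ^ n * (u y)\<^sup>2) has_field_derivative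
        of_nat n * y ^ (n - 1) * (u y)\<^sup>2 + y ^ n * (2 * u y * u' y)) (at y)"
      by (auto intro!: derivative_eq_intros der simp: algebra_simps)
    also have "of_nat n * y ^ (n - 1) * (u y)\<^sup>2 + y ^ n * (2 * u y * u' y) =
        y ^ (n - 1) * u y * (of_nat n * u y + 2 * y * u' y)"
      using n by (cases n) (simp_all add: algebra_simps power2_eq_square)
    finally show ?thesis by (simp add: eq)
  qed
  then obtain c where c: "\<And>y. y ^ n * (u y)\<^sup>2 = c"
    using has_field_derivative_zero_constant[of UNIV "\<lambda>y. y ^ n * (u y)\<^sup>2"] by auto
  from c[of 0] n have "c = 0" by (simp add: zero_power)
  then show ?thesis using c[of y] False by simp
qed

lemma affine_of_const_deriv:
  fixes u :: "complex \<Rightarrow> complex"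
  assumes "\<And>y. (u has_field_derivative c) (at y)"
  shows "u y = u 0 + c * y"
proof -
  have "((\<lambda>y. u y - c * y) has_field_derivative 0) (at y)" for y
    by (auto intro!: derivative_eq_intros assms)
  then obtain d where d: "\<And>y. u y - c * y = d"
    using has_field_derivative_zero_constant[of UNIV "\<lambda>y. u y - c * y"] by auto
  from d[of y] d[of 0] show ?thesis by (simp add: algebra_simps)
qed

text \<open>Oriented by the order of the four variables, so that set literals reach a sorted normal
  form.\<close>

lemma insert_sort:
  "insert Theta2 (insert Theta1 I) = insert Theta1 (insert Theta2 I)"
  "insert Nu1 (insert Theta1 I) = insert Theta1 (insert Nu1 I)"
  "insert Nu2 (insert Theta1 I) = insert Theta1 (insert Nu2 I)"
  "insert Nu1 (insert Theta2 I) = insert Theta2 (insert Nu1 I)"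
  "insert Nu2 (insert Theta2 I) = insert Theta2 (insert Nu2 I)"
  "insert Nu2 (insert Nu1 I) = insert Nu1 (insert Nu2 I)"
  by (rule insert_commute)+

text \<open>The generating function of \<open>-2\<close> times the Euler field \<open>y \<partial>/\<partial>y + (\<theta> \<partial>/\<partial>\<theta> + \<nu> \<partial>/\<partial>\<nu>)/2\<close>.\<close>

definition euler :: gamma where
  "euler = (((0, 0, 0), (0, 1, 0), (0, 0, 0)), 0)"

text \<open>The weight operator on coefficients. The shift by -2 is the term
  \<open>f \<otimes> pd Yc g\<close>, because the even part of the Euler generating function begins
  with \<open>-2 * y\<close>.\<close>

lemma cf_lagrange_euler:
  assumes f: "fun_on_M f"
  shows "cf (lagrange f (gen a euler)) I y = (of_nat (card I) - 2) * cf f I y + 2 * y * cf (pd Yc f) I y"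
  by (rule odd_var_set_cases[of "\<lambda>I. cf (lagrange f (gen a euler)) I y =
        (of_nat (card I) - 2) * cf f I y + 2 * y * cf (pd Yc f) I y"])
    (simp add: lagrange_def contact_op_def UNIV_odd_var cf_add cf_diff cf_sprod cf_frame cf_parity f
      dy_parity dy_gen cf_gen eps_eval euler_def zero_fun_apply insert_Diff_if insert_sort;
      simp add: algebra_simps)+

text \<open>Each equation of the system lowers the Euler weight, so on coefficients it commutes with the
  bracket with the Euler field up to a positive constant. An entire function u with
  \<open>n u + 2 y u' = 0\<close> and \<open>n > 0\<close> vanishes, hence f solves the system if its bracket with the
  Euler field does.\<close>

lemma generated_by_gen:
  assumes a: "a \<noteq> -1" and f: "fun_on_M f" "hom p f"
    and sol: "\<forall>E\<in>system a. vf_apply (prolong (vertical (lagrange f (gen a euler)))) E = 0"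
  shows "\<exists>u. f = gen a u"
proof -
  define k where "k = lagrange f (gen a euler)"
  define f1 where "f1 = pd Yc f"
  define f2 where "f2 = pd Yc f1"
  define f3 where "f3 = pd Yc f2"
  have M: "fun_on_M f" "fun_on_M f1" "fun_on_M f2" "fun_on_M f3" "fun_on_M k"
    using f by (simp_all add: f1_def f2_def f3_def k_def)
  have a1: "a + 1 \<noteq> 0" using a by (metis add_eq_0_iff add.commute)
  have der: "(cf f I has_field_derivative cf f1 I y) (at y)"
    "(cf f1 I has_field_derivative cf f2 I y) (at y)"
    "(cf f2 I has_field_derivative cf f3 I y) (at y)" for I y
    using DERIV_cf[OF M(1)] DERIV_cf[OF M(2)] DERIV_cf[OF M(3)] by (simp_all add: f1_def f2_def f3_def)
  have k0: "cf k I y = (of_nat (card I) - 2) * cf f I y + 2 * y * cf f1 I y" for I y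
    using cf_lagrange_euler[OF M(1)] by (simp add: k_def f1_def)
  \<comment> \<open>Each y-derivative raises the weight by 2: the factor \<open>card I - 2\<close>
    becomes \<open>card I\<close> here and \<open>card I + 2\<close> in \<open>k2\<close>.\<close>
  have k1: "cf (pd Yc k) I y = of_nat (card I) * cf f1 I y + 2 * y * cf f2 I y" for I y
  proof (rule DERIV_unique[OF DERIV_cf[OF M(5)]])
    have "cf k I = (\<lambda>y. (of_nat (card I) - 2) * cf f I y + 2 * y * cf f1 I y)" using k0 by blast
    then show "(cf k I has_field_derivative of_nat (card I) * cf f1 I y + 2 * y * cf f2 I y) (at y)"
      by (auto intro!: derivative_eq_intros der simp: algebra_simps)
  qed
  have k2: "cf (pd Yc (pd Yc k)) I y = (of_nat (card I) + 2) * cf f2 I y + 2 * y * cf f3 I y" for I y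
  proof (rule DERIV_unique[OF DERIV_cf])
    have "cf (pd Yc k) I = (\<lambda>y. of_nat (card I) * cf f1 I y + 2 * y * cf f2 I y)" using k1 by blast
    then show "(cf (pd Yc k) I has_field_derivative (of_nat (card I) + 2) * cf f2 I y + 2 * y * cf f3 I y) (at y)"
      by (auto intro!: derivative_eq_intros der simp: algebra_simps)
  qed (simp add: M)
  have "hom p k" using hom_lagrange[OF f gen_M hom_gen(1)] by (simp add: k_def euler_def)
  note E = sol[folded k_def, unfolded vertical_system[OF M(5) this]]
  let ?A = "{Theta1, Theta2, Nu1, Nu2}"
  note ev = D_multi_expand[OF M(5)] Let_def numeral_2_eq_2 cf_add cf_diff cf_scal cf_zero cf_coord_sprod
    cf_pd_Oc eps_eval insert_sort insert_Diff_if k0 k1 k2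
  have at: "cf F I y = 0" if "F = 0" for F I y using that by (simp add: cf_zero)
  \<comment> \<open>Both terms have weight 2: the second derivative of the degree 0 coefficient and
    the quartic coefficient itself.\<close>
  have o1: "(a + 1) * cf f2 {} y + 2 * cf f ?A y = 0" for y
  proof (rule euler_ode[where n = 2 and u = "\<lambda>y. (a + 1) * cf f2 {} y + 2 * cf f ?A y"
        and u' = "\<lambda>y. (a + 1) * cf f3 {} y + 2 * cf f1 ?A y"])
    fix y
    show "((\<lambda>y. (a + 1) * cf f2 {} y + 2 * cf f ?A y) has_field_derivative
        (a + 1) * cf f3 {} y + 2 * cf f1 ?A y) (at y)"
      by (auto intro!: derivative_eq_intros der)
    show "of_nat 2 * ((a + 1) * cf f2 {} y + 2 * cf f ?A y) + 2 * y * ((a + 1) * cf f3 {} y + 2 * cf f1 ?A y) = 0"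
      using at[OF conjunct1[OF E], of "{}" y] by (simp add: ev algebra_simps)
  qed simp
  \<comment> \<open>At a single odd coordinate the quartic derivative contributes nothing, so the
    second derivative stands alone, with weight 3.\<close>
  have o2: "cf f2 {i} y = 0" for i y
  proof (rule euler_ode[where n = 3 and u' = "cf f3 {i}", OF der(3)])
    fix y
    have "scal (a + 1) (D_multi 2 {} k) + scal 2 (D_multi 0 ?A k) = 0" using E by blast
    from at[OF this, of "{i}" y] show "of_nat 3 * cf f2 {i} y + 2 * y * cf f3 {i} y = 0"
      using a1 by (cases i) (simp_all add: ev)
  qed simp
  have single: "cf f1 I y = 0" if "\<And>y. cf (pd Yc k) I y = 0" "card I > 0" for I y
  proof (rule euler_ode[where n = "card I" and u' = "cf f2 I", OF der(2)])
    show "of_nat (card I) * cf f1 I y + 2 * y * cf f2 I y = 0" for y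
      using that(1)[of y] unfolding k1 .
  qed (rule that(2))
  note ev' = D_multi_expand[OF M(5)] Let_def cf_add cf_diff cf_scal cf_zero cf_coord_sprod
    cf_pd_Oc eps_eval insert_sort insert_Diff_if
  have o3: "cf f1 I y = 0" if I: "I \<in> {{Theta1, Nu2}, {Theta2, Nu1}, {Theta1, Theta2}, {Nu1, Nu2}}" for I y
  proof (rule single)
    have "D_multi 1 {Theta1, Nu2} k = 0" "D_multi 1 {Theta2, Nu1} k = 0"
      "D_multi 1 {Theta1, Theta2} k = 0" "D_multi 1 {Nu1, Nu2} k = 0" using E by blast+
    from this[THEN at, of "{}"] show "cf (pd Yc k) I y = 0" for y
      using I by (auto simp: ev')
    show "card I > 0" using I by auto
  qed
  have o4: "cf f1 {Theta1, Nu1} y - cf f1 {Theta2, Nu2} y = 0" for y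
  proof (rule euler_ode[where n = 2 and u = "\<lambda>y. cf f1 {Theta1, Nu1} y - cf f1 {Theta2, Nu2} y"
        and u' = "\<lambda>y. cf f2 {Theta1, Nu1} y - cf f2 {Theta2, Nu2} y"])
    fix y
    show "((\<lambda>y. cf f1 {Theta1, Nu1} y - cf f1 {Theta2, Nu2} y) has_field_derivative
        cf f2 {Theta1, Nu1} y - cf f2 {Theta2, Nu2} y) (at y)"
      by (intro derivative_intros der)
    have "D_multi 1 {Theta1, Nu1} k - D_multi 1 {Theta2, Nu2} k = 0" using E by blast
    from at[OF this, of "{}" y]
    show "of_nat 2 * (cf f1 {Theta1, Nu1} y - cf f1 {Theta2, Nu2} y) +
        2 * y * (cf f2 {Theta1, Nu1} y - cf f2 {Theta2, Nu2} y) = 0"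
      by (simp add: ev algebra_simps)
  qed simp
  \<comment> \<open>First derivatives in degree \<open>n\<close> and plain coefficients in degree
    \<open>n + 2\<close> share the weight \<open>n\<close>.\<close>
  have comb: "c * cf f1 I y + d * cf f K y = 0"
    if "\<And>y. c * cf (pd Yc k) I y + d * cf k K y = 0" "card I = n" "card K = n + 2" "n > 0" for c d I K n y
  proof (rule euler_ode[where n = n and u = "\<lambda>y. c * cf f1 I y + d * cf f K y"
        and u' = "\<lambda>y. c * cf f2 I y + d * cf f1 K y"])
    fix y
    show "((\<lambda>y. c * cf f1 I y + d * cf f K y) has_field_derivative c * cf f2 I y + d * cf f1 K y) (at y)"
      by (auto intro!: derivative_eq_intros der)
    show "of_nat n * (c * cf f1 I y + d * cf f K y) + 2 * y * (c * cf f2 I y + d * cf f1 K y) = 0"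
      using that(1)[of y] that(2,3) by (simp add: k0 k1 algebra_simps)
  qed (rule that(4))
  have E7: "scal (a + 1) (D_multi 1 {Nu1} k) + D_multi 0 {Theta2, Nu1, Nu2} k = 0"
    "scal (a + 1) (D_multi 1 {Nu2} k) - D_multi 0 {Theta1, Nu1, Nu2} k = 0"
    and E8: "coord_fun (Oc Nu1) \<otimes> (scal a (D_multi 1 {Theta1} k) + D_multi 0 {Theta1, Theta2, Nu2} k) = 0"
    "coord_fun (Oc Nu2) \<otimes> (scal a (D_multi 1 {Theta2} k) - D_multi 0 {Theta1, Theta2, Nu1} k) = 0"
    using E by blast+
  have o5: "(a + 1) * cf f1 {Nu1} y + (-1) * cf f {Theta2, Nu1, Nu2} y = 0" for y
    by (rule comb[where n = 1]) (use at[OF E7(1), of "{}"] in \<open>simp_all add: ev'\<close>)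
  have o6: "(a + 1) * cf f1 {Theta1, Nu1} y + (-1) * cf f ?A y = 0" for y
    by (rule comb[where n = 2]) (use at[OF E7(1), of "{Theta1}"] in \<open>simp_all add: ev' eq_neg_iff_add_eq_0 algebra_simps\<close>)
  have o7: "(a + 1) * cf f1 {Nu2} y + 1 * cf f {Theta1, Nu1, Nu2} y = 0" for y
    by (rule comb[where n = 1]) (use at[OF E7(2), of "{}"] in \<open>simp_all add: ev'\<close>)
  \<comment> \<open>Multiplication by \<open>Nu1\<close> hides the terms containing
    \<open>Nu1\<close>; the coefficient at \<open>{Nu1}\<close> still shows the constant term of the
    expression behind the factor.\<close>
  have o8: "a * cf f1 {Theta1} y + (-1) * cf f {Theta1, Theta2, Nu2} y = 0" for y
    by (rule comb[where n = 1]) (use at[OF E8(1), of "{Nu1}"] in \<open>simp_all add: ev'\<close>)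
  have o9: "a * cf f1 {Theta2} y + 1 * cf f {Theta1, Theta2, Nu1} y = 0" for y
    by (rule comb[where n = 1]) (use at[OF E8(2), of "{Nu2}"] in \<open>simp_all add: ev'\<close>)
  \<comment> \<open>The derivative along \<open>Theta1, Nu2\<close>, read at the complementary set,
    is the full coefficient up to sign.\<close>
  have o10: "cf f1 ?A y = 0" for y
  proof (rule single)
    have "D_multi 1 {Theta1, Nu2} k = 0" using E by blast
    from at[OF this, of "{Theta2, Nu1}"] show "cf (pd Yc k) ?A y = 0" for y
      by (simp add: ev')
  qed simp
  have cA: "cf f ?A y = cf f ?A 0" for y
    using affine_of_const_deriv[of "cf f ?A" 0 y] der(1)[of ?A] by (simp add: o10)
  \<comment> \<open>This becomes the coordinate \<open>y2\<close>, as the quartic coefficient in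
    \<open>gen_coeff\<close> is \<open>(a + 1) * y2\<close>.\<close>
  define b where "b = cf f ?A 0 / (a + 1)"
  have b: "cf f ?A y = (a + 1) * b" for y using cA[of y] a1 by (simp add: b_def)
  have f2: "cf f2 {} y = - 2 * b" for y
  proof -
    have "(a + 1) * (cf f2 {} y + 2 * b) = 0" using o1[of y] unfolding b by (simp add: algebra_simps)
    then show ?thesis using a1 by (simp add: add_eq_0_iff)
  qed
  have f1: "cf f1 {} y = cf f1 {} 0 + - 2 * b * y" for y
    using affine_of_const_deriv[of "cf f1 {}" "- 2 * b" y] der(2)[of "{}"] by (simp add: f2)
  have c0: "cf f {} y = cf f {} 0 + cf f1 {} 0 * y - b * y\<^sup>2" for y
  proof -
    have "((\<lambda>y. cf f {} y + b * y\<^sup>2) has_field_derivative cf f1 {} 0) (at y)" for y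
      by (auto intro!: derivative_eq_intros der simp: f1[of y])
    from affine_of_const_deriv[OF this, of y] show ?thesis by (simp add: algebra_simps)
  qed
  have f1i: "cf f1 {i} y = cf f1 {i} 0" for i y
    using affine_of_const_deriv[of "cf f1 {i}" 0 y] der(2)[of "{i}"] by (simp add: o2)
  have ci: "cf f {i} y = cf f {i} 0 + cf f1 {i} 0 * y" for i y
  proof (rule affine_of_const_deriv)
    show "(cf f {i} has_field_derivative cf f1 {i} 0) (at y)" for y
      using der(1)[of "{i}" y] f1i[of i y] by simp
  qed
  have cij: "cf f I y = cf f I 0" if "I \<in> {{Theta1, Nu2}, {Theta2, Nu1}, {Theta1, Theta2}, {Nu1, Nu2}}" for I y
    using affine_of_const_deriv[of "cf f I" 0 y] der(1)[of I] by (simp add: o3[OF that])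
  have s13: "cf f1 {Theta1, Nu1} y = b" for y
  proof -
    have "(a + 1) * (cf f1 {Theta1, Nu1} y - b) = 0" using o6[of y] unfolding b by (simp add: algebra_simps)
    then show ?thesis using a1 by simp
  qed
  have s24: "cf f1 {Theta2, Nu2} y = b" for y using o4[of y] s13[of y] by simp
  have c13: "cf f {Theta1, Nu1} y = cf f {Theta1, Nu1} 0 + b * y" for y
    by (rule affine_of_const_deriv) (use der(1)[of "{Theta1, Nu1}"] s13 in simp)
  have c24: "cf f {Theta2, Nu2} y = cf f {Theta2, Nu2} 0 + b * y" for y
    by (rule affine_of_const_deriv) (use der(1)[of "{Theta2, Nu2}"] s24 in simp)
  \<comment> \<open>Solves \<open>gen_coeff\<close> for the diagonal part: the coefficient of
    \<open>y\<close> is \<open>-2 * h2\<close>, and at y = 0 the two diagonal quadratic coefficients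
    are \<open>h2 - h1 - h3\<close> and \<open>h2 - h1 + h3\<close>.\<close>
  define h2 where "h2 = - cf f1 {} 0 / 2"
  define h3 where "h3 = (cf f {Theta2, Nu2} 0 - cf f {Theta1, Nu1} 0) / 2"
  define h1 where "h1 = h2 - (cf f {Theta1, Nu1} 0 + cf f {Theta2, Nu2} 0) / 2"
  define w where "w = (\<lambda>p q r. if p = Vx then
      (if r = Vx then (if q = Vx then cf f {Theta1} 0 else cf f1 {Theta1} 0)
       else - (if q = Vx then cf f {Theta2} 0 else cf f1 {Theta2} 0))
    else
      (if r = Vx then - (if q = Vx then cf f {Nu2} 0 else cf f1 {Nu2} 0)
       else - (if q = Vx then cf f {Nu1} 0 else cf f1 {Nu1} 0)))"
  define u where "u = (((cf f {Theta1, Theta2} 0, h1, - cf f {Nu1, Nu2} 0), (cf f {} 0, h2, b),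
    (cf f {Theta1, Nu2} 0, h3, cf f {Theta2, Nu1} 0)), w)"
  have cubic: "cf f {Theta2, Nu1, Nu2} y = (a + 1) * cf f1 {Nu1} 0"
    "cf f {Theta1, Nu1, Nu2} y = - (a + 1) * cf f1 {Nu2} 0"
    "cf f {Theta1, Theta2, Nu2} y = a * cf f1 {Theta1} 0"
    "cf f {Theta1, Theta2, Nu1} y = - a * cf f1 {Theta2} 0" for y
    using o5[of y] o7[of y] o8[of y] o9[of y] f1i[of _ y] by (simp_all add: algebra_simps add_eq_0_iff)
  have "f = gen a u"
  proof (rule cf_ext[OF M(1) gen_M])
    fix I y
    show "cf f I y = cf (gen a u) I y"
      unfolding cf_gen u_def
      by (rule odd_var_set_cases[of "\<lambda>I. cf f I y = gen_coeff a
          (((cf f {Theta1, Theta2} 0, h1, - cf f {Nu1, Nu2} 0), (cf f {} 0, h2, b),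
            (cf f {Theta1, Nu2} 0, h3, cf f {Theta2, Nu1} 0)), w) I y"])
        (simp_all add: c0[of y] ci[of _ y] cij[of _ y] c13[of y] c24[of y] cubic b h1_def h2_def h3_def w_def
          field_simps)
  qed
  then show ?thesis ..
qed


section \<open>The isomorphism\<close>

lemma contact_lift_affine:
  assumes f: "fun_on_M f"
  shows "b \<in> base \<Longrightarrow> fun_on_M (contact_lift f b)" "characteristic (contact_lift f) \<in> jet_affine"
proof -
  show M: "fun_on_M (contact_lift f b)" if "b \<in> base" for b
    unfolding contact_lift_base[OF that] using that
    by (rule base_cases) (simp_all add: contact_vf_Oc contact_vf_Yc f)
  show "characteristic (contact_lift f) \<in> jet_affine"
    unfolding characteristic_def contact_lift_h
    by (intro jet_affine_diff jet_affine_sum jet_affine_sprod D_affine) (simp_all add: f M)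
qed

lemma parity_pow_affine: "F \<in> jet_affine \<Longrightarrow> (parity ^^ n) F \<in> jet_affine"
  using jet_affine_tw[of _ True] by (induction n) simp_all

lemma contact_lift_add:
  assumes "fun_on_M f" "fun_on_M g" "c \<in> insert (Jet 0 {}) base"
  shows "contact_lift (f + g) c = contact_lift f c + contact_lift g c"
proof -
  from assms(3) consider "c = Jet 0 {}" | "c = Yc" | i where "c = Oc i" by (auto elim: base_cases)
  then show ?thesis
    by cases (use assms in \<open>simp_all add: contact_lift_h contact_lift_base contact_vf_Oc contact_vf_Yc pd_add
      fun_on_M_superfun sprod_add_left parity_add frame_add sum.distrib algebra_simps\<close>)
qed

lemma contact_lift_scal:
  assumes "fun_on_M f" "c \<in> insert (Jet 0 {}) base"
  shows "contact_lift (scal k f) c = scal k (contact_lift f c)"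
proof -
  from assms(2) consider "c = Jet 0 {}" | "c = Yc" | i where "c = Oc i" by (auto elim: base_cases)
  then show ?thesis
    by cases (use assms in \<open>simp_all add: contact_lift_h contact_lift_base contact_vf_Oc contact_vf_Yc pd_scal
      fun_on_M_superfun sprod_scal_left parity_scal frame_scal scal_add scal_sum\<close>)
qed

lemma parity_pow_add: "(parity ^^ n) (F + G) = (parity ^^ n) F + (parity ^^ n) G"
  by (induction n) (simp_all add: parity_add)

lemma parity_pow_scal: "(parity ^^ n) (scal k F) = scal k ((parity ^^ n) F)"
  by (induction n) (simp_all add: parity_scal)

text \<open>Generating functions may be inhomogeneous, so the sum is compared through the powers of
  \<open>parity\<close> in \<open>prolong\<close> and not through a sign.\<close>

lemma prolong_contact_add:
  assumes f: "fun_on_M f" and g: "fun_on_M g"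
  shows "prolong (contact_lift (f + g)) = prolong (contact_lift f) + prolong (contact_lift g)"
proof
  fix c
  have q: "characteristic (contact_lift (f + g)) = characteristic (contact_lift f) + characteristic (contact_lift g)"
    unfolding characteristic_def
    by (simp add: contact_lift_add[OF f g] sprod_add_left sum.distrib algebra_simps cong: sum.cong)
  note aff = parity_pow_affine[OF contact_lift_affine(2)[OF f]] parity_pow_affine[OF contact_lift_affine(2)[OF g]]
  show "prolong (contact_lift (f + g)) c = (prolong (contact_lift f) + prolong (contact_lift g)) c"
  proof (cases "c \<in> base")
    case True
    then show ?thesis
      unfolding plus_fun_apply[of "prolong (contact_lift f)" "prolong (contact_lift g)"]
      by (simp add: contact_lift_add[OF f g])
  next
    case False
    then obtain m I where c: "c = Jet m I" using Oc_base Yc_base by (cases c) auto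
    show ?thesis
      unfolding c plus_fun_apply[of "prolong (contact_lift f)" "prolong (contact_lift g)"]
      unfolding prolong_def coord.case q parity_pow_add D_multi_add[OF aff]
      by (simp add: contact_lift_add[OF f g] sprod_add_left sum.distrib algebra_simps cong: sum.cong)
  qed
qed

lemma prolong_contact_scal:
  assumes f: "fun_on_M f"
  shows "prolong (contact_lift (scal k f)) = vf_scal k (prolong (contact_lift f))"
proof
  fix c
  have q: "characteristic (contact_lift (scal k f)) = scal k (characteristic (contact_lift f))"
    unfolding characteristic_def
    by (simp add: contact_lift_scal[OF f] sprod_scal_left scal_sum scal_diff cong: sum.cong)
  show "prolong (contact_lift (scal k f)) c = vf_scal k (prolong (contact_lift f)) c"
  proof (cases "c \<in> base")
    case True
    then show ?thesis by (simp add: contact_lift_scal[OF f] vf_scal_def)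
  next
    case False
    then obtain m I where c: "c = Jet m I" using Oc_base Yc_base by (cases c) auto
    show ?thesis
      unfolding c vf_scal_def prolong_def coord.case q parity_pow_scal
        D_multi_scal[OF parity_pow_affine[OF contact_lift_affine(2)[OF f]]]
      by (simp add: contact_lift_scal[OF f] sprod_scal_left scal_sum scal_add cong: sum.cong)
  qed
qed

lemma vf_apply_plus: "vf_apply (V + W) F = vf_apply V F + vf_apply W F"
  using vf_apply_field_add[of V W F] by (simp add: plus_fun_def[of V W])

definition gen_field :: "complex \<Rightarrow> gamma \<Rightarrow> vfield" where
  "gen_field a u = prolong (contact_lift (gen a u))"

lemma gen_field_add: "gen_field a (u + v) = gen_field a u + gen_field a v"
  by (simp add: gen_field_def gen_add prolong_contact_add)

lemma gen_field_split: "gen_field a (A, w) = gen_field a (A, 0) + gen_field a (0, w)"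
  unfolding gen_field_add[symmetric] by simp

lemma hom_gen_field: "hom_vf False (gen_field a (A, 0))" "hom_vf True (gen_field a (0, w))"
  unfolding gen_field_def by (intro hom_vf_prolong admissible_contact gen_M hom_gen)+

lemma vf_part_plus: "vf_part p (V + W) = vf_part p V + vf_part p W"
  by (intro ext) (simp add: vf_part_def pointwise)

lemma vf_part_gen_field:
  "vf_part False (gen_field a (A, w)) = gen_field a (A, 0)"
  "vf_part True (gen_field a (A, w)) = gen_field a (0, w)"
  unfolding gen_field_split[of a A w] vf_part_plus hom_vf_part[OF hom_gen_field(1)] hom_vf_part[OF hom_gen_field(2)]
  by simp_all

lemma contact_op_add:
  "fun_on_M f \<Longrightarrow> fun_on_M g \<Longrightarrow> contact_op (f + g) h = contact_op f h + contact_op g h"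
  "fun_on_M g \<Longrightarrow> fun_on_M h \<Longrightarrow> contact_op f (g + h) = contact_op f g + contact_op f h"
  by (simp_all add: contact_op_def parity_add frame_add sprod_add_left sprod_add_right pd_add
      fun_on_M_superfun sum.distrib algebra_simps)

lemma lagrange_add:
  "fun_on_M f \<Longrightarrow> fun_on_M g \<Longrightarrow> lagrange (f + g) h = lagrange f h + lagrange g h"
  "fun_on_M g \<Longrightarrow> fun_on_M h \<Longrightarrow> lagrange f (g + h) = lagrange f g + lagrange f h"
  by (simp_all add: lagrange_def contact_op_add pd_add fun_on_M_superfun sprod_add_left sprod_add_right algebra_simps)

text \<open>\<open>vf_bracket\<close> is defined through homogeneous parts, and these are the fields
  of the homogeneous parts of \<open>u\<close> and \<open>v\<close>. \<open>contact_bracket\<close>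
  settles the four combinations, and additivity reassembles them.\<close>

lemma gen_field_bracket: "gen_field a (D21_bracket a u v) = vf_bracket (gen_field a u) (gen_field a v)"
proof
  fix c
  obtain A w B x where u: "u = (A, w)" and v: "v = (B, x)" by (cases u; cases v)
  let ?f = "\<lambda>p. gen a (if p then (0, w) else (A, 0))" and ?g = "\<lambda>p. gen a (if p then (0, x) else (B, 0))"
  have h: "hom p (?f p)" "hom p (?g p)" for p by (cases p; simp add: hom_gen)+
  have summand: "vf_apply (prolong (contact_lift (?f p))) (prolong (contact_lift (?g q)) c)
      - scal (if p \<and> q then -1 else 1) (vf_apply (prolong (contact_lift (?g q))) (prolong (contact_lift (?f p)) c))
      = prolong (contact_lift (lagrange (?f p) (?g q))) c" for p q
  proof -
    have "superfun (prolong (contact_lift (?f p)) c)" "superfun (prolong (contact_lift (?g q)) c)"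
      by (rule hom_vfD(2)[OF hom_vf_prolong[OF admissible_contact[OF gen_M h(1)]]]
          hom_vfD(2)[OF hom_vf_prolong[OF admissible_contact[OF gen_M h(2)]]])+
    then show ?thesis
      unfolding contact_bracket[OF gen_M h(1) gen_M h(2), symmetric]
        vf_bracket_hom[OF hom_vf_prolong[OF admissible_contact[OF gen_M h(1)]]
          hom_vf_prolong[OF admissible_contact[OF gen_M h(2)]]]
      by (simp add: supercommutator_def vf_apply_coord superfun_oddsupp sg_def)
  qed
  have "vf_bracket (gen_field a u) (gen_field a v) c =
      (\<Sum>p\<in>{False, True}. \<Sum>q\<in>{False, True}. prolong (contact_lift (lagrange (?f p) (?g q))) c)"
  proof -
    have part: "vf_part p (gen_field a u) = prolong (contact_lift (?f p))"
      "vf_part p (gen_field a v) = prolong (contact_lift (?g p))" for p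
      unfolding u v gen_field_def[symmetric]
      by (cases p; simp only: vf_part_gen_field if_True if_False)+
    show ?thesis unfolding vf_bracket_def part summand ..
  qed
  also have "\<dots> = prolong (contact_lift (lagrange (gen a u) (gen a v))) c"
  proof -
    have s: "gen a u = ?f False + ?f True" "gen a v = ?g False + ?g True"
      unfolding gen_add[symmetric] u v by simp_all
    show ?thesis
      unfolding s by (simp add: lagrange_add prolong_contact_add plus_fun_apply add.assoc)
  qed
  finally show "gen_field a (D21_bracket a u v) c = vf_bracket (gen_field a u) (gen_field a v) c"
    by (simp add: gen_field_def lagrange_gen)
qed

lemma inj_gen: "gen a u = gen a v \<Longrightarrow> u = v"
proof -
  assume eq: "gen a u = gen a v"
  obtain x1 h1 y1 x2 h2 y2 x3 h3 y3 w where u: "u = (((x1, h1, y1), (x2, h2, y2), (x3, h3, y3)), w)"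
    by (metis prod.exhaust)
  obtain x1' h1' y1' x2' h2' y2' x3' h3' y3' w' where
    v: "v = (((x1', h1', y1'), (x2', h2', y2'), (x3', h3', y3')), w')"
    by (metis prod.exhaust)
  have c: "gen_coeff a u I y = gen_coeff a v I y" for I y
    using arg_cong[OF eq, of "\<lambda>f. cf f I y"] by (simp add: cf_gen)
  have "x2 = x2'" using c[of "{}" 0] by (simp add: u v)
  \<comment> \<open>The values at 1 and -1 separate the linear from the quadratic term.\<close>
  moreover have "y2 = y2' \<and> h2 = h2'"
    using c[of "{}" 1] c[of "{}" "-1"] \<open>x2 = x2'\<close> by (simp add: u v) algebra
  moreover have "h1 = h1' \<and> h3 = h3'"
    using c[of "{Theta1, Nu1}" 0] c[of "{Theta2, Nu2}" 0] calculation by (simp add: u v) algebra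
  moreover have "x1 = x1'" "y1 = y1'" "x3 = x3'" "y3 = y3'"
    using c[of "{Theta1, Theta2}" 0] c[of "{Nu1, Nu2}" 0] c[of "{Theta1, Nu2}" 0] c[of "{Theta2, Nu1}" 0]
    by (simp_all add: u v)
  moreover have "w = w'"
  proof (intro ext)
    fix p q r
    show "w p q r = w' p q r"
      using c[of "{Theta1}" 0] c[of "{Theta1}" 1] c[of "{Theta2}" 0] c[of "{Theta2}" 1]
        c[of "{Nu1}" 0] c[of "{Nu1}" 1] c[of "{Nu2}" 0] c[of "{Nu2}" 1]
      by (cases p; cases q; cases r) (simp_all add: u v)
  qed
  ultimately show "u = v" by (simp add: u v)
qed

text \<open>The generating function is recovered from the field by \<open>rec\<close>, which is the
  contraction with the contact form up to sign conventions.\<close>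

lemma inj_gen_field: "inj (gen_field a)"
proof (rule injI)
  fix u v assume eq: "gen_field a u = gen_field a v"
  have rec: "gen a u = gen_field a u Yc - (\<Sum>i\<in>UNIV. gen_field a u (Oc i) \<otimes> shift i)" for u
    by (simp add: gen_field_def contact_lift_base contact_vf_Yc contact_vf_Oc)
  have "gen a u = gen a v" unfolding rec[of u] rec[of v] eq ..
  then show "u = v" by (rule inj_gen)
qed

lemma gen_field_symmetry:
  assumes "a \<noteq> -1"
  shows "gen_field a u \<in> contact_symmetries a"
proof -
  obtain A w where u: "u = (A, w)" by (cases u)
  have "gen_field a u \<in> cont_inf" unfolding cont_inf_def gen_field_def using gen_M by blast
  moreover have "vf_apply (gen_field a u) F \<in> system_ideal a" if "F \<in> system_ideal a" for F
    unfolding u gen_field_split[of a A w] vf_apply_plus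
    using contact_symmetry_hom[OF assms hom_gen(1) that] contact_symmetry_hom[OF assms hom_gen(2) that]
    by (simp add: gen_field_def system_ideal.add)
  ultimately show ?thesis by (simp add: contact_symmetries_def)
qed

lemma symmetry_gen_field:
  assumes a: "a \<noteq> -1" and V: "V \<in> contact_symmetries a"
  shows "V \<in> range (gen_field a)"
proof -
  obtain f where f: "fun_on_M f" and Vf: "V = prolong (contact_lift f)"
    using V by (auto simp: contact_symmetries_def cont_inf_def)
  \<comment> \<open>A symmetry need not be homogeneous, but supercommutators are available only for
    homogeneous fields, hence the projections to the two parities.\<close>
  define g where "g p = scal (1 / 2) (f + scal (sg p) (parity f))" for p
  have g: "fun_on_M (g p)" "hom p (g p)" for p
  proof -
    show "fun_on_M (g p)" unfolding g_def using f by simp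
    show "hom p (g p)"
      unfolding hom_def
    proof (intro allI impI)
      fix K z assume "g p K z \<noteq> 0"
      then show "odd (card K) = p"
        by (cases p; cases "even (card K)") (simp_all add: g_def scal_def parity_def pointwise)
    qed
  qed
  have fg: "f = g False + g True"
    by (simp add: g_def scal_def fun_eq_iff pointwise field_simps)
  let ?s = "gen a euler"
  have s: "hom False ?s" unfolding euler_def by (rule hom_gen)
  let ?W = "\<lambda>s. vf_apply (prolong (vertical s))" and ?V = "\<lambda>p. vf_apply (prolong (contact_lift (g p)))"
  have "?W (lagrange (g p) ?s) E = 0" if E: "E \<in> system a" for E p
  proof -
    have Elin: "E \<in> jet_linear" using system_linear[OF E] .
    have VE: "?V p E \<in> jet_linear" for p by (rule prolong_contact_linear[OF g Elin])
    have "vf_apply V E \<in> system_ideal a"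
      using V system_ideal.equation[OF E] by (simp add: contact_symmetries_def)
    moreover have "vf_apply V E = ?V False E + ?V True E"
      unfolding Vf by (subst fg) (simp add: prolong_contact_add g vf_apply_plus)
    ultimately have "?V False E + ?V True E \<in> system_ideal a" by simp
    then have "?W ?s (?V False E + ?V True E) \<in> system_ideal a"
      by (rule solution_ideal[OF gen_solution[OF s]])
    moreover have "fun_on_M (?W ?s (?V False E + ?V True E))"
      by (rule vertical_linear_M[OF gen_M s jet_linear.add[OF VE VE]])
    ultimately have "?W ?s (?V False E + ?V True E) = 0" by (rule ideal_M_zero)
    then have sum: "?W ?s (?V False E) + ?W ?s (?V True E) = 0"
      using VE by (simp add: vf_apply_add jet_linear_superfun)
    have "?W ?s E = 0" using gen_solution[OF s] E by (simp add: solution_def)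
    then have W: "?W (lagrange (g p) ?s) E = - ?W ?s (?V p E)" for p
      using contact_vertical[OF g gen_M s jet_linear_affine[OF Elin], of p]
      by (simp add: supercommutator_def)
    obtain e where e: "hom e E" using system_hom[OF E] .
    have h: "hom (p \<noteq> e) (?W (lagrange (g p) ?s) E)" for p
    proof -
      have "hom p (lagrange (g p) ?s)" using hom_lagrange[OF g gen_M s, of p] by simp
      from hom_vf_apply[OF hom_vf_prolong[OF admissible_vertical[OF lagrange_M[OF g(1) gen_M] this]]
          jet_linear_superfun[OF Elin] e] show ?thesis .
    qed
    \<comment> \<open>So far only the sum over both parities is known to vanish. Since
      \<open>E\<close> is homogeneous, the two contributions have opposite parity, and each of them
      must be zero.\<close>
    have neg: "?W (lagrange (g p) ?s) E = - ?W (lagrange (g (\<not> p)) ?s) E"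
      using sum unfolding W by (cases p) (simp_all add: neg_eq_iff_add_eq_0 add.commute)
    have "hom (\<not> (p \<noteq> e)) (?W (lagrange (g p) ?s) E)"
    proof -
      have "hom ((\<not> p) \<noteq> e) (- ?W (lagrange (g (\<not> p)) ?s) E)" by (rule hom_minus[OF h])
      moreover have "((\<not> p) \<noteq> e) = (\<not> (p \<noteq> e))" by auto
      ultimately show ?thesis unfolding neg[symmetric] by metis
    qed
    with h show ?thesis by (rule hom_eq_zero)
  qed
  then have "\<exists>u. g p = gen a u" for p
    by (intro generated_by_gen[OF a g]) blast
  then obtain u v where "g False = gen a u" "g True = gen a v" by blast
  then have "V = gen_field a (u + v)"
    unfolding Vf gen_field_def by (subst fg) (simp add: gen_add)
  then show ?thesis by blast
qed

theorem theorem4p13: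
  fixes a :: complex
  assumes "a \<noteq> 0" and "a \<noteq> -1"
  shows "\<exists>\<Phi>. lie_superalgebra_iso (D21_bracket a) (contact_symmetries a) \<Phi>"
proof (intro exI[of _ "gen_field a"])
  have "range (gen_field a) = contact_symmetries a"
    using gen_field_symmetry[OF assms(2)] symmetry_gen_field[OF assms(2)] by blast
  then have "bij_betw (gen_field a) UNIV (contact_symmetries a)"
    using inj_gen_field by (simp add: bij_betw_def)
  moreover have "gen_field a (gamma_scal k u) = vf_scal k (gen_field a u)" for k u
    by (simp add: gen_field_def gen_scal prolong_contact_scal)
  ultimately show "lie_superalgebra_iso (D21_bracket a) (contact_symmetries a) (gen_field a)"
    unfolding lie_superalgebra_iso_def
    by (simp add: gen_field_add vf_part_gen_field gen_field_bracket)
qed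

end
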